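(* Let $N\ge2$, $R>0$, $\Omega=B(0,R)\subset\mathbb{R}^N$, let $P$ be an interior point of $B(0,R)$, and $\Omega_\varepsilon=B(0,R)\setminus B(P,\varepsilon)$. Then, for $\varepsilon>0$ small enough, $$\sharp\{\text{critical points of }\mathcal{R}_{\Omega_\varepsilon}\text{ in }\Omega_\varepsilon\}=\begin{cases}2&\text{if }P\neq0,\\ \infty&\text{if }P=0,\end{cases}$$ and if $P\ne0$ the two critical points are non-degenerate.
   Context: $\omega_N$ is the volume of the unit ball of $\mathbb{R}^N$. $B(x_0,r)$ is the ball with center $x_0$ and radius $r$; here $\Omega$ is the open ball and the removed ball $B(P,\varepsilon)$ is closed, so that $\Omega_\varepsilon$ is an open set; $\varepsilon$ is small enough that $B(P,\varepsilon)\subset\Omega$. For a smooth domain $D\subset\mathbb{R}^N$, $G_D(x,y)$ is the Green function of $-\Delta$ with zero Dirichlet condition on $\partial D$, written $G_D(x,y)=S(x,y)-H_D(x,y)$, where $S(x,y)=-\frac1{2\pi}\ln|x-y|$ if $N=2$ and $S(x,y)=\frac{1}{N(N-2)\omega_N}|x-y|^{2-N}$ if $N\ge3$; $H_D$ is the regular part (harmonic in each variable). The Robin function of $D$ is $\mathcal{R}_D(x)=H_D(x,x)$, $x\in D$. A critical point is non-degenerate if the Hessian matrix there is invertible. *)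

theory Defs
  imports "HOL-Analysis.Analysis"
begin

definition partial_deriv :: "'n \<Rightarrow> (real ^ 'n \<Rightarrow> real) \<Rightarrow> real ^ 'n \<Rightarrow> real" where
  "partial_deriv i f x = deriv (\<lambda>t. f (x + t *\<^sub>R axis i 1)) 0"

text \<open>The differentiability clauses are needed because \<^const>\<open>deriv\<close> is total: they guarantee
  that the partial derivatives below are genuine. For open \<open>U\<close> the whole condition is the usual
  class \<open>C\<^sup>2(U)\<close>.\<close>

definition C2_on :: "(real ^ 'n) set \<Rightarrow> (real ^ 'n \<Rightarrow> real) \<Rightarrow> bool" where
  "C2_on U f \<longleftrightarrow>
     (\<forall>x\<in>U. f differentiable (at x) \<and> (\<forall>i. partial_deriv i f differentiable (at x))) \<and>
     (\<forall>i j. continuous_on U (partial_deriv i (partial_deriv j f)))"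

definition laplacian :: "(real ^ 'n \<Rightarrow> real) \<Rightarrow> real ^ 'n \<Rightarrow> real" where
  "laplacian f x = (\<Sum>i\<in>UNIV. partial_deriv i (partial_deriv i f) x)"

definition harmonic_on :: "(real ^ 'n) set \<Rightarrow> (real ^ 'n \<Rightarrow> real) \<Rightarrow> bool" where
  "harmonic_on U f \<longleftrightarrow> C2_on U f \<and> (\<forall>x\<in>U. laplacian f x = 0)"

definition hessian :: "(real ^ 'n \<Rightarrow> real) \<Rightarrow> real ^ 'n \<Rightarrow> real ^ 'n ^ 'n" where
  "hessian f x = (\<chi> i j. partial_deriv i (partial_deriv j f) x)"

definition critical_point :: "(real ^ 'n \<Rightarrow> real) \<Rightarrow> real ^ 'n \<Rightarrow> bool" where
  "critical_point f x \<longleftrightarrow> (f has_derivative (\<lambda>_. 0)) (at x)"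

definition nondegenerate_critical_point :: "(real ^ 'n \<Rightarrow> real) \<Rightarrow> real ^ 'n \<Rightarrow> bool" where
  "nondegenerate_critical_point f x \<longleftrightarrow>
     critical_point f x \<and> (\<exists>U. open U \<and> x \<in> U \<and> C2_on U f) \<and> invertible (hessian f x)"

text \<open>The fundamental solution of \<open>-\<Delta>\<close> in dimension \<open>N = CARD('n) \<ge> 2\<close>; the volume of the
  unit ball is \<open>measure lborel (ball 0 1)\<close>.\<close>

definition fundamental_solution :: "real ^ 'n \<Rightarrow> real ^ 'n \<Rightarrow> real" where
  "fundamental_solution x y =
     (if CARD('n) = 2 then - (1 / (2 * pi)) * ln (norm (x - y))
      else 1 / (real CARD('n) * (real CARD('n) - 2) * measure lborel (ball (0 :: real ^ 'n) 1))
             * norm (x - y) powi (2 - int CARD('n)))"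

text \<open>Since \<open>-\<Delta> S(x,\<cdot>) = \<delta>\<^sub>x\<close>, the function \<open>G = S(x,\<cdot>) - h\<close> solves \<open>-\<Delta> G = \<delta>\<^sub>x\<close> in \<open>D\<close> with
  \<open>G = 0\<close> on the boundary exactly when \<open>h\<close> is harmonic in \<open>D\<close> and attains the boundary values
  \<open>S(x,\<cdot>)\<close> continuously. On a bounded open \<open>D\<close> this determines \<open>h\<close> on the closure of \<open>D\<close> by the
  maximum principle; the value \<open>0\<close> elsewhere only serves to make the total function unique.\<close>

definition regular_part :: "(real ^ 'n) set \<Rightarrow> real ^ 'n \<Rightarrow> real ^ 'n \<Rightarrow> real" where
  "regular_part D x = (THE h.
     harmonic_on D h \<and>
     continuous_on (closure D) h \<and>
     (\<forall>y\<in>frontier D. h y = fundamental_solution x y) \<and>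
     (\<forall>y. y \<notin> closure D \<longrightarrow> h y = 0))"

definition green_function :: "(real ^ 'n) set \<Rightarrow> real ^ 'n \<Rightarrow> real ^ 'n \<Rightarrow> real" where
  "green_function D x y = fundamental_solution x y - regular_part D x y"

definition robin_function :: "(real ^ 'n) set \<Rightarrow> real ^ 'n \<Rightarrow> real" where
  "robin_function D x = regular_part D x x"

end

theory Submission
  imports Defs
begin

text \<open>
  The group generated by the inversions in the two boundary spheres moves a source \<open>x\<close> along an orbit
  of image points, and every squared distance to an image is, up to a positive factor, a quadratic
  \<open>w|y - x|\<^sup>2 + a A(y) + b B(y)\<close>, where \<open>A\<close> and \<open>B\<close> are the two degenerate quadratics of the pencil spanned
  by the powers with respect to the spheres. Summing over the images gives the regular part explicitly (in
  dimension two only after pairing images and adding a multiple of \<open>ln (A/B)\<close>). On the diagonal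
  all distances become functions of the hyperbolic distance \<open>d\<close> to the hyperbolic centre of the hole, so
  the Robin function is an increasing function of \<open>\<Phi> = - ln (R\<^sup>2 - |x|\<^sup>2) + \<omega> (cosh d)\<close>.

  The first summand depends on the hyperbolic distance to \<open>0\<close> and the second one, strictly
  decreasing, on the distance to the centre of the hole. Hence critical points lie on the axis
  through \<open>0\<close> and \<open>P\<close>, unless \<open>P = 0\<close>, when \<open>\<Phi>\<close> is radial. As a function of hyperbolic arc length on the axis,
  \<open>\<Phi>\<close> is strictly convex on both sides of the hole and tends to infinity at all ends, so there is
  exactly one critical point on each side. Its Hessian is \<open>\<kappa> I + \<mu> u u\<^sup>T\<close>, with \<open>\<kappa> \<noteq> 0\<close> by the
  gradient equation and \<open>\<kappa> + \<mu> \<noteq> 0\<close> by convexity. Convexity in dimension at least three comes from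
  log-convexity, which passes to sums of the images.
\<close>

section \<open>Twice differentiable functions and the maximum principle\<close>

text \<open>No asymptotics in \<open>\<epsilon>\<close> enter: the count holds for every closed ball
  inside the open one. The geometric reason is that two disjoint nested spheres are conformally
  equivalent to concentric ones, where the images and the Robin function can be written down by
  radial symmetry. Its effect is carried by the pencil quadratics \<open>A\<close> and
  \<open>B\<close> in the original coordinates, and the conformal factor survives as a power of
  \<open>al\<close>. On the diagonal the images produce (2 al)^(2-N) times a function of d when N >
  2, and an added - ln (2 al) when N = 2. A logarithm therefore separates the two variables when N >
  2, which is why convexity has to be strengthened to log-convexity there. The difficulty is that
  the contribution of each group of images is a difference of powers, and log-convexity is not
  preserved by subtraction; it has to be recovered from an expansion in which all coefficients are
  nonnegative.\<close>

definition c2_with ::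
  "(real ^ 'n) set \<Rightarrow> (real ^ 'n \<Rightarrow> real) \<Rightarrow> (real ^ 'n \<Rightarrow> real ^ 'n) \<Rightarrow> (real ^ 'n \<Rightarrow> real ^ 'n ^ 'n) \<Rightarrow> bool"
  where "c2_with U f G H \<longleftrightarrow> open U \<and>
    (\<forall>x\<in>U. (f has_derivative (\<lambda>h. G x \<bullet> h)) (at x) \<and> (G has_derivative (\<lambda>h. H x *v h)) (at x)) \<and>
    continuous_on U H"

lemma c2_withI:
  assumes "open U" "\<And>x. x \<in> U \<Longrightarrow> (f has_derivative (\<lambda>h. G x \<bullet> h)) (at x)"
    "\<And>x. x \<in> U \<Longrightarrow> (G has_derivative (\<lambda>h. H x *v h)) (at x)" "continuous_on U H"
  shows "c2_with U f G H"
  using assms by (auto simp: c2_with_def)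

lemma c2_withD:
  assumes "c2_with U f G H"
  shows "open U" "\<And>x. x \<in> U \<Longrightarrow> (f has_derivative (\<lambda>h. G x \<bullet> h)) (at x)"
    "\<And>x. x \<in> U \<Longrightarrow> (G has_derivative (\<lambda>h. H x *v h)) (at x)" "continuous_on U H"
  using assms by (auto simp: c2_with_def)

section \<open>Partial derivatives read off from a gradient and a Hessian\<close>

lemma has_real_derivative_along_axis:
  fixes f :: "real ^ 'n \<Rightarrow> real"
  assumes "(f has_derivative f') (at (x + t *\<^sub>R axis i 1))"
  shows "((\<lambda>t. f (x + t *\<^sub>R axis i 1)) has_real_derivative f' (axis i 1)) (at t)"
proof -
  have "((\<lambda>t. x + t *\<^sub>R axis i (1::real)) has_derivative (\<lambda>h. h *\<^sub>R axis i 1)) (at t)"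
    by (auto intro!: derivative_eq_intros)
  from has_derivative_compose[OF this assms]
  have "((\<lambda>t. f (x + t *\<^sub>R axis i 1)) has_derivative (\<lambda>h. f' (h *\<^sub>R axis i 1))) (at t)" .
  moreover have "linear f'" using assms has_derivative_linear by blast
  ultimately show ?thesis
    by (simp add: has_field_derivative_def linear_scale mult.commute[of _ "f' _"])
qed

lemma partial_deriv_eq:
  fixes f :: "real ^ 'n \<Rightarrow> real"
  assumes "(f has_derivative f') (at x)"
  shows "partial_deriv i f x = f' (axis i 1)"
  unfolding partial_deriv_def
  using has_real_derivative_along_axis[of f f' x 0 i] assms by (simp add: DERIV_imp_deriv)

lemma c2_with_partial_deriv:
  assumes "c2_with U f G H" "x \<in> U"
  shows "partial_deriv i f x = G x $ i"
  using partial_deriv_eq[OF c2_withD(2)[OF assms], of i] by (simp add: inner_axis)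

lemma c2_with_partial_has_derivative:
  assumes "c2_with U f G H" "x \<in> U"
  shows "(partial_deriv i f has_derivative (\<lambda>h. (H x *v h) $ i)) (at x)"
proof -
  have "((\<lambda>x. G x $ i) has_derivative (\<lambda>h. (H x *v h) $ i)) (at x)"
    by (rule bounded_linear.has_derivative[OF bounded_linear_vec_nth])
       (rule c2_withD(3)[OF assms])
  then show ?thesis
    by (rule has_derivative_transform_within_open[OF _ c2_withD(1)[OF assms(1)] assms(2)])
       (simp add: c2_with_partial_deriv[OF assms(1)])
qed

lemma c2_with_second_partial:
  assumes "c2_with U f G H" "x \<in> U"
  shows "partial_deriv j (partial_deriv i f) x = H x $ i $ j"
  using partial_deriv_eq[OF c2_with_partial_has_derivative[OF assms], of j i]
  by (simp add: matrix_vector_mult_basis column_def)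

text \<open>Explicit gradient and Hessian fields combine more easily than iterated
  \<open>partial_deriv\<close>; this passes from them to the notion of the theorem.\<close>

lemma c2_with_C2_on:
  assumes "c2_with U f G H"
  shows "C2_on U f"
  unfolding C2_on_def
proof (intro conjI ballI allI)
  fix x i assume "x \<in> U"
  show "f differentiable at x"
    using c2_withD(2)[OF assms \<open>x \<in> U\<close>] by (auto simp: differentiable_def)
  show "partial_deriv i f differentiable at x"
    using c2_with_partial_has_derivative[OF assms \<open>x \<in> U\<close>] by (auto simp: differentiable_def)
next
  fix i j
  have "continuous_on U (\<lambda>x. H x $ j $ i)"
    by (intro continuous_intros c2_withD(4)[OF assms])
  then show "continuous_on U (partial_deriv i (partial_deriv j f))"
    by (rule continuous_on_eq) (simp add: c2_with_second_partial[OF assms])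
qed

lemma c2_with_laplacian:
  assumes "c2_with U f G H" "x \<in> U"
  shows "laplacian f x = trace (H x)"
  by (simp add: laplacian_def trace_def c2_with_second_partial[OF assms])

lemma c2_with_hessian:
  assumes "c2_with U f G H" "x \<in> U"
  shows "hessian f x = transpose (H x)"
  by (simp add: hessian_def transpose_def c2_with_second_partial[OF assms])

lemma c2_with_critical_point:
  assumes "c2_with U f G H" "x \<in> U"
  shows "critical_point f x \<longleftrightarrow> G x = 0"
proof
  assume "critical_point f x"
  then have "(\<lambda>h. G x \<bullet> h) = (\<lambda>_. 0)"
    unfolding critical_point_def using has_derivative_unique c2_withD(2)[OF assms] by blast
  then show "G x = 0" by (metis inner_eq_zero_iff)
next
  assume "G x = 0"
  then show "critical_point f x" 
    unfolding critical_point_def using c2_withD(2)[OF assms] by simp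
qed

section \<open>Closure rules for explicit gradients and Hessians\<close>

lemma c2_with_cong:
  assumes "c2_with U f G H" "\<And>x. x \<in> U \<Longrightarrow> f x = f' x"
  shows "c2_with U f' G H"
proof (rule c2_withI)
  fix x assume x: "x \<in> U"
  show "(f' has_derivative (\<lambda>h. G x \<bullet> h)) (at x)"
    using has_derivative_transform_within_open[OF c2_withD(2)[OF assms(1) x] c2_withD(1)[OF assms(1)] x]
      assms(2) by blast
qed (use c2_withD[OF assms(1)] in auto)

lemma c2_with_const: "open U \<Longrightarrow> c2_with U (\<lambda>_. k) (\<lambda>_. 0) (\<lambda>_. 0)"
  by (rule c2_withI) (auto)

lemma c2_with_add:
  assumes "c2_with U f G H" "c2_with U f' G' H'"
  shows "c2_with U (\<lambda>x. f x + f' x) (\<lambda>x. G x + G' x) (\<lambda>x. H x + H' x)"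
proof (rule c2_withI)
  fix x assume x: "x \<in> U"
  note d = c2_withD[OF assms(1)] c2_withD[OF assms(2)]
  show "((\<lambda>x. f x + f' x) has_derivative (\<lambda>h. (G x + G' x) \<bullet> h)) (at x)"
    using has_derivative_add[OF d(2)[OF x] d(6)[OF x]] by (simp add: inner_add_left[symmetric])
  show "((\<lambda>x. G x + G' x) has_derivative (\<lambda>h. (H x + H' x) *v h)) (at x)"
    using has_derivative_add[OF d(3)[OF x] d(7)[OF x]] by (simp add: matrix_vector_mult_add_rdistrib[symmetric])
qed (use c2_withD[OF assms(1)] c2_withD[OF assms(2)] in \<open>auto intro!: continuous_on_add\<close>)

lemma c2_with_scale:
  assumes "c2_with U f G H"
  shows "c2_with U (\<lambda>x. k * f x) (\<lambda>x. k *\<^sub>R G x) (\<lambda>x. k *\<^sub>R H x)"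
proof (rule c2_withI)
  fix x assume x: "x \<in> U"
  note d = c2_withD[OF assms(1)]
  show "((\<lambda>x. k * f x) has_derivative (\<lambda>h. (k *\<^sub>R G x) \<bullet> h)) (at x)"
    using has_derivative_mult_right[OF d(2)[OF x], of k] by simp
  show "((\<lambda>x. k *\<^sub>R G x) has_derivative (\<lambda>h. (k *\<^sub>R H x) *v h)) (at x)"
    using has_derivative_scaleR_right[OF d(3)[OF x], of k] by (simp add: scaleR_matrix_vector_assoc)
qed (use c2_withD[OF assms(1)] in \<open>auto intro!: continuous_intros\<close>)

definition outer :: "real ^ 'n \<Rightarrow> real ^ 'n \<Rightarrow> real ^ 'n ^ 'n" where
  "outer a b = (\<chi> i j. a $ i * b $ j)"

lemma outer_mult_vec: "outer a b *v h = (b \<bullet> h) *\<^sub>R a"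
  by (simp add: vec_eq_iff outer_def matrix_vector_mult_def inner_vec_def sum_distrib_left sum_distrib_right mult_ac)

lemma trace_outer: "trace (outer a b) = a \<bullet> b"
  by (simp add: trace_def outer_def inner_vec_def)

lemma continuous_on_outer [continuous_intros]:
  "continuous_on U a \<Longrightarrow> continuous_on U b \<Longrightarrow> continuous_on U (\<lambda>x. outer (a x) (b x))"
  unfolding outer_def by (intro continuous_intros)

lemma c2_with_gradient_continuous:
  assumes "c2_with U f G H" shows "continuous_on U G" "continuous_on U f"
  using c2_withD(1-3)[OF assms] has_derivative_continuous
  by (metis continuous_at_imp_continuous_on)+

text \<open>The rank-one summand is the source of the shape \<kappa> I + \<mu> u u^T at the end:
  wherever the inner gradients are all parallel to u, so are their outer products.\<close>

lemma c2_with_compose: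
  assumes f: "c2_with U f G H"
    and g: "\<And>x. x \<in> U \<Longrightarrow> (g has_real_derivative g1 (f x)) (at (f x))"
    and g1: "\<And>x. x \<in> U \<Longrightarrow> (g1 has_real_derivative g2 (f x)) (at (f x))"
    and g2: "continuous_on (f ` U) g2"
  shows "c2_with U (\<lambda>x. g (f x)) (\<lambda>x. g1 (f x) *\<^sub>R G x)
           (\<lambda>x. g1 (f x) *\<^sub>R H x + g2 (f x) *\<^sub>R outer (G x) (G x))"
proof (rule c2_withI)
  fix x assume x: "x \<in> U"
  note d = c2_withD[OF f]
  show "((\<lambda>x. g (f x)) has_derivative (\<lambda>h. g1 (f x) *\<^sub>R G x \<bullet> h)) (at x)"
    using has_derivative_compose[OF d(2)[OF x] g[OF x, unfolded has_field_derivative_def]]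
    by simp
  have "((\<lambda>x. g1 (f x)) has_derivative (\<lambda>h. g2 (f x) * (G x \<bullet> h))) (at x)"
    using has_derivative_compose[OF d(2)[OF x] g1[OF x, unfolded has_field_derivative_def]]
    by simp
  then show "((\<lambda>x. g1 (f x) *\<^sub>R G x) has_derivative
        (\<lambda>h. (g1 (f x) *\<^sub>R H x + g2 (f x) *\<^sub>R outer (G x) (G x)) *v h)) (at x)"
    using has_derivative_scaleR[OF _ d(3)[OF x]]
    by (simp add: matrix_vector_mult_add_rdistrib scaleR_matrix_vector_assoc[symmetric] outer_mult_vec)
next
  have c1: "continuous_on U (\<lambda>x. g1 (f x))"
    by (rule continuous_on_compose2[of "f ` U" g1])
       (use g1 DERIV_isCont c2_with_gradient_continuous[OF f] in \<open>auto intro!: continuous_at_imp_continuous_on\<close>)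
  have c2: "continuous_on U (\<lambda>x. g2 (f x))"
    using continuous_on_compose2[OF g2 c2_with_gradient_continuous(2)[OF f]] by blast
  show "continuous_on U (\<lambda>x. g1 (f x) *\<^sub>R H x + g2 (f x) *\<^sub>R outer (G x) (G x))"
    by (intro continuous_intros c1 c2 c2_withD(4)[OF f] c2_with_gradient_continuous[OF f])
qed (use c2_withD[OF f] in auto)

text \<open>Powers with respect to spheres and squared distances to points are of this form, and so
  is every combination of them; all potentials below are functions of such quadratics.\<close>

definition quad :: "real \<Rightarrow> real ^ 'n \<Rightarrow> real \<Rightarrow> real ^ 'n \<Rightarrow> real" where
  "quad k b c y = k * (y \<bullet> y) + b \<bullet> y + c"

lemma c2_with_quad:
  "open U \<Longrightarrow> c2_with U (quad k b c) (\<lambda>y. (2 * k) *\<^sub>R y + b) (\<lambda>_. (2 * k) *\<^sub>R mat 1)"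
  unfolding quad_def
  by (rule c2_withI)
     (auto intro!: derivative_eq_intros simp: fun_eq_iff algebra_simps inner_commute scaleR_matrix_vector_assoc[symmetric])

section \<open>Maximum principle and uniqueness of the regular part\<close>

lemma local_min_second_derivative:
  fixes \<phi> :: "real \<Rightarrow> real"
  assumes "\<delta> > 0" and d: "\<And>t. \<bar>t - a\<bar> < \<delta> \<Longrightarrow> (\<phi> has_real_derivative \<phi>' t) (at t)"
    and d2: "(\<phi>' has_real_derivative k) (at a)"
    and le: "\<And>t. \<bar>t - a\<bar> < \<delta> \<Longrightarrow> \<phi> a \<le> \<phi> t"
  shows "k \<ge> 0"
proof (rule ccontr)
  assume "\<not> k \<ge> 0"
  then have k: "k < 0" by simp
  have z: "\<phi>' a = 0"
    by (rule DERIV_local_min[OF d assms(1)]) (use assms(1) le in \<open>auto simp: abs_minus_commute\<close>)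
  \<comment> \<open>A negative second derivative makes \<open>\<phi>'\<close>, zero at a, negative
    just to the right; the mean value theorem then yields a smaller value of
    \<open>\<phi>\<close>.\<close>
  obtain d0 where d0: "d0 > 0" "\<And>h. h > 0 \<Longrightarrow> h < d0 \<Longrightarrow> \<phi>' (a + h) < 0"
    using DERIV_neg_dec_right[OF d2 k] z by auto
  define h where "h = min (\<delta>/2) (d0/2)"
  have h: "h > 0" "h < \<delta>" "h < d0" using assms(1) d0 by (auto simp: h_def)
  have "\<exists>z. a < z \<and> z < a + h \<and> \<phi> (a + h) - \<phi> a = ((a + h) - a) * \<phi>' z"
    by (rule MVT2) (use h d in auto)
  then obtain z where z: "a < z" "z < a + h" "\<phi> (a + h) - \<phi> a = h * \<phi>' z" by auto
  have "\<phi>' z < 0" using d0(2)[of "z - a"] z h by auto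
  then have "\<phi> (a + h) < \<phi> a" using z h by (smt (verit) mult_pos_neg)
  then show False using le[of "a + h"] h by auto
qed

lemma C2_on_diff_has_partials:
  assumes "C2_on U f" "x \<in> U"
  shows "(f has_derivative (frechet_derivative f (at x))) (at x)"
    "(partial_deriv i f has_derivative (frechet_derivative (partial_deriv i f) (at x))) (at x)"
  using assms by (auto simp: C2_on_def frechet_derivative_works[symmetric])

text \<open>On a line in a coordinate direction the interior maximum becomes a one-variable minimum
  of the negated function.\<close>

lemma C2_on_second_partial_le_at_max:
  fixes h :: "real ^ 'n \<Rightarrow> real"
  assumes C2: "C2_on D h" and "open D" "z \<in> D"
    and max: "\<And>y. y \<in> D \<Longrightarrow> h y + k * (y \<bullet> y) \<le> h z + k * (z \<bullet> z)"
  shows "partial_deriv i (partial_deriv i h) z + 2 * k \<le> 0"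
proof -
  obtain r where r: "r > 0" "ball z r \<subseteq> D" using \<open>open D\<close> \<open>z \<in> D\<close> by (meson open_contains_ball)
  define pt where "pt t = z + t *\<^sub>R axis i (1::real)" for t
  have pt: "pt t \<in> D" if "\<bar>t\<bar> < r" for t
    using that r by (auto simp: pt_def dist_norm norm_axis_1 intro!: subsetD[OF r(2)])
  have sq: "pt t \<bullet> pt t = z \<bullet> z + 2 * t * z $ i + t\<^sup>2" for t
    by (simp add: pt_def inner_add_left inner_add_right inner_axis inner_axis' power2_eq_square algebra_simps)
  define \<phi> where "\<phi> t = - (h (pt t) + k * (z \<bullet> z + 2 * t * z $ i + t\<^sup>2))" for t
  define \<phi>' where "\<phi>' t = - (partial_deriv i h (pt t) + k * (2 * z $ i + 2 * t))" for t
  have "- (partial_deriv i (partial_deriv i h) z + 2 * k) \<ge> 0"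
  proof (rule local_min_second_derivative[OF r(1), of 0 \<phi> \<phi>'])
    fix t assume t: "\<bar>t - 0\<bar> < r"
    have "((\<lambda>t. h (pt t)) has_real_derivative partial_deriv i h (pt t)) (at t)"
      using has_real_derivative_along_axis[of h _ z t i, OF C2_on_diff_has_partials(1)[OF C2]]
        partial_deriv_eq[OF C2_on_diff_has_partials(1)[OF C2], of "pt t" i] pt[of t] t
      by (simp add: pt_def)
    then show "(\<phi> has_real_derivative \<phi>' t) (at t)"
      unfolding \<phi>_def \<phi>'_def by (auto intro!: derivative_eq_intros)
    show "\<phi> 0 \<le> \<phi> t"
      using max[OF pt[of t]] t unfolding \<phi>_def sq by (simp add: pt_def)
  next
    have "((\<lambda>t. partial_deriv i h (pt t)) has_real_derivative partial_deriv i (partial_deriv i h) (pt 0)) (at 0)"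
      using has_real_derivative_along_axis[of "partial_deriv i h" _ z 0 i, OF C2_on_diff_has_partials(2)[OF C2]]
        partial_deriv_eq[OF C2_on_diff_has_partials(2)[OF C2], of "pt 0" i i] pt[of 0] r
      by (simp add: pt_def)
    then show "(\<phi>' has_real_derivative - (partial_deriv i (partial_deriv i h) z + 2 * k)) (at 0)"
      unfolding \<phi>'_def by (auto intro!: derivative_eq_intros simp: pt_def)
  qed
  then show ?thesis by simp
qed

text \<open>The perturbation h + k |y|^2 has Laplacian 2 k N > 0, whereas at an interior maximum
  every pure second partial is at most 0.\<close>

lemma harmonic_max_principle:
  fixes h :: "real ^ 'n \<Rightarrow> real"
  assumes "open D" "bounded D" "harmonic_on D h" "continuous_on (closure D) h"
    and bdry: "\<And>y. y \<in> frontier D \<Longrightarrow> h y \<le> 0" and "x \<in> D"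
  shows "h x \<le> 0"
proof (rule ccontr)
  assume "\<not> h x \<le> 0"
  then have pos: "h x > 0" by simp
  have comp: "compact (closure D)" using assms(2) by (simp add: compact_closure)
  obtain M where M: "\<And>y. y \<in> closure D \<Longrightarrow> norm y \<le> M"
    using compact_imp_bounded[OF comp] by (auto simp: bounded_iff)
  have M0: "M \<ge> 0" using M[of x] \<open>x \<in> D\<close> closure_subset norm_ge_zero by (meson order_trans subsetD)
  \<comment> \<open>Small enough that k |z|^2 < h x on the closure, so that the maximum of the
    perturbed function cannot sit on the frontier, where h <= 0; the summand 1 keeps the denominator
    positive even for M = 0.\<close>
  define k where "k = h x / (2 * (M\<^sup>2 + 1))"
  have k: "k > 0" using pos by (simp add: k_def add_nonneg_pos)
  have "2 * (k * (M\<^sup>2 + 1)) = h x" 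
    unfolding k_def using add_nonneg_pos[of "M\<^sup>2" 1] by (simp add: field_simps)
  then have kM: "k * M\<^sup>2 < h x" using pos k by (simp add: algebra_simps)
  have "\<exists>z\<in>closure D. \<forall>y\<in>closure D. h y + k * (y \<bullet> y) \<le> h z + k * (z \<bullet> z)"
    by (rule continuous_attains_sup[OF comp])
       (use \<open>x \<in> D\<close> closure_subset in \<open>auto intro!: continuous_intros assms(4)\<close>)
  then obtain z where z: "z \<in> closure D" "\<And>y. y \<in> closure D \<Longrightarrow> h y + k * (y \<bullet> y) \<le> h z + k * (z \<bullet> z)"
    by blast
  have "h x \<le> h x + k * (x \<bullet> x)" using k by simp
  also have "\<dots> \<le> h z + k * (z \<bullet> z)" using z(2)[of x] \<open>x \<in> D\<close> closure_subset by blast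
  finally have hz: "h x \<le> h z + k * (z \<bullet> z)" .
  have zz: "z \<bullet> z \<le> M\<^sup>2" using M[OF z(1)] M0 by (simp add: dot_square_norm power_mono)
  have "z \<in> D"
  proof (rule ccontr)
    assume "z \<notin> D"
    then have "z \<in> frontier D" using z(1) \<open>open D\<close> by (simp add: frontier_def interior_open)
    then have "h z \<le> 0" by (rule bdry)
    moreover have "k * (z \<bullet> z) \<le> k * M\<^sup>2" using k zz by simp
    ultimately show False using hz kM by linarith
  qed
  have C2: "C2_on D h" using assms(3) by (simp add: harmonic_on_def)
  have "partial_deriv i (partial_deriv i h) z + 2 * k \<le> 0" for i
    by (rule C2_on_second_partial_le_at_max[OF C2 \<open>open D\<close> \<open>z \<in> D\<close>]) (use z(2) closure_subset in blast)
  then have "(\<Sum>i\<in>UNIV. partial_deriv i (partial_deriv i h) z) \<le> (\<Sum>i\<in>(UNIV::'n set). - 2 * k)"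
    by (intro sum_mono) (simp add: algebra_simps, smt (verit))
  also have "\<dots> < 0" using k by simp
  finally have "laplacian h z < 0" by (simp add: laplacian_def)
  then show False using assms(3) \<open>z \<in> D\<close> by (simp add: harmonic_on_def)
qed

text \<open>Uniqueness must face an arbitrary harmonic competitor, known only through
  \<open>C2_on\<close>. That notion asks for differentiability of f and of its partials, not just
  existence of partials, so Frechet derivatives can be assembled.\<close>

lemma C2_on_imp_c2_with:
  fixes f :: "real ^ 'n \<Rightarrow> real"
  assumes "open U" "C2_on U f"
  shows "c2_with U f (\<lambda>x. \<chi> i. partial_deriv i f x) (\<lambda>x. \<chi> i j. partial_deriv j (partial_deriv i f) x)"
proof (rule c2_withI)
  have grad: "(g has_derivative (\<lambda>h. (\<chi> i. partial_deriv i g x) \<bullet> h)) (at x)"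
    if gd: "g differentiable (at x)" for g :: "real ^ 'n \<Rightarrow> real" and x
  proof -
    obtain g' where g': "(g has_derivative g') (at x)" using gd unfolding differentiable_def by blast
    have lin: "linear g'" using g' has_derivative_linear by blast
    have "g' = (\<lambda>h. (\<chi> i. partial_deriv i g x) \<bullet> h)"
    proof
      fix h :: "real ^ 'n"
      have "g' h = g' (\<Sum>i\<in>UNIV. h $ i *s axis i 1)" by (simp add: basis_expansion)
      also have "\<dots> = (\<Sum>i\<in>UNIV. h $ i * g' (axis i 1))"
        using lin by (simp add: linear_sum linear_scale scalar_mult_eq_scaleR)
      also have "\<dots> = (\<chi> i. partial_deriv i g x) \<bullet> h"
        by (simp add: inner_vec_def partial_deriv_eq[OF g'] mult.commute)
      finally show "g' h = (\<chi> i. partial_deriv i g x) \<bullet> h" .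
    qed
    with g' show ?thesis by simp
  qed
  fix x assume x: "x \<in> U"
  show "(f has_derivative (\<lambda>h. (\<chi> i. partial_deriv i f x) \<bullet> h)) (at x)"
    by (rule grad) (use assms x in \<open>auto simp: C2_on_def\<close>)
  show "((\<lambda>x. \<chi> i. partial_deriv i f x) has_derivative
         (\<lambda>h. (\<chi> i j. partial_deriv j (partial_deriv i f) x) *v h)) (at x)"
  proof (subst has_derivative_componentwise_within, intro ballI)
    fix b :: "real ^ 'n" assume "b \<in> Basis"
    then obtain i where b: "b = axis i 1" by (auto simp: Basis_vec_def)
    have "(partial_deriv i f has_derivative (\<lambda>h. (\<chi> j. partial_deriv j (partial_deriv i f) x) \<bullet> h)) (at x)"
      by (rule grad) (use assms x in \<open>auto simp: C2_on_def\<close>)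
    then have "(partial_deriv i f has_derivative (\<lambda>h. \<Sum>j\<in>UNIV. partial_deriv j (partial_deriv i f) x * h $ j)) (at x)"
      by (simp add: inner_vec_def)
    then show "((\<lambda>x. (\<chi> i. partial_deriv i f x) \<bullet> b) has_derivative
         (\<lambda>h. ((\<chi> i j. partial_deriv j (partial_deriv i f) x) *v h) \<bullet> b)) (at x)"
      by (simp add: b inner_axis matrix_vector_mult_def)
  qed
qed (use assms in \<open>auto simp: C2_on_def intro!: continuous_intros\<close>)

lemma c2_with_harmonic_on:
  assumes "c2_with U f G H" "\<And>x. x \<in> U \<Longrightarrow> trace (H x) = 0"
  shows "harmonic_on U f"
  using assms by (simp add: harmonic_on_def c2_with_C2_on c2_with_laplacian)

lemma harmonic_on_diff:
  assumes "open U" "harmonic_on U f" "harmonic_on U g"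
  shows "harmonic_on U (\<lambda>x. f x - g x)"
proof -
  note c = C2_on_imp_c2_with[OF assms(1)]
  have f: "C2_on U f" and g: "C2_on U g" using assms by (auto simp: harmonic_on_def)
  have *: "c2_with U (\<lambda>x. f x + (- 1) * g x)
     (\<lambda>x. (\<chi> i. partial_deriv i f x) + (- 1) *\<^sub>R (\<chi> i. partial_deriv i g x))
     (\<lambda>x. (\<chi> i j. partial_deriv j (partial_deriv i f) x) + (- 1) *\<^sub>R (\<chi> i j. partial_deriv j (partial_deriv i g) x))"
    by (rule c2_with_add[OF c[OF f] c2_with_scale[OF c[OF g]]])
  have "harmonic_on U (\<lambda>x. f x + (- 1) * g x)"
  proof (rule c2_with_harmonic_on[OF *])
    fix x assume "x \<in> U"
    then have "laplacian f x = 0" "laplacian g x = 0" using assms by (auto simp: harmonic_on_def)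
    then show "trace ((\<chi> i j. partial_deriv j (partial_deriv i f) x) + (- 1) *\<^sub>R (\<chi> i j. partial_deriv j (partial_deriv i g) x)) = 0"
      by (simp add: trace_def laplacian_def sum_subtractf)
  qed
  then show ?thesis by simp
qed

lemma harmonic_on_unique:
  fixes h :: "real ^ 'n \<Rightarrow> real"
  assumes "open D" "bounded D" "harmonic_on D h" "continuous_on (closure D) h"
    "harmonic_on D k" "continuous_on (closure D) k"
    "\<And>y. y \<in> frontier D \<Longrightarrow> h y = k y" "x \<in> D"
  shows "h x = k x"
proof -
  have "h x - k x \<le> 0"
    by (rule harmonic_max_principle[OF assms(1,2) harmonic_on_diff[OF assms(1,3,5)]])
       (use assms in \<open>auto intro!: continuous_intros\<close>)
  moreover have "k x - h x \<le> 0"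
    by (rule harmonic_max_principle[OF assms(1,2) harmonic_on_diff[OF assms(1,5,3)]])
       (use assms in \<open>auto intro!: continuous_intros\<close>)
  ultimately show ?thesis by simp
qed

text \<open>Turns the definite description into a verification: inside by the maximum principle, on
  the frontier by the data, elsewhere by the convention 0.\<close>

lemma regular_part_eqI:
  assumes "open D" "bounded D" "harmonic_on D h" "continuous_on (closure D) h"
    "\<And>y. y \<in> frontier D \<Longrightarrow> h y = fundamental_solution x y"
    "\<And>y. y \<notin> closure D \<Longrightarrow> h y = 0"
  shows "regular_part D x = h"
  unfolding regular_part_def
proof (rule the_equality)
  fix k assume k: "harmonic_on D k \<and> continuous_on (closure D) k \<and>
     (\<forall>y\<in>frontier D. k y = fundamental_solution x y) \<and> (\<forall>y. y \<notin> closure D \<longrightarrow> k y = 0)"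
  show "k = h"
  proof
    fix y
    have D: "closure D = D \<union> frontier D"
      by (simp add: Un_commute closure_Un_frontier)
    consider "y \<in> D" | "y \<in> frontier D" | "y \<notin> closure D" using D by blast
    then show "k y = h y"
      by cases (use k assms harmonic_on_unique[of D k h y] in auto)
  qed
qed (use assms in auto)

section \<open>Termwise differentiation of series\<close>

lemma norm_matrix_vector_mult_le:
  fixes A :: "real ^ 'n ^ 'm"
  shows "norm (A *v h) \<le> norm A * norm h"
proof -
  have "norm (A *v h) = L2_set (\<lambda>i. norm (A $ i \<bullet> h)) UNIV"
    by (simp add: norm_vec_def matrix_vector_mult_def inner_vec_def)
  also have "\<dots> \<le> L2_set (\<lambda>i. norm (A $ i) * norm h) UNIV"
    by (intro L2_set_mono) (auto simp: Cauchy_Schwarz_ineq2)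
  also have "\<dots> = norm A * norm h"
    by (simp add: L2_set_left_distrib norm_vec_def[of A])
  finally show ?thesis .
qed

text \<open>The derivative is \<open>op\<close> applied to a coefficient, so uniform convergence of
  the coefficients suffices, and the bound with constant 1 converts it into an estimate by e * norm
  h. Used with the inner product for gradients, the matrix action for Hessians and multiplication on
  the line.\<close>

lemma has_derivative_series_bilinear:
  fixes f :: "nat \<Rightarrow> 'a::real_normed_vector \<Rightarrow> 'b::banach" and g :: "nat \<Rightarrow> 'a \<Rightarrow> 'c::banach"
  assumes "open U" and bil: "bounded_bilinear op" and op: "\<And>a h. norm (op a h) \<le> norm a * norm h"
    and der: "\<And>n x. x \<in> U \<Longrightarrow> (f n has_derivative op (g n x)) (at x)"
    and fM: "\<And>n x. x \<in> U \<Longrightarrow> norm (f n x) \<le> M n"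
    and gM: "\<And>n x. x \<in> U \<Longrightarrow> norm (g n x) \<le> M n"
    and "summable M" and "x \<in> U"
  shows "((\<lambda>x. \<Sum>n. f n x) has_derivative op (\<Sum>n. g n x)) (at x)"
proof -
  interpret bounded_bilinear op by (rule bil)
  obtain r where r: "r > 0" "ball x r \<subseteq> U" using \<open>open U\<close> \<open>x \<in> U\<close> by (meson open_contains_ball)
  have ul: "uniform_limit U (\<lambda>n x. \<Sum>i<n. g i x) (\<lambda>x. \<Sum>i. g i x) sequentially"
    by (rule Weierstrass_m_test[OF gM \<open>summable M\<close>])
  have sm: "summable (\<lambda>n. f n y)" if "y \<in> U" for y
    by (rule summable_comparison_test'[OF \<open>summable M\<close>, of 0]) (use fM that in auto)
  have "\<exists>F. \<forall>y\<in>ball x r. (\<lambda>n. f n y) sums (F y) \<and> (F has_derivative op (\<Sum>n. g n y)) (at y within ball x r)"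
  proof (rule has_derivative_series)
    show "(f n has_derivative op (g n y)) (at y within ball x r)" if "y \<in> ball x r" for n y
      by (rule has_derivative_at_withinI, rule der) (use r that in blast)
    show "(\<lambda>n. f n x) sums (\<Sum>n. f n x)" using sm \<open>x \<in> U\<close> by (simp add: summable_sums)
    fix e :: real assume "e > 0"
    have "\<forall>\<^sub>F n in sequentially. \<forall>y\<in>U. dist (\<Sum>i<n. g i y) (\<Sum>i. g i y) < e"
      using ul \<open>e > 0\<close> by (rule uniform_limitD)
    then show "\<forall>\<^sub>F n in sequentially. \<forall>y\<in>ball x r. \<forall>h. norm ((\<Sum>i<n. op (g i y) h) - op (\<Sum>i. g i y) h) \<le> e * norm h"
    proof (eventually_elim, intro ballI allI)
      fix n y h assume *: "\<forall>y\<in>U. dist (\<Sum>i<n. g i y) (\<Sum>i. g i y) < e" and y: "y \<in> ball x r"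
      have "norm ((\<Sum>i<n. op (g i y) h) - op (\<Sum>i. g i y) h) = norm (op ((\<Sum>i<n. g i y) - (\<Sum>i. g i y)) h)"
        by (simp add: diff_left sum_left)
      also have "\<dots> \<le> norm ((\<Sum>i<n. g i y) - (\<Sum>i. g i y)) * norm h" by (rule op)
      also have "\<dots> \<le> e * norm h"
        by (rule mult_right_mono) (use * y r in \<open>auto simp: dist_norm intro!: less_imp_le\<close>)
      finally show "norm ((\<Sum>i<n. op (g i y) h) - op (\<Sum>i. g i y) h) \<le> e * norm h" .
    qed
  qed (use r in auto)
  then obtain F where F: "\<And>y. y \<in> ball x r \<Longrightarrow> (\<lambda>n. f n y) sums (F y)"
    "\<And>y. y \<in> ball x r \<Longrightarrow> (F has_derivative op (\<Sum>n. g n y)) (at y within ball x r)" by blast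
  have "(F has_derivative op (\<Sum>n. g n x)) (at x)"
    using F(2)[of x] r by (simp add: at_within_open[of x "ball x r"])
  then show ?thesis
    by (rule has_derivative_transform_within_open[of _ _ _ _ "ball x r"])
       (use r F(1) in \<open>auto simp: sums_iff\<close>)
qed

lemma c2_with_series:
  fixes F :: "nat \<Rightarrow> real ^ 'n \<Rightarrow> real"
  assumes c2: "\<And>n. c2_with U (F n) (G n) (H n)" and "summable M"
    and "\<And>n x. x \<in> U \<Longrightarrow> \<bar>F n x\<bar> \<le> M n" "\<And>n x. x \<in> U \<Longrightarrow> norm (G n x) \<le> M n"
    "\<And>n x. x \<in> U \<Longrightarrow> norm (H n x) \<le> M n"
  shows "c2_with U (\<lambda>x. \<Sum>n. F n x) (\<lambda>x. \<Sum>n. G n x) (\<lambda>x. \<Sum>n. H n x)"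
proof (rule c2_withI)
  note d = c2_withD[OF c2]
  fix x assume x: "x \<in> U"
  show "((\<lambda>x. \<Sum>n. F n x) has_derivative (\<lambda>h. (\<Sum>n. G n x) \<bullet> h)) (at x)"
    by (rule has_derivative_series_bilinear[OF d(1) bounded_bilinear_inner _ d(2), where M = M])
       (use assms x in \<open>auto simp: Cauchy_Schwarz_ineq2\<close>)
  have "bounded_bilinear (\<lambda>(A :: real ^ 'n ^ 'n) h. A *v h)"
  proof
    show "\<exists>K. \<forall>(A :: real ^ 'n ^ 'n) h. norm (A *v h) \<le> norm A * norm h * K"
      using norm_matrix_vector_mult_le by (intro exI[of _ 1]) auto
  qed (auto simp: matrix_vector_mult_add_rdistrib matrix_vector_right_distrib
        scaleR_matrix_vector_assoc matrix_vector_mult_scaleR)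
  then show "((\<lambda>x. \<Sum>n. G n x) has_derivative (\<lambda>h. (\<Sum>n. H n x) *v h)) (at x)"
    by (rule has_derivative_series_bilinear[OF d(1) _ norm_matrix_vector_mult_le d(3), where M = M])
       (use assms x in auto)
next
  show "continuous_on U (\<lambda>x. \<Sum>n. H n x)"
  proof (rule uniform_limit_theorem)
    show "uniform_limit U (\<lambda>n x. \<Sum>i<n. H i x) (\<lambda>x. \<Sum>n. H n x) sequentially"
      by (rule Weierstrass_m_test) (use assms in auto)
  qed (auto intro!: always_eventually continuous_intros c2_withD(4)[OF c2])
qed (use c2_withD(1)[OF c2] in auto)

lemma trace_suminf:
  fixes H :: "nat \<Rightarrow> real ^ 'n ^ 'n"
  assumes "summable H" "\<And>n. trace (H n) = 0"
  shows "trace (\<Sum>n. H n) = 0"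
proof -
  have "bounded_linear (trace :: real ^ 'n ^ 'n \<Rightarrow> real)"
    unfolding linear_conv_bounded_linear[symmetric]
    by (rule linearI) (simp_all add: trace_def sum.distrib sum_distrib_left)
  from bounded_linear.suminf[OF this assms(1)] assms(2) show ?thesis by simp
qed

section \<open>Null quadratics and the two spheres\<close>

text \<open>The fundamental solution as a function of the squared distance, normalised so that its derivative is
  \<open>- D powr (-N/2) / 2\<close> in every dimension.\<close>

definition green_profile :: "nat \<Rightarrow> real \<Rightarrow> real" where
  "green_profile N D = (if N = 2 then - ln D / 2 else D powr (1 - real N / 2) / (real N - 2))"

definition green_profile1 :: "nat \<Rightarrow> real \<Rightarrow> real" where
  "green_profile1 N D = - (D powr (- real N / 2)) / 2"

definition green_profile2 :: "nat \<Rightarrow> real \<Rightarrow> real" where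
  "green_profile2 N D = real N / 4 * D powr (- real N / 2 - 1)"

lemma green_profile_derivs:
  assumes "D > 0"
  shows "(green_profile N has_real_derivative green_profile1 N D) (at D)"
    "(green_profile1 N has_real_derivative green_profile2 N D) (at D)"
    "(green_profile2 N has_real_derivative (- (real N / 4) * (real N / 2 + 1) * D powr (- real N / 2 - 2))) (at D)"
proof -
  show "(green_profile N has_real_derivative green_profile1 N D) (at D)"
  proof (cases "N = 2")
    case True
    then show ?thesis unfolding green_profile_def[abs_def] green_profile1_def using assms
      by (auto intro!: derivative_eq_intros simp: powr_minus divide_simps)
  next
    case False
    then have *: "(1 - real N / 2) / (real N - 2) = - 1 / 2" by (simp add: field_simps)
    have "((\<lambda>D. D powr (1 - real N / 2) / (real N - 2)) has_real_derivative
        (1 - real N / 2) * D powr (1 - real N / 2 - 1) / (real N - 2)) (at D)"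
      using assms by (intro DERIV_cdivide has_real_derivative_powr)
    also have "(1 - real N / 2) * D powr (1 - real N / 2 - 1) / (real N - 2) = (1 - real N / 2) / (real N - 2) * D powr (- real N / 2)"
      by simp
    also have "\<dots> = green_profile1 N D" unfolding * green_profile1_def by simp
    finally show ?thesis unfolding green_profile_def[abs_def] using False by simp
  qed
  show "(green_profile1 N has_real_derivative green_profile2 N D) (at D)"
    unfolding green_profile2_def green_profile1_def[abs_def] using assms
    by (auto intro!: derivative_eq_intros simp: field_simps)
  show "(green_profile2 N has_real_derivative (- (real N / 4) * (real N / 2 + 1) * D powr (- real N / 2 - 2))) (at D)"
    unfolding green_profile2_def[abs_def] using assms
    by (auto intro!: derivative_eq_intros simp: field_simps)
qed

text \<open>The left side is half the Laplacian of f(|y - a|^2), where D is the squared distance and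
  f the profile.\<close>

lemma green_profile_ode:
  assumes "D > 0"
  shows "real N * green_profile1 N D + 2 * D * green_profile2 N D = 0"
  using powr_mult_base[of D "- real N / 2 - 1"] assms unfolding green_profile1_def green_profile2_def
  by (simp add: mult.assoc mult.left_commute[of D])

lemma continuous_on_green_profile:
  "continuous_on {0<..} (green_profile N)"
  "continuous_on {0<..} (green_profile1 N)"
  "continuous_on {0<..} (green_profile2 N)"
  by (rule continuous_at_imp_continuous_on, rule ballI, rule DERIV_isCont, erule green_profile_derivs[OF greaterThan_iff[THEN iffD1]])+

text \<open>The condition says that the quadratic is a multiple of the squared distance to a point, or constant.\<close>

lemma quad_null_gradient:
  assumes "b \<bullet> b = 4 * k * c"
  shows "((2 * k) *\<^sub>R y + b) \<bullet> ((2 * k) *\<^sub>R y + b) = 4 * k * quad k b c y"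
  using assms by (simp add: quad_def inner_add_left inner_add_right inner_commute algebra_simps)

lemma c2_with_green_profile:
  fixes b :: "real ^ 'n"
  assumes "open U" "\<And>y. y \<in> U \<Longrightarrow> quad k b c y > 0"
  shows "c2_with U (\<lambda>y. green_profile CARD('n) (quad k b c y))
    (\<lambda>y. green_profile1 CARD('n) (quad k b c y) *\<^sub>R ((2 * k) *\<^sub>R y + b))
    (\<lambda>y. green_profile1 CARD('n) (quad k b c y) *\<^sub>R ((2 * k) *\<^sub>R mat 1) +
         green_profile2 CARD('n) (quad k b c y) *\<^sub>R outer ((2 * k) *\<^sub>R y + b) ((2 * k) *\<^sub>R y + b))"
  by (rule c2_with_compose[OF c2_with_quad[OF assms(1)]])
     (use assms(2) green_profile_derivs in \<open>auto intro: continuous_on_subset[OF continuous_on_green_profile(3)]\<close>)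

text \<open>By nullity the squared gradient is 4 k Q, and the Laplacian of Q is 2 k N; so the trace
  is 2 k times the expression in \<open>green_profile_ode\<close>.\<close>

lemma trace_green_profile:
  fixes b :: "real ^ 'n"
  assumes "b \<bullet> b = 4 * k * c" "quad k b c y > 0"
  shows "trace (green_profile1 CARD('n) (quad k b c y) *\<^sub>R ((2 * k) *\<^sub>R mat 1) +
         green_profile2 CARD('n) (quad k b c y) *\<^sub>R outer ((2 * k) *\<^sub>R y + b) ((2 * k) *\<^sub>R y + b) :: real ^ 'n ^ 'n) = 0"
proof -
  have tr: "trace (x *\<^sub>R (M :: real ^ 'n ^ 'n) + z *\<^sub>R M') = x * trace M + z * trace M'" for x z M M'
    by (simp add: trace_def sum.distrib sum_distrib_left)
  have tr1: "trace ((2 * k) *\<^sub>R mat 1 :: real ^ 'n ^ 'n) = 2 * k * CARD('n)"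
    by (simp add: trace_def mat_def)
  show ?thesis
    unfolding tr tr1 trace_outer quad_null_gradient[OF assms(1)]
    using green_profile_ode[OF assms(2), of "CARD('n)"] by (simp add: algebra_simps) algebra
qed

text \<open>\<open>al\<close> and \<open>be\<close> are the powers with respect to the two spheres, scaled to unit length for the Lorentzian form
  \<open>\<nabla>V \<bullet> \<nabla>W - 2 k\<^sub>V W - 2 k\<^sub>W V\<close> on quadratics (\<open>k\<close> the coefficient of \<open>|y|\<^sup>2\<close>), whose null vectors are the squared
  distances to points. Their product is \<open>- c\<close>, so \<open>c = cosh L\<close> and \<open>e = exp L\<close> with \<open>L\<close> the inversive distance of the
  spheres; \<open>A\<close> and \<open>B\<close> are the null vectors in the span, with product \<open>- 2\<close>.\<close>

locale eccentric_annulus =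
  fixes R \<epsilon> :: real and P :: "real ^ 'n"
  assumes eps_pos: "\<epsilon> > 0" and hole_inside: "norm P + \<epsilon> < R" and dim: "CARD('n) \<ge> 2"
begin

definition \<Omega> :: "(real ^ 'n) set" where "\<Omega> = ball 0 R - cball P \<epsilon>"
definition al :: "real ^ 'n \<Rightarrow> real" where "al y = (R\<^sup>2 - y \<bullet> y) / (2 * R)"
definition be :: "real ^ 'n \<Rightarrow> real" where "be y = ((y - P) \<bullet> (y - P) - \<epsilon>\<^sup>2) / (2 * \<epsilon>)"
definition c :: real where "c = (R\<^sup>2 + \<epsilon>\<^sup>2 - P \<bullet> P) / (2 * R * \<epsilon>)"
definition e :: real where "e = c + sqrt (c\<^sup>2 - 1)"
definition s :: real where "s = (e - 1 / e) / 2"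
definition A :: "real ^ 'n \<Rightarrow> real" where "A y = (be y + e * al y) / s"
definition B :: "real ^ 'n \<Rightarrow> real" where "B y = (be y + al y / e) / s"

section \<open>The two spheres in terms of the pencil\<close>

lemma R_pos: "R > 0"
  using eps_pos hole_inside norm_ge_zero[of P] by linarith

lemma c_gt_1: "c > 1"
proof -
  have "norm P < R - \<epsilon>" using hole_inside by simp
  then have "(norm P)\<^sup>2 < (R - \<epsilon>)\<^sup>2" by (intro power_strict_mono) auto
  then have "2 * R * \<epsilon> < R\<^sup>2 + \<epsilon>\<^sup>2 - P \<bullet> P"
    by (simp add: dot_square_norm power2_diff)
  then show ?thesis using R_pos eps_pos by (simp add: c_def)
qed

lemma e_gt_1: "e > 1" and e_inverse: "e + 1 / e = 2 * c"
proof -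
  have c2: "c\<^sup>2 - 1 \<ge> 0" using c_gt_1 by (simp add: one_le_power)
  show "e > 1" unfolding e_def using c_gt_1 c2 by (smt (verit) real_sqrt_ge_zero)
  then have e0: "e \<noteq> 0" by auto
  have "e * e + 1 = 2 * c * e" unfolding e_def using c2 
    by (simp add: algebra_simps power2_eq_square)
  then show "e + 1 / e = 2 * c" using e0 by (simp add: field_simps)
qed

lemma s_pos: "s > 0"
proof -
  have "1 / e < 1" using e_gt_1 by simp
  from less_trans[OF this e_gt_1] show ?thesis by (simp add: s_def)
qed

text \<open>With \<open>c\<close> = cosh L and \<open>e\<close> = exp L this identifies
  \<open>s\<close> as sinh L; dividing by it in \<open>A\<close> and \<open>B\<close> gives their
  Lorentzian product the value - 2.\<close>

lemma s_sq: "s\<^sup>2 = c\<^sup>2 - 1"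
proof -
  define z where "z = 1 / e"
  have "e * z = 1" using e_gt_1 by (simp add: z_def)
  have ce: "c = (e + z) / 2" and se: "s = (e - z) / 2" using e_inverse by (simp_all add: s_def z_def)
  have "s\<^sup>2 = (e\<^sup>2 - 2 * (e * z) + z\<^sup>2) / 4" "c\<^sup>2 = (e\<^sup>2 + 2 * (e * z) + z\<^sup>2) / 4"
    unfolding ce se by (simp_all add: power2_eq_square algebra_simps)
  with \<open>e * z = 1\<close> show ?thesis by simp
qed

lemma e_eq: "e = c + s"
  using e_inverse by (simp add: s_def field_simps)

lemma A_minus_B: "A y - B y = 2 * al y"
proof -
  have "A y - B y = (e - 1 / e) * al y / s"
    unfolding A_def B_def using s_pos by (simp add: field_simps)
  also have "\<dots> = 2 * al y" using s_pos unfolding e_eq[symmetric] by (simp add: s_def)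
  finally show ?thesis .
qed

text \<open>Together with \<open>A_minus_B\<close>: the outer sphere is A/B = 1 and the inner one is
  A/B = e^2, so the ratio serves as a radial coordinate between them.\<close>

lemma B_minus_A: "e\<^sup>2 * B y - A y = 2 * e * be y"
proof -
  have es: "e\<^sup>2 - 1 = 2 * e * s" using e_gt_1 by (simp add: s_def power2_eq_square field_simps)
  have "e\<^sup>2 * B y - A y = (e\<^sup>2 - 1) * be y / s"
    unfolding A_def B_def using s_pos e_gt_1 by (simp add: field_simps power2_eq_square)
  then show ?thesis using s_pos unfolding es by simp
qed

lemma Omega_eq: "\<Omega> = {y. al y > 0 \<and> be y > 0}"
proof -
  have "y \<in> ball 0 R \<longleftrightarrow> al y > 0" for y
    using R_pos by (simp add: al_def norm_lt_square zero_less_divide_iff)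
  moreover have "y \<notin> cball P \<epsilon> \<longleftrightarrow> be y > 0" for y
    using eps_pos by (simp add: be_def dist_norm norm_minus_commute[of P] not_le norm_gt_square zero_less_divide_iff)
  ultimately show ?thesis by (simp add: \<Omega>_def set_eq_iff)
qed

lemma continuous_on_al_be [continuous_intros]:
  "continuous_on U al" "continuous_on U be" "continuous_on U A" "continuous_on U B"
  unfolding al_def[abs_def] be_def[abs_def] A_def[abs_def] B_def[abs_def] 
  using R_pos eps_pos s_pos e_gt_1 by (auto intro!: continuous_intros)

lemma open_Omega: "open \<Omega>" and bounded_Omega: "bounded \<Omega>"
  by (auto simp: \<Omega>_def open_Diff intro: bounded_subset[OF bounded_ball])

lemma compact_closure_Omega: "compact (closure \<Omega>)"
  by (simp add: bounded_Omega compact_closure)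

lemma closure_Omega: "closure \<Omega> \<subseteq> {y. al y \<ge> 0 \<and> be y \<ge> 0}"
proof (rule closure_minimal)
  show "closed {y. al y \<ge> 0 \<and> be y \<ge> 0}"
    by (intro closed_Collect_conj closed_Collect_le continuous_intros)
qed (auto simp: Omega_eq)

lemma frontier_Omega: "y \<in> frontier \<Omega> \<Longrightarrow> y \<in> closure \<Omega> \<and> (al y = 0 \<or> be y = 0)"
  using closure_Omega unfolding frontier_def interior_open[OF open_Omega] 
  by (auto simp: Omega_eq)

text \<open>The spheres are disjoint because |P| + \<open>\<epsilon>\<close> < R; this keeps
  \<open>B\<close> positive up to the boundary.\<close>

lemma al_be_not_zero: "al y \<noteq> 0 \<or> be y \<noteq> 0"
proof (rule ccontr)
  assume "\<not> (al y \<noteq> 0 \<or> be y \<noteq> 0)"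
  then have "norm y = R" "norm (y - P) = \<epsilon>"
    using R_pos eps_pos by (auto simp: al_def be_def dot_square_norm power2_eq_iff_nonneg)
  then show False using norm_triangle_ineq[of P "y - P"] hole_inside by simp
qed

lemma A_B_bounds:
  assumes "y \<in> closure \<Omega>"
  shows "B y > 0" "A y > 0" "A y \<ge> B y" "A y \<le> e\<^sup>2 * B y"
proof -
  have *: "al y \<ge> 0" "be y \<ge> 0" using assms closure_Omega by auto
  then have "be y + al y / e > 0" using al_be_not_zero[of y] e_gt_1
    by (smt (verit) divide_pos_pos divide_nonneg_pos)
  then show B: "B y > 0" using s_pos by (simp add: B_def)
  show "A y \<ge> B y" "A y \<le> e\<^sup>2 * B y" using A_minus_B[of y] B_minus_A[of y] * e_gt_1
    by (auto simp: mult_nonneg_nonneg) (smt (verit) mult_nonneg_nonneg)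
  then show "A y > 0" using B by simp
qed

lemma A_B_strict:
  assumes "y \<in> \<Omega>"
  shows "A y > B y" "A y < e\<^sup>2 * B y"
proof -
  have *: "al y > 0" "be y > 0" using assms Omega_eq by auto
  then show "A y > B y" "A y < e\<^sup>2 * B y" using A_minus_B[of y] B_minus_A[of y] e_gt_1
    by (auto) (smt (verit) mult_pos_pos)
qed

section \<open>Lorentzian products in the pencil\<close>

definition kA :: real where "kA = (1 / (2 * \<epsilon>) - e / (2 * R)) / s"
definition kB :: real where "kB = (1 / (2 * \<epsilon>) - (1 / e) / (2 * R)) / s"
text \<open>\<open>A\<close> and \<open>B\<close> share this linear coefficient, since
  \<open>al\<close> is centred at 0 and contributes none.\<close>

definition vA :: "real ^ 'n" where "vA = (- 1 / (\<epsilon> * s)) *\<^sub>R P"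
definition cA :: real where "cA = ((P \<bullet> P - \<epsilon>\<^sup>2) / (2 * \<epsilon>) + e * R / 2) / s"
definition cB :: real where "cB = ((P \<bullet> P - \<epsilon>\<^sup>2) / (2 * \<epsilon>) + (1 / e) * R / 2) / s"

lemma A_quad: "A y = quad kA vA cA y" and B_quad: "B y = quad kB vA cB y"
  unfolding A_def B_def quad_def kA_def kB_def vA_def cA_def cB_def al_def be_def
  using R_pos eps_pos s_pos e_gt_1
  by (simp_all add: inner_diff_left inner_diff_right inner_commute field_simps power2_eq_square)

text \<open>Nullity amounts to e^2 - 2 c e + 1 = 0, whose roots \<open>e\<close> and 1 /
  \<open>e\<close> single out the two members of the pencil; the value - 2 results from s^2 = c^2 -
  1.\<close>

lemma null_A: "vA \<bullet> vA = 4 * kA * cA" and null_B: "vA \<bullet> vA = 4 * kB * cB"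
  and null_AB: "vA \<bullet> vA - 2 * (kA * cB + kB * cA) = - 2"
proof -
  have PP: "P \<bullet> P = R\<^sup>2 + \<epsilon>\<^sup>2 - 2 * R * \<epsilon> * c" using R_pos eps_pos by (simp add: c_def)
  have v: "vA \<bullet> vA = (P \<bullet> P) / (\<epsilon> * s)\<^sup>2" by (simp add: vA_def power2_eq_square)
  have cA: "cA = R * (R / \<epsilon> - 2 * c + e) / (2 * s)"
    unfolding cA_def PP using eps_pos by (simp add: field_simps power2_eq_square)
  have cB: "cB = R * (R / \<epsilon> - 2 * c + 1 / e) / (2 * s)"
    unfolding cB_def PP using eps_pos by (simp add: field_simps power2_eq_square)
  have kA: "kA = (R / \<epsilon> - e) / (2 * R * s)" and kB: "kB = (R / \<epsilon> - 1 / e) / (2 * R * s)"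
    unfolding kA_def kB_def using R_pos eps_pos e_gt_1 by (simp_all add: field_simps)
  have PPe: "(P \<bullet> P) / (\<epsilon> * s)\<^sup>2 = ((R / \<epsilon>)\<^sup>2 + 1 - 2 * c * (R / \<epsilon>)) / s\<^sup>2"
    unfolding PP using eps_pos s_pos by (simp add: field_simps power2_eq_square)
  have e1: "e = 2 * c - 1 / e" and e2: "1 / e = 2 * c - e" and ee: "e * (2 * c - e) = 1" 
    using e_inverse e_gt_1 by (auto simp: field_simps)
  have g: "4 * ((\<rho> - x) / (2 * R * s)) * (R * z / (2 * s)) = (\<rho> - x) * z / s\<^sup>2" for \<rho> x z
    using R_pos s_pos by (simp add: field_simps power2_eq_square)
  have g': "(\<rho> - x) / (2 * R * s) * (R * z / (2 * s)) = (\<rho> - x) * z / (4 * s\<^sup>2)" for \<rho> x z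
    using R_pos s_pos by (simp add: field_simps power2_eq_square)
  show "vA \<bullet> vA = 4 * kA * cA" unfolding v PPe kA cA g
    using ee by (simp add: power2_eq_square algebra_simps)
  show "vA \<bullet> vA = 4 * kB * cB" unfolding v PPe kB cB g e2
    using ee by (simp add: power2_eq_square algebra_simps)
  have "2 * (kA * cB + kB * cA) = ((R / \<epsilon> - e) * (R / \<epsilon> - 2 * c + 1 / e) + (R / \<epsilon> - 1 / e) * (R / \<epsilon> - 2 * c + e)) / (2 * s\<^sup>2)"
    unfolding kA cA kB cB g' using s_pos by (simp add: add_divide_distrib)
  also have "\<dots> = ((R / \<epsilon> - e)\<^sup>2 + (R / \<epsilon> - (2 * c - e))\<^sup>2) / (2 * s\<^sup>2)"
    unfolding e2 by (simp add: power2_eq_square)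
  finally have *: "2 * (kA * cB + kB * cA) = ((R / \<epsilon> - e)\<^sup>2 + (R / \<epsilon> - (2 * c - e))\<^sup>2) / (2 * s\<^sup>2)" .
  have num: "2 * (\<rho>\<^sup>2 + 1 - 2 * c * \<rho>) - ((\<rho> - e)\<^sup>2 + (\<rho> - (2 * c - e))\<^sup>2) = 4 - 4 * c\<^sup>2" for \<rho>
    using ee by (simp add: power2_eq_square algebra_simps)
  have "vA \<bullet> vA - 2 * (kA * cB + kB * cA) =
      (2 * ((R / \<epsilon>)\<^sup>2 + 1 - 2 * c * (R / \<epsilon>)) - ((R / \<epsilon> - e)\<^sup>2 + (R / \<epsilon> - (2 * c - e))\<^sup>2)) / (2 * s\<^sup>2)"
    unfolding * v PPe by (simp add: diff_divide_distrib add_divide_distrib)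
  also have "\<dots> = (4 - 4 * c\<^sup>2) / (2 * s\<^sup>2)" unfolding num ..
  also have "\<dots> = - 2" using s_pos unfolding s_sq[symmetric] using s_sq by (simp add: field_simps)
  finally show "vA \<bullet> vA - 2 * (kA * cB + kB * cA) = - 2" .
qed

text \<open>Up to a positive factor, \<^term>\<open>image_quad x w a b y\<close> is the squared distance from \<open>y\<close> to an image
  of \<open>x\<close> under the group generated by the two sphere inversions.\<close>

definition image_quad :: "real ^ 'n \<Rightarrow> real \<Rightarrow> real \<Rightarrow> real \<Rightarrow> real ^ 'n \<Rightarrow> real" where
  "image_quad x w a b y = w * ((y - x) \<bullet> (y - x)) + a * A y + b * B y"

definition iq_k :: "real \<Rightarrow> real \<Rightarrow> real \<Rightarrow> real" where "iq_k w a b = w + a * kA + b * kB"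
definition iq_v :: "real ^ 'n \<Rightarrow> real \<Rightarrow> real \<Rightarrow> real \<Rightarrow> real ^ 'n" where
  "iq_v x w a b = (- 2 * w) *\<^sub>R x + (a + b) *\<^sub>R vA"
definition iq_c :: "real ^ 'n \<Rightarrow> real \<Rightarrow> real \<Rightarrow> real \<Rightarrow> real" where
  "iq_c x w a b = w * (x \<bullet> x) + a * cA + b * cB"

lemma image_quad_eq: "image_quad x w a b y = quad (iq_k w a b) (iq_v x w a b) (iq_c x w a b) y"
  unfolding image_quad_def iq_k_def iq_v_def iq_c_def A_quad B_quad quad_def
  by (simp add: inner_diff_left inner_diff_right inner_add_left inner_commute algebra_simps)

text \<open>All three summands are null, and pairing any quadratic with |y - x|^2 evaluates it at x
  up to the factor - 2. Only mixed products remain, and they add up to - 4 times the left side of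
  the hypothesis.\<close>

lemma image_quad_null:
  assumes "a * b + w * (a * A x + b * B x) = 0"
  shows "iq_v x w a b \<bullet> iq_v x w a b = 4 * iq_k w a b * iq_c x w a b"
proof -
  have x: "A x = kA * (x \<bullet> x) + vA \<bullet> x + cA" "B x = kB * (x \<bullet> x) + vA \<bullet> x + cB"
    by (simp_all add: A_quad B_quad quad_def)
  have "iq_v x w a b \<bullet> iq_v x w a b - 4 * iq_k w a b * iq_c x w a b =
    - 4 * (a * b + w * (a * A x + b * B x)) + a\<^sup>2 * (vA \<bullet> vA - 4 * kA * cA) + b\<^sup>2 * (vA \<bullet> vA - 4 * kB * cB)
    + 2 * a * b * (vA \<bullet> vA - 2 * (kA * cB + kB * cA) + 2)"
    unfolding iq_k_def iq_v_def iq_c_def x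
    by (simp add: inner_diff_left inner_diff_right inner_add_left inner_add_right inner_commute algebra_simps power2_eq_square)
  also have "\<dots> = 0" using assms null_A null_B null_AB by simp
  finally show ?thesis by simp
qed

end

section \<open>The family of image points\<close>

text \<open>The image terms depend on a parameter \<open>q\<close> tending to \<open>0\<close> geometrically along the orbit. In dimension two
  the paired terms vanish at \<open>q = 0\<close>, and the Lipschitz bound there makes their series converge.\<close>

definition lip_at0 :: "real \<Rightarrow> 'a set \<Rightarrow> (real \<Rightarrow> 'a \<Rightarrow> 'b::real_normed_vector) \<Rightarrow> bool" where
  "lip_at0 q1 K F \<longleftrightarrow> (\<exists>M\<ge>0. \<forall>q\<in>{0..q1}. \<forall>y\<in>K. norm (F q y) \<le> M \<and> norm (F q y - F 0 y) \<le> M * q)"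

section \<open>Rules for the Lipschitz bound at q = 0\<close>

lemma lip_at0E:
  assumes "lip_at0 q1 K F"
  obtains M where "M \<ge> 0" "\<And>q y. 0 \<le> q \<Longrightarrow> q \<le> q1 \<Longrightarrow> y \<in> K \<Longrightarrow> norm (F q y) \<le> M"
    "\<And>q y. 0 \<le> q \<Longrightarrow> q \<le> q1 \<Longrightarrow> y \<in> K \<Longrightarrow> norm (F q y - F 0 y) \<le> M * q"
  using assms unfolding lip_at0_def by force

lemma lip_at0I:
  assumes "\<And>q y. 0 \<le> q \<Longrightarrow> q \<le> q1 \<Longrightarrow> y \<in> K \<Longrightarrow> norm (F q y) \<le> M"
    "\<And>q y. 0 \<le> q \<Longrightarrow> q \<le> q1 \<Longrightarrow> y \<in> K \<Longrightarrow> norm (F q y - F 0 y) \<le> M' * q"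
  shows "lip_at0 q1 K F"
  unfolding lip_at0_def
proof (intro exI[of _ "max 0 (max M M')"] conjI ballI)
  fix q y assume "q \<in> {0..q1}" and y: "y \<in> K"
  then have q: "0 \<le> q" "q \<le> q1" by auto
  show "norm (F q y) \<le> max 0 (max M M')" using assms(1)[OF q y] by simp
  have "M' * q \<le> max 0 (max M M') * q" by (rule mult_right_mono) (use q in auto)
  then show "norm (F q y - F 0 y) \<le> max 0 (max M M') * q" using assms(2)[OF q y] by simp
qed simp

lemma lip_at0_param:
  assumes "\<And>y. y \<in> K \<Longrightarrow> norm (g y) \<le> M"
  shows "lip_at0 q1 K (\<lambda>q y. g y)"
  by (rule lip_at0I[of _ _ _ M 0]) (use assms in auto)

lemma lip_at0_const: "lip_at0 q1 K (\<lambda>q y. k)"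
  by (rule lip_at0_param[of _ _ "norm k"]) simp

lemma lip_at0_q: "lip_at0 q1 K (\<lambda>q y. q)"
  by (rule lip_at0I[of _ _ _ q1 1]) auto

lemma lip_at0_add:
  assumes "lip_at0 q1 K F" "lip_at0 q1 K G"
  shows "lip_at0 q1 K (\<lambda>q y. F q y + G q y)"
proof -
  obtain M where M: "M \<ge> 0" "\<And>q y. 0 \<le> q \<Longrightarrow> q \<le> q1 \<Longrightarrow> y \<in> K \<Longrightarrow> norm (F q y) \<le> M"
    "\<And>q y. 0 \<le> q \<Longrightarrow> q \<le> q1 \<Longrightarrow> y \<in> K \<Longrightarrow> norm (F q y - F 0 y) \<le> M * q" by (rule lip_at0E[OF assms(1)]) blast
  obtain M' where M': "M' \<ge> 0" "\<And>q y. 0 \<le> q \<Longrightarrow> q \<le> q1 \<Longrightarrow> y \<in> K \<Longrightarrow> norm (G q y) \<le> M'"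
    "\<And>q y. 0 \<le> q \<Longrightarrow> q \<le> q1 \<Longrightarrow> y \<in> K \<Longrightarrow> norm (G q y - G 0 y) \<le> M' * q" by (rule lip_at0E[OF assms(2)]) blast
  show ?thesis
  proof (rule lip_at0I[of _ _ _ "M + M'" "M + M'"])
    fix q y assume q: "0 \<le> q" "q \<le> q1" and y: "y \<in> K"
    show "norm (F q y + G q y) \<le> M + M'"
      using norm_triangle_ineq M(2)[OF q y] M'(2)[OF q y] by (smt (verit))
    have "norm (F q y + G q y - (F 0 y + G 0 y)) \<le> norm (F q y - F 0 y) + norm (G q y - G 0 y)"
      by (simp add: add_diff_add norm_triangle_ineq)
    then show "norm (F q y + G q y - (F 0 y + G 0 y)) \<le> (M + M') * q"
      using M(3)[OF q y] M'(3)[OF q y] by (simp add: algebra_simps)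
  qed
qed

lemma lip_at0_bilinear:
  assumes "bounded_bilinear op" "lip_at0 q1 K F" "lip_at0 q1 K G"
  shows "lip_at0 q1 K (\<lambda>q y. op (F q y) (G q y))"
proof -
  interpret bounded_bilinear op by (rule assms(1))
  obtain M where M: "M \<ge> 0" "\<And>q y. 0 \<le> q \<Longrightarrow> q \<le> q1 \<Longrightarrow> y \<in> K \<Longrightarrow> norm (F q y) \<le> M"
    "\<And>q y. 0 \<le> q \<Longrightarrow> q \<le> q1 \<Longrightarrow> y \<in> K \<Longrightarrow> norm (F q y - F 0 y) \<le> M * q" by (rule lip_at0E[OF assms(2)]) blast
  obtain M' where M': "M' \<ge> 0" "\<And>q y. 0 \<le> q \<Longrightarrow> q \<le> q1 \<Longrightarrow> y \<in> K \<Longrightarrow> norm (G q y) \<le> M'"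
    "\<And>q y. 0 \<le> q \<Longrightarrow> q \<le> q1 \<Longrightarrow> y \<in> K \<Longrightarrow> norm (G q y - G 0 y) \<le> M' * q" by (rule lip_at0E[OF assms(3)]) blast
  obtain C where C: "C \<ge> 0" "\<And>a b. norm (op a b) \<le> norm a * norm b * C" using nonneg_bounded by blast
  have bd: "norm (op a b) \<le> u * v * C" if "norm a \<le> u" "norm b \<le> v" for a b u v
  proof -
    have "norm a * norm b * C \<le> u * v * C" 
      by (intro mult_right_mono mult_mono) (use that C norm_ge_zero order_trans in blast)+
    then show ?thesis using C(2)[of a b] by linarith
  qed
  show ?thesis
  proof (rule lip_at0I[of _ _ _ "M * M' * C" "2 * (M * M' * C)"])
    fix q y assume q: "0 \<le> q" "q \<le> q1" and y: "y \<in> K"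
    show "norm (op (F q y) (G q y)) \<le> M * M' * C" by (rule bd[OF M(2)[OF q y] M'(2)[OF q y]])
    have "op (F q y) (G q y) - op (F 0 y) (G 0 y) = op (F q y - F 0 y) (G q y) + op (F 0 y) (G q y - G 0 y)"
      by (simp add: diff_left diff_right)
    also have "norm \<dots> \<le> norm (op (F q y - F 0 y) (G q y)) + norm (op (F 0 y) (G q y - G 0 y))"
      by (rule norm_triangle_ineq)
    also have "\<dots> \<le> (M * q) * M' * C + M * (M' * q) * C"
      by (intro add_mono bd M M' q y) (use q in auto)
    finally show "norm (op (F q y) (G q y) - op (F 0 y) (G 0 y)) \<le> 2 * (M * M' * C) * q"
      by (simp add: algebra_simps)
  qed
qed

lemmas lip_at0_scaleR = lip_at0_bilinear[OF bounded_bilinear_scaleR]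
lemmas lip_at0_mult = lip_at0_bilinear[OF bounded_bilinear_mult]

lemma lip_at0_sum:
  assumes "\<And>i. i \<in> I \<Longrightarrow> lip_at0 q1 K (F i)"
  shows "lip_at0 q1 K (\<lambda>q y. \<Sum>i\<in>I. F i q y)"
  using assms by (induction I rule: infinite_finite_induct) (auto intro: lip_at0_const lip_at0_add)

lemma norm_outer: "norm (outer a b) = norm a * norm b"
  by (simp add: outer_def norm_vec_def abs_mult L2_set_right_distrib[symmetric] L2_set_left_distrib[symmetric])

lemma bounded_bilinear_outer: "bounded_bilinear outer"
proof
  show "\<exists>K. \<forall>a b. norm (outer a b) \<le> norm a * norm b * K"
    by (intro exI[of _ 1]) (simp add: norm_outer)
qed (auto simp: outer_def vec_eq_iff algebra_simps)

lemmas lip_at0_outer = lip_at0_bilinear[OF bounded_bilinear_outer]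

text \<open>The lower bound \<open>\<eta>\<close> confines the arguments to a compact interval away
  from the singularity at 0, on which the derivative of g is bounded.\<close>

lemma lip_at0_compose:
  fixes F :: "real \<Rightarrow> 'a \<Rightarrow> real"
  assumes F: "lip_at0 q1 K F" and "\<eta> > 0" and low: "\<And>q y. 0 \<le> q \<Longrightarrow> q \<le> q1 \<Longrightarrow> y \<in> K \<Longrightarrow> F q y \<ge> \<eta>"
    and g: "\<And>z. z > 0 \<Longrightarrow> (g has_real_derivative g' z) (at z)" and g': "continuous_on {0<..} g'"
  shows "lip_at0 q1 K (\<lambda>q y. g (F q y))"
proof -
  obtain M where M: "M \<ge> 0" "\<And>q y. 0 \<le> q \<Longrightarrow> q \<le> q1 \<Longrightarrow> y \<in> K \<Longrightarrow> norm (F q y) \<le> M"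
    "\<And>q y. 0 \<le> q \<Longrightarrow> q \<le> q1 \<Longrightarrow> y \<in> K \<Longrightarrow> norm (F q y - F 0 y) \<le> M * q" by (rule lip_at0E[OF F]) blast
  have sub: "{\<eta>..M} \<subseteq> {0<..}" using \<open>\<eta> > 0\<close> by auto
  have "bounded (g' ` {\<eta>..M})"
    by (intro compact_imp_bounded compact_continuous_image continuous_on_subset[OF g' sub]) simp
  then obtain L where L: "\<And>z. z \<in> {\<eta>..M} \<Longrightarrow> norm (g' z) \<le> L" unfolding bounded_iff by blast
  have cg: "continuous_on {0<..} g"
    by (auto intro!: continuous_at_imp_continuous_on DERIV_isCont g)
  have "bounded (g ` {\<eta>..M})"
    by (intro compact_imp_bounded compact_continuous_image continuous_on_subset[OF cg sub]) simp
  then obtain L' where L': "\<And>z. z \<in> {\<eta>..M} \<Longrightarrow> norm (g z) \<le> L'" unfolding bounded_iff by blast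
  have lip: "norm (g a - g b) \<le> L * norm (a - b)" if "a \<in> {\<eta>..M}" "b \<in> {\<eta>..M}" for a b
    by (rule field_differentiable_bound[of "{\<eta>..M}" g g'])
       (use that L sub in \<open>auto intro!: has_field_derivative_at_within g\<close>)
  show ?thesis
  proof (rule lip_at0I[of _ _ _ L' "L * M"])
    fix q y assume q: "0 \<le> q" "q \<le> q1" and y: "y \<in> K"
    have F1: "F q y \<in> {\<eta>..M}" using low[OF q y] M(2)[OF q y] by auto
    have F0: "F 0 y \<in> {\<eta>..M}" using low[OF _ _ y, of 0] M(2)[OF _ _ y, of 0] q by auto
    show "norm (g (F q y)) \<le> L'" by (rule L'[OF F1])
    have L0: "L \<ge> 0" using L[OF F1] norm_ge_zero[of "g' (F q y)"] by linarith
    have "norm (g (F q y) - g (F 0 y)) \<le> L * norm (F q y - F 0 y)" by (rule lip[OF F1 F0])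
    also have "\<dots> \<le> L * (M * q)" by (rule mult_left_mono[OF M(3)[OF q y] L0])
    finally show "norm (g (F q y) - g (F 0 y)) \<le> L * M * q" by simp
  qed
qed

text \<open>One geometric rate serves all dimensions. For N >= 3 the exponent N/2 - 1 is at least
  1/2, so the weight alone is at most sqrt q = r^(n+1). For N = 2 the weight is 1, and vanishing at
  q = 0 gives the even smaller M q.\<close>

lemma lip_at0_weighted_bound:
  assumes "lip_at0 (r\<^sup>2) K F" "0 < r" "r \<le> 1" "N \<ge> 2" and zero: "\<And>y. N = 2 \<Longrightarrow> y \<in> K \<Longrightarrow> F 0 y = 0"
  obtains M where "\<And>n y. y \<in> K \<Longrightarrow>
    norm (((r ^ (2 * Suc n)) powr (real N / 2 - 1)) *\<^sub>R F (r ^ (2 * Suc n)) y) \<le> M * r ^ Suc n"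
proof -
  obtain M where M: "M \<ge> 0" "\<And>q y. 0 \<le> q \<Longrightarrow> q \<le> r\<^sup>2 \<Longrightarrow> y \<in> K \<Longrightarrow> norm (F q y) \<le> M"
    "\<And>q y. 0 \<le> q \<Longrightarrow> q \<le> r\<^sup>2 \<Longrightarrow> y \<in> K \<Longrightarrow> norm (F q y - F 0 y) \<le> M * q" by (rule lip_at0E[OF assms(1)]) blast
  have "norm (((r ^ (2 * Suc n)) powr (real N / 2 - 1)) *\<^sub>R F (r ^ (2 * Suc n)) y) \<le> M * r ^ Suc n"
    if y: "y \<in> K" for n y
  proof -
    define q where "q = r ^ (2 * Suc n)"
    have "q = (r ^ Suc n)\<^sup>2" by (simp only: q_def power_mult[symmetric] mult.commute)
    then have sq: "sqrt q = r ^ Suc n" using assms(2) by (simp del: power_Suc)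
    have q: "0 < q" "q \<le> r\<^sup>2" "q \<le> 1" "q \<le> r ^ Suc n"
      using assms(2,3) power_decreasing[of 2 "2 * Suc n" r] power_decreasing[of "Suc n" "2 * Suc n" r]
      by (auto simp: q_def power_le_one simp del: power_Suc)
    show ?thesis
    proof (cases "N = 2")
      case True
      then have "norm (F q y) \<le> M * q" using M(3)[of q y] q y zero[OF True y] by auto
      also have "\<dots> \<le> M * r ^ Suc n" using q M by (intro mult_left_mono) auto
      finally show ?thesis unfolding q_def[symmetric] using True q by simp
    next
      case False
      then have "real N / 2 - 1 \<ge> 1 / 2" using assms(4) by simp
      then have "q powr (real N / 2 - 1) \<le> q powr (1 / 2)" using q by (intro powr_mono') auto
      also have "\<dots> = r ^ Suc n" using q sq by (simp add: powr_half_sqrt del: power_Suc)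
      finally have "q powr (real N / 2 - 1) * norm (F q y) \<le> r ^ Suc n * M"
        using M(2)[of q y] q y by (intro mult_mono) auto
      then show ?thesis unfolding q_def[symmetric] by (simp add: mult.commute del: power_Suc)
    qed
  qed
  then show ?thesis by (rule that)
qed

lemma c2_with_sum:
  assumes "open U" "\<And>i. i \<in> I \<Longrightarrow> c2_with U (f i) (G i) (H i)"
  shows "c2_with U (\<lambda>x. \<Sum>i\<in>I. f i x) (\<lambda>x. \<Sum>i\<in>I. G i x) (\<lambda>x. \<Sum>i\<in>I. H i x)"
  using assms(2) by (induction I rule: infinite_finite_induct)
    (auto intro: c2_with_const c2_with_add assms(1))

section \<open>The four images belonging to one ratio q\<close>

context eccentric_annulus begin

definition r :: real where "r = 1 / e"

lemma r_bounds: "0 < r" "r < 1" "r\<^sup>2 < 1"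
proof -
  show *: "0 < r" "r < 1" using e_gt_1 by (simp_all add: r_def)
  show "r\<^sup>2 < 1" using mult_strict_mono'[of r 1 r 1] * by (simp add: power2_eq_square)
qed

text \<open>Since r^2 = 1/e^2, the second bound degenerates only for q = r^2 on the inner sphere;
  \<open>A_B_r_strict\<close> is its strict form inside.\<close>

lemma A_B_r:
  assumes "y \<in> closure \<Omega>" "q \<le> r\<^sup>2"
  shows "A y - q * B y > 0" "B y - q * A y \<ge> 0"
proof -
  note b = A_B_bounds[OF assms(1)]
  have "q * B y \<le> r\<^sup>2 * B y" using b assms by (intro mult_right_mono) auto
  also have "\<dots> < 1 * B y" using b r_bounds by (intro mult_strict_right_mono) auto
  finally show "A y - q * B y > 0" using b by linarith
  have "q * A y \<le> r\<^sup>2 * A y" using b assms by (intro mult_right_mono) auto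
  also have "\<dots> \<le> r\<^sup>2 * (e\<^sup>2 * B y)" using b by (intro mult_left_mono) auto
  also have "\<dots> = B y" using e_gt_1 by (simp add: r_def power_divide)
  finally show "B y - q * A y \<ge> 0" by simp
qed

lemma A_B_r_strict:
  assumes "y \<in> \<Omega>" "q \<le> r\<^sup>2"
  shows "B y - q * A y > 0"
proof -
  note b = A_B_bounds(2)[OF subsetD[OF closure_subset assms(1)]] A_B_strict[OF assms(1)]
  have "q * A y \<le> r\<^sup>2 * A y" using b assms by (intro mult_right_mono) auto
  also have "\<dots> < r\<^sup>2 * (e\<^sup>2 * B y)" using b r_bounds by (intro mult_strict_left_mono) auto
  also have "\<dots> = B y" using e_gt_1 by (simp add: r_def power_divide)
  finally show ?thesis by simp
qed

text \<open>With \<open>q = e\<^sup>-\<^sup>2\<^sup>k\<close>, the indices \<open>0, 1\<close> are the two images of \<open>x\<close> under odd words in the inversions and \<open>2, 3\<close> those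
  under even words; all are multiplied by \<open>q\<close>, so that they stay bounded and nonzero at \<open>q = 0\<close>. For \<open>i = 0\<close>, \<open>q = 1\<close> this is
  the image under the inversion in the outer sphere alone.\<close>

definition coefA :: "real ^ 'n \<Rightarrow> nat \<Rightarrow> real \<Rightarrow> real" where
  "coefA x i q = (if i = 0 then A x - q * B x else if i = 1 then - q * (B x - q * A x)
     else if i = 2 then - q * (1 - q) * B x else (1 - q) * B x)"

definition coefB :: "real ^ 'n \<Rightarrow> nat \<Rightarrow> real \<Rightarrow> real" where
  "coefB x i q = (if i = 0 then - q * (A x - q * B x) else if i = 1 then B x - q * A x
     else if i = 2 then (1 - q) * A x else - q * (1 - q) * A x)"

definition image_factor :: "real ^ 'n \<Rightarrow> nat \<Rightarrow> real \<Rightarrow> real ^ 'n \<Rightarrow> real" where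
  "image_factor x i q y = image_quad x q (coefA x i q) (coefB x i q) y"

text \<open>The hypothesis of \<open>image_quad_null\<close> with w = q; it makes every image term
  harmonic.\<close>

lemma coef_null: "coefA x i q * coefB x i q + q * (coefA x i q * A x + coefB x i q * B x) = 0"
  unfolding coefA_def coefB_def by (simp add: algebra_simps)

text \<open>For the odd images the pencil part splits into a function of x times the same function
  of y. Exchanging x and y fixes these two and swaps the even ones, which is the symmetry of the
  Green function.\<close>

lemma image_factor_0: "image_factor x 0 q y = q * ((y - x) \<bullet> (y - x)) + (A x - q * B x) * (A y - q * B y)"
  and image_factor_1: "image_factor x 1 q y = q * ((y - x) \<bullet> (y - x)) + (B x - q * A x) * (B y - q * A y)"
  and image_factor_2: "image_factor x 2 q y = q * ((y - x) \<bullet> (y - x)) + (1 - q) * (A x * B y - q * (B x * A y))"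
  and image_factor_3: "image_factor x 3 q y = q * ((y - x) \<bullet> (y - x)) + (1 - q) * (B x * A y - q * (A x * B y))"
  unfolding image_factor_def image_quad_def coefA_def coefB_def by (simp_all add: algebra_simps)

lemma image_factor_pos:
  assumes "x \<in> \<Omega>" "y \<in> closure \<Omega>" "0 \<le> q" "q \<le> r\<^sup>2" "i < 4"
  shows "image_factor x i q y > 0"
proof -
  have xc: "x \<in> closure \<Omega>" using assms(1) closure_subset by blast
  note bx = A_B_bounds[OF xc] and yb = A_B_bounds[OF assms(2)]
  have d: "q * ((y - x) \<bullet> (y - x)) \<ge> 0" using assms by simp
  have q1: "q < 1" using assms r_bounds by simp
  have cross: "q * (u * v) < u' * v'" if "q * u < u'" "v \<le> v'" "u \<ge> 0" "v > 0" for u v u' v'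
  proof -
    have "q * u * v < u' * v" using that by (intro mult_strict_right_mono) auto
    also have "\<dots> \<le> u' * v'" using that assms(3) by (intro mult_left_mono) (auto, smt (verit) mult_nonneg_nonneg)
    finally show ?thesis by (simp add: mult.assoc)
  qed
  consider "i = 0" | "i = 1" | "i = 2" | "i = 3" using assms(5) by linarith
  then show ?thesis
  proof cases
    case 1
    then show ?thesis using A_B_r(1)[OF xc assms(4)] A_B_r(1)[OF assms(2,4)] d
      by (simp add: image_factor_0 add_nonneg_pos)
  next
    case 2
    have p: "B x - q * A x > 0" by (rule A_B_r_strict[OF assms(1,4)])
    show ?thesis
    proof (cases "B y - q * A y > 0")
      case True
      then show ?thesis using d p 2 unfolding 2 image_factor_1 by (simp add: add_nonneg_pos del: One_nat_def)
    next
      \<comment> \<open>Here y is on the inner sphere and q = r^2, the degenerate case of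
        \<open>A_B_r\<close>; x and y differ, so the distance term supplies positivity.\<close>
      case False
      then have q: "q \<noteq> 0" using yb by auto
      have "x \<noteq> y" using False p by auto
      then have "q * ((y - x) \<bullet> (y - x)) > 0" using q assms(3) by auto
      moreover have "(B x - q * A x) * (B y - q * A y) \<ge> 0" using p A_B_r(2)[OF assms(2,4)] by simp
      ultimately show ?thesis unfolding 2 image_factor_1 by linarith
    qed
  next
    case 3
    have "q * (B x * A y) = (q * A y) * B x" by simp
    also have "\<dots> \<le> B y * B x" using A_B_r(2)[OF assms(2,4)] bx by (intro mult_right_mono) auto
    also have "\<dots> < A x * B y" using A_B_strict[OF assms(1)] yb by simp
    finally have "A x * B y - q * (B x * A y) > 0" by simp
    then show ?thesis using d q1 unfolding 3 image_factor_2 by (simp add: add_nonneg_pos)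
  next
    case 4
    have "q * (A x * B y) < B x * A y"
      by (rule cross) (use A_B_r_strict[OF assms(1,4)] bx yb in auto)
    then show ?thesis using d q1 unfolding 4 image_factor_3 by (simp add: add_nonneg_pos)
  qed
qed

definition image_k :: "real ^ 'n \<Rightarrow> nat \<Rightarrow> real \<Rightarrow> real" where "image_k x i q = iq_k q (coefA x i q) (coefB x i q)"
definition image_v :: "real ^ 'n \<Rightarrow> nat \<Rightarrow> real \<Rightarrow> real ^ 'n" where "image_v x i q = iq_v x q (coefA x i q) (coefB x i q)"
definition image_c :: "real ^ 'n \<Rightarrow> nat \<Rightarrow> real \<Rightarrow> real" where "image_c x i q = iq_c x q (coefA x i q) (coefB x i q)"

lemma image_factor_quad: "image_factor x i q = quad (image_k x i q) (image_v x i q) (image_c x i q)"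
  unfolding image_factor_def[abs_def] image_k_def image_v_def image_c_def by (rule ext) (rule image_quad_eq)

lemma image_factor_null: "image_v x i q \<bullet> image_v x i q = 4 * image_k x i q * image_c x i q"
  unfolding image_k_def image_v_def image_c_def by (rule image_quad_null) (rule coef_null)

definition image_grad :: "real ^ 'n \<Rightarrow> nat \<Rightarrow> real \<Rightarrow> real ^ 'n \<Rightarrow> real ^ 'n" where
  "image_grad x i q y = (2 * image_k x i q) *\<^sub>R y + image_v x i q"

lemma lip_at0_coef: "lip_at0 q1 K (\<lambda>q y. coefA x i q)" "lip_at0 q1 K (\<lambda>q y. coefB x i q)"
proof -
  have m: "lip_at0 q1 K (\<lambda>q y. - 1 * F q y)" if "lip_at0 q1 K F" for F :: "real \<Rightarrow> _ \<Rightarrow> real"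
    by (intro lip_at0_mult lip_at0_const that)
  have s: "lip_at0 q1 K (\<lambda>q y. F q y - G q y)" if "lip_at0 q1 K F" "lip_at0 q1 K G" for F G :: "real \<Rightarrow> _ \<Rightarrow> real"
    using lip_at0_add[OF that(1) m[OF that(2)]] by simp
  have n: "lip_at0 q1 K (\<lambda>q y. - F q y)" if "lip_at0 q1 K F" for F :: "real \<Rightarrow> _ \<Rightarrow> real"
    using m[OF that] by simp
  show "lip_at0 q1 K (\<lambda>q y. coefA x i q)" "lip_at0 q1 K (\<lambda>q y. coefB x i q)"
    unfolding coefA_def coefB_def
    by (cases "i = 0"; cases "i = 1"; cases "i = 2"; simp del: minus_mult_left[symmetric]; intro n s lip_at0_mult lip_at0_const lip_at0_q)+
qed

lemma lip_at0_image_coeffs: "lip_at0 q1 K (\<lambda>q y. image_k x i q)" "lip_at0 q1 K (\<lambda>q y. image_v x i q)" "lip_at0 q1 K (\<lambda>q y. image_c x i q)"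
  unfolding image_k_def image_v_def image_c_def iq_k_def iq_v_def iq_c_def
  by (intro lip_at0_add lip_at0_scaleR lip_at0_mult lip_at0_const lip_at0_coef lip_at0_q)+

lemma bounded_y: "\<exists>M. \<forall>y\<in>closure \<Omega>. norm y \<le> M"
  using compact_imp_bounded[OF compact_closure_Omega] by (auto simp: bounded_iff)

lemma lip_at0_y: "lip_at0 q1 (closure \<Omega>) (\<lambda>q y. y)"
  using bounded_y lip_at0_param[of "closure \<Omega>" "\<lambda>y. y"] by blast

lemma lip_at0_image_grad: "lip_at0 q1 (closure \<Omega>) (image_grad x i)"
  unfolding image_grad_def[abs_def] by (intro lip_at0_add lip_at0_scaleR lip_at0_mult lip_at0_const lip_at0_image_coeffs lip_at0_y)

lemma lip_at0_image_factor: "lip_at0 q1 (closure \<Omega>) (image_factor x i)"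
proof -
  have "lip_at0 q1 (closure \<Omega>) (\<lambda>q y. image_k x i q * (y \<bullet> y) + image_v x i q \<bullet> y + image_c x i q)"
    by (intro lip_at0_add lip_at0_mult lip_at0_bilinear[OF bounded_bilinear_inner] lip_at0_image_coeffs lip_at0_y)
  then show ?thesis by (simp add: image_factor_quad[abs_def] quad_def[abs_def])
qed

text \<open>A positive continuous function on the compact product of [0, r^2] and the closure has a
  positive minimum; including q = 0 makes the bound uniform along the whole orbit.\<close>

lemma image_factor_lower_bound:
  assumes "x \<in> \<Omega>" "i < 4"
  obtains \<eta> where "\<eta> > 0" "\<And>q y. 0 \<le> q \<Longrightarrow> q \<le> r\<^sup>2 \<Longrightarrow> y \<in> closure \<Omega> \<Longrightarrow> image_factor x i q y \<ge> \<eta>"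
proof -
  let ?S = "{0..r\<^sup>2} \<times> closure \<Omega>"
  have "continuous_on ?S (\<lambda>z. coefA x i (fst z))" "continuous_on ?S (\<lambda>z. coefB x i (fst z))"
    unfolding coefA_def coefB_def
    by (cases "i = 0"; cases "i = 1"; cases "i = 2"; simp; intro continuous_intros)+
  then have cont: "continuous_on ?S (\<lambda>z. image_factor x i (fst z) (snd z))"
    unfolding image_factor_def image_quad_def A_quad B_quad quad_def
    by (intro continuous_intros)
  have ne: "?S \<noteq> {}" using assms(1) closure_subset by fastforce
  obtain z where z: "z \<in> ?S" "\<And>w. w \<in> ?S \<Longrightarrow> image_factor x i (fst z) (snd z) \<le> image_factor x i (fst w) (snd w)"
    using continuous_attains_inf[OF compact_Times[OF compact_Icc compact_closure_Omega] ne cont] by blast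
  show ?thesis
  proof (rule that)
    show "image_factor x i (fst z) (snd z) > 0" using z(1) assms by (intro image_factor_pos) auto
    show "image_factor x i (fst z) (snd z) \<le> image_factor x i q y" if "0 \<le> q" "q \<le> r\<^sup>2" "y \<in> closure \<Omega>" for q y
      using z(2)[of "(q, y)"] that by simp
  qed
qed

lemma lip_at0_green_profiles:
  assumes "x \<in> \<Omega>" "i < 4"
  shows "lip_at0 (r\<^sup>2) (closure \<Omega>) (\<lambda>q y. green_profile N (image_factor x i q y))"
    "lip_at0 (r\<^sup>2) (closure \<Omega>) (\<lambda>q y. green_profile1 N (image_factor x i q y))"
    "lip_at0 (r\<^sup>2) (closure \<Omega>) (\<lambda>q y. green_profile2 N (image_factor x i q y))"
proof -
  obtain \<eta> where \<eta>: "\<eta> > 0" "\<And>q y. 0 \<le> q \<Longrightarrow> q \<le> r\<^sup>2 \<Longrightarrow> y \<in> closure \<Omega> \<Longrightarrow> image_factor x i q y \<ge> \<eta>"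
    using image_factor_lower_bound[OF assms] by blast
  note comp = lip_at0_compose[OF lip_at0_image_factor \<eta>]
  show "lip_at0 (r\<^sup>2) (closure \<Omega>) (\<lambda>q y. green_profile N (image_factor x i q y))"
    by (rule comp[OF _ _ _ green_profile_derivs(1) continuous_on_green_profile(2)])
  show "lip_at0 (r\<^sup>2) (closure \<Omega>) (\<lambda>q y. green_profile1 N (image_factor x i q y))"
    by (rule comp[OF _ _ _ green_profile_derivs(2) continuous_on_green_profile(3)])
  show "lip_at0 (r\<^sup>2) (closure \<Omega>) (\<lambda>q y. green_profile2 N (image_factor x i q y))"
    by (rule comp[OF _ _ _ green_profile_derivs(3)]) (auto intro!: continuous_intros)
qed

text \<open>The Green function counts even images with + and odd ones with -. The regular part is
  the fundamental solution minus the Green function, so the signs are reversed and the source itself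
  is left out.\<close>

definition image_sign :: "nat \<Rightarrow> real" where "image_sign i = (if i < 2 then 1 else - 1)"

definition pair_sum :: "real ^ 'n \<Rightarrow> real \<Rightarrow> real ^ 'n \<Rightarrow> real" where
  "pair_sum x q y = (\<Sum>i<4. image_sign i * green_profile CARD('n) (image_factor x i q y))"
definition pair_grad :: "real ^ 'n \<Rightarrow> real \<Rightarrow> real ^ 'n \<Rightarrow> real ^ 'n" where
  "pair_grad x q y = (\<Sum>i<4. image_sign i *\<^sub>R (green_profile1 CARD('n) (image_factor x i q y) *\<^sub>R image_grad x i q y))"
definition pair_hess :: "real ^ 'n \<Rightarrow> real \<Rightarrow> real ^ 'n \<Rightarrow> real ^ 'n ^ 'n" where
  "pair_hess x q y = (\<Sum>i<4. image_sign i *\<^sub>R (green_profile1 CARD('n) (image_factor x i q y) *\<^sub>R ((2 * image_k x i q) *\<^sub>R mat 1) +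
     green_profile2 CARD('n) (image_factor x i q y) *\<^sub>R outer (image_grad x i q y) (image_grad x i q y)))"

lemma lip_at0_T:
  assumes "x \<in> \<Omega>"
  shows "lip_at0 (r\<^sup>2) (closure \<Omega>) (pair_sum x)" "lip_at0 (r\<^sup>2) (closure \<Omega>) (pair_grad x)" "lip_at0 (r\<^sup>2) (closure \<Omega>) (pair_hess x)"
  unfolding pair_sum_def[abs_def] pair_grad_def[abs_def] pair_hess_def[abs_def]
  by (intro lip_at0_sum lip_at0_mult lip_at0_scaleR lip_at0_const lip_at0_add lip_at0_outer lip_at0_image_coeffs lip_at0_image_grad
        lip_at0_green_profiles assms; simp)+

lemma c2_with_T:
  assumes "x \<in> \<Omega>" "0 \<le> q" "q \<le> r\<^sup>2"
  shows "c2_with \<Omega> (pair_sum x q) (pair_grad x q) (pair_hess x q)"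
proof -
  have pos: "image_factor x i q y > 0" if "i < 4" "y \<in> \<Omega>" for i y
    using image_factor_pos[OF assms(1) _ assms(2,3) that(1)] that(2) closure_subset by blast
  show ?thesis
    unfolding pair_sum_def[abs_def] pair_grad_def[abs_def] pair_hess_def[abs_def] image_grad_def image_factor_quad
    by (intro c2_with_sum c2_with_scale c2_with_green_profile open_Omega)
       (use pos in \<open>auto simp: image_factor_quad\<close>)
qed

lemma trace_add: "trace (X + Y) = trace X + trace (Y :: real ^ 'm ^ 'm)"
  and trace_scaleR: "trace (k *\<^sub>R X) = k * trace (X :: real ^ 'm ^ 'm)"
  by (simp_all add: trace_def sum.distrib sum_distrib_left)

lemma trace_pair_hess:
  assumes "x \<in> \<Omega>" "0 \<le> q" "q \<le> r\<^sup>2" "y \<in> \<Omega>"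
  shows "trace (pair_hess x q y) = 0"
proof -
  have pos: "image_factor x i q y > 0" if "i < 4" for i
    using image_factor_pos[OF assms(1) _ assms(2,3) that(1)] assms(4) closure_subset by blast
  have "trace (\<Sum>i<n. image_sign i *\<^sub>R (green_profile1 CARD('n) (image_factor x i q y) *\<^sub>R ((2 * image_k x i q) *\<^sub>R mat 1) +
     green_profile2 CARD('n) (image_factor x i q y) *\<^sub>R outer (image_grad x i q y) (image_grad x i q y))) = 0" if "n \<le> 4" for n
    using that
  proof (induction n)
    case (Suc n)
    then have "trace (green_profile1 CARD('n) (image_factor x n q y) *\<^sub>R ((2 * image_k x n q) *\<^sub>R mat 1) +
     green_profile2 CARD('n) (image_factor x n q y) *\<^sub>R outer (image_grad x n q y) (image_grad x n q y)) = 0"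
      using pos[of n] unfolding image_factor_quad image_grad_def by (intro trace_green_profile image_factor_null) simp
    with Suc show ?case by (simp add: trace_add trace_scaleR)
  qed (simp add: trace_def)
  then show ?thesis unfolding pair_hess_def by simp
qed

text \<open>At q = 0 the four factors are the products of A x or B x with A y or B y. Odd and even
  images take up each of A x, B x, A y, B y equally often, so the signed logarithms cancel, and with
  them the first two derivatives.\<close>

lemma T_at_0:
  assumes "CARD('n) = 2" "x \<in> \<Omega>" "y \<in> closure \<Omega>"
  shows "pair_sum x 0 y = 0" "pair_grad x 0 y = 0" "pair_hess x 0 y = 0"
proof -
  note bx = A_B_bounds[OF subsetD[OF closure_subset assms(2)]] and yb = A_B_bounds[OF assms(3)]
  define a where "a = (2 * kA) *\<^sub>R y + vA"
  define b where "b = (2 * kB) *\<^sub>R y + vA"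
  have image_factor: "image_factor x 0 0 y = A x * A y" "image_factor x (Suc 0) 0 y = B x * B y" "image_factor x 2 0 y = A x * B y" "image_factor x 3 0 y = B x * A y"
    using image_factor_0[of x 0 y] image_factor_1[of x 0 y] image_factor_2[of x 0 y] image_factor_3[of x 0 y] by simp_all
  have image_k: "image_k x 0 0 = A x * kA" "image_k x (Suc 0) 0 = B x * kB" "image_k x 2 0 = A x * kB" "image_k x 3 0 = B x * kA"
    by (simp_all add: image_k_def iq_k_def coefA_def coefB_def)
  have image_grad: "image_grad x 0 0 y = A x *\<^sub>R a" "image_grad x (Suc 0) 0 y = B x *\<^sub>R b" "image_grad x 2 0 y = A x *\<^sub>R b" "image_grad x 3 0 y = B x *\<^sub>R a"
    unfolding image_grad_def image_k image_v_def iq_v_def a_def b_def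
    by (simp_all add: coefA_def coefB_def scaleR_add_right mult_ac)
  have f1: "green_profile1 CARD('n) z = - 1 / (2 * z)" if "z > 0" for z
    using that assms(1) by (simp add: green_profile1_def powr_minus divide_simps)
  have f2: "green_profile2 CARD('n) z = 1 / (2 * (z * z))" if "z > 0" for z
  proof -
    have "z powr (- 1 - 1) = 1 / (z * z)" using that powr_minus[of z 2] by (simp add: power2_eq_square divide_simps)
    then show ?thesis using assms(1) by (simp add: green_profile2_def)
  qed
  have s4: "(\<Sum>i<4. g i) = g 0 + g (Suc 0) + g 2 + g 3" for g :: "nat \<Rightarrow> 'z::comm_monoid_add"
    by (simp add: eval_nat_numeral)
  show "pair_sum x 0 y = 0" unfolding pair_sum_def s4 image_factor image_sign_def green_profile_def using bx yb assms(1)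
    by (simp add: ln_mult add_divide_distrib diff_divide_distrib)
  have o: "outer (u *\<^sub>R v) (u *\<^sub>R v) = (u * u) *\<^sub>R outer v v" for u and v :: "real ^ 'n"
    by (simp add: outer_def vec_eq_iff)
  show "pair_grad x 0 y = 0" unfolding pair_grad_def s4 image_factor image_grad image_sign_def using bx yb
    by (simp add: f1 divide_simps)
  show "pair_hess x 0 y = 0" unfolding pair_hess_def s4 image_factor image_grad image_k image_sign_def o using bx yb
    by (simp add: f1 f2 scaleR_add_right vec_eq_iff divide_simps mat_def) 
qed

end

section \<open>The regular part as a sum over images\<close>

text \<open>Homogeneity of the profile: the normalisation by q turns into a weight. The logarithmic
  constant for N = 2 is harmless because the four image signs add up to 0.\<close>

lemma green_profile_scale:
  assumes "q > 0" "D > 0"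
  shows "q powr (real N / 2 - 1) * green_profile N D = green_profile N (D / q) - (if N = 2 then ln q / 2 else 0)"
proof (cases "N = 2")
  case True
  then show ?thesis using assms by (simp add: green_profile_def ln_div field_simps)
next
  case False
  have "q powr (real N / 2 - 1) = 1 / q powr (1 - real N / 2)"
    using powr_minus_divide[of q "1 - real N / 2"] by simp
  then show ?thesis using assms False by (simp add: green_profile_def powr_divide)
qed

section \<open>The candidate for the regular part and its boundary values\<close>

context eccentric_annulus begin

text \<open>The exponent starts at 2, not at 0. At q = 1 the four images degenerate: indices 2 and 3
  are the source itself, and 0 and 1 coincide in the reflection at the outer sphere, which
  \<open>regular_sum\<close> adds separately and once.\<close>

definition image_ratio :: "nat \<Rightarrow> real" where "image_ratio n = r ^ (2 * Suc n)"

lemma image_ratio_bounds: "0 < image_ratio n" "0 \<le> image_ratio n" "image_ratio n \<le> r\<^sup>2" "image_ratio n < 1"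
proof -
  show "0 < image_ratio n" using r_bounds by (simp add: image_ratio_def)
  then show "0 \<le> image_ratio n" by simp
  show "image_ratio n \<le> r\<^sup>2" unfolding image_ratio_def using r_bounds by (intro power_decreasing) auto
  then show "image_ratio n < 1" using r_bounds by simp
qed

definition gweight :: "real \<Rightarrow> real" where "gweight q = q powr (real CARD('n) / 2 - 1)"

text \<open>In dimension two the sum over the images has the right values on the outer sphere but differs by a
  constant from them on the inner one; the multiple of \<open>ln (A/B)\<close> repairs this.\<close>

definition planar_coef :: "real ^ 'n \<Rightarrow> real" where
  "planar_coef x = (if CARD('n) = 2 then ln (A x / B x) / (2 * ln e) else 0)"

definition regular_sum :: "real ^ 'n \<Rightarrow> real ^ 'n \<Rightarrow> real" where
  "regular_sum x y = green_profile CARD('n) (image_factor x 0 1 y) + (\<Sum>n. gweight (image_ratio n) * pair_sum x (image_ratio n) y) +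
    planar_coef x * (green_profile CARD('n) (B y) - green_profile CARD('n) (A y))"

text \<open>q = 1 is outside the range of \<open>image_factor_pos\<close>. The product (A x - B x)
  (A y - B y) vanishes only for y on the outer sphere, where the distance to x is positive.\<close>

lemma image_factor_0_1_pos:
  assumes "x \<in> \<Omega>" "y \<in> closure \<Omega>"
  shows "image_factor x 0 1 y > 0"
proof -
  have p: "A x - B x > 0" using A_B_strict[OF assms(1)] by simp
  show ?thesis
  proof (cases "A y - B y > 0")
    case True
    then show ?thesis using p by (simp add: image_factor_0 add_nonneg_pos)
  next
    case False
    then have "A y = B y" using A_B_bounds[OF assms(2)] by simp
    moreover have "x \<noteq> y" using False p by auto
    ultimately show ?thesis by (simp add: image_factor_0)
  qed
qed

lemma T_bound:
  assumes "x \<in> \<Omega>"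
  obtains M where "summable M"
    "\<And>n y. y \<in> closure \<Omega> \<Longrightarrow> \<bar>gweight (image_ratio n) * pair_sum x (image_ratio n) y\<bar> \<le> M n"
    "\<And>n y. y \<in> closure \<Omega> \<Longrightarrow> norm (gweight (image_ratio n) *\<^sub>R pair_grad x (image_ratio n) y) \<le> M n"
    "\<And>n y. y \<in> closure \<Omega> \<Longrightarrow> norm (gweight (image_ratio n) *\<^sub>R pair_hess x (image_ratio n) y) \<le> M n"
proof -
  have r: "0 < r" "r \<le> 1" using r_bounds by auto
  obtain M1 where M1: "\<And>n y. y \<in> closure \<Omega> \<Longrightarrow> norm (((r ^ (2 * Suc n)) powr (real CARD('n) / 2 - 1)) *\<^sub>R pair_sum x (r ^ (2 * Suc n)) y) \<le> M1 * r ^ Suc n"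
    using lip_at0_weighted_bound[OF lip_at0_T(1)[OF assms] r dim T_at_0(1)[OF _ assms]] by blast
  obtain M2 where M2: "\<And>n y. y \<in> closure \<Omega> \<Longrightarrow> norm (((r ^ (2 * Suc n)) powr (real CARD('n) / 2 - 1)) *\<^sub>R pair_grad x (r ^ (2 * Suc n)) y) \<le> M2 * r ^ Suc n"
    using lip_at0_weighted_bound[OF lip_at0_T(2)[OF assms] r dim T_at_0(2)[OF _ assms]] by blast
  obtain M3 where M3: "\<And>n y. y \<in> closure \<Omega> \<Longrightarrow> norm (((r ^ (2 * Suc n)) powr (real CARD('n) / 2 - 1)) *\<^sub>R pair_hess x (r ^ (2 * Suc n)) y) \<le> M3 * r ^ Suc n"
    using lip_at0_weighted_bound[OF lip_at0_T(3)[OF assms] r dim T_at_0(3)[OF _ assms]] by blast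
  define M where "M = max M1 (max M2 M3)"
  have le: "M1 * r ^ Suc n \<le> M * r ^ Suc n" "M2 * r ^ Suc n \<le> M * r ^ Suc n" "M3 * r ^ Suc n \<le> M * r ^ Suc n" for n
    using r by (auto simp: M_def intro!: mult_right_mono)
  show ?thesis
  proof (rule that[of "\<lambda>n. M * r ^ Suc n"])
    show "summable (\<lambda>n. M * r ^ Suc n)"
      using r_bounds by (intro summable_mult) (simp add: summable_geometric summable_mult)
    show "\<bar>gweight (image_ratio n) * pair_sum x (image_ratio n) y\<bar> \<le> M * r ^ Suc n" if "y \<in> closure \<Omega>" for n y
      using M1[OF that, of n] le(1)[of n] by (simp add: gweight_def image_ratio_def del: power_Suc)
    show "norm (gweight (image_ratio n) *\<^sub>R pair_grad x (image_ratio n) y) \<le> M * r ^ Suc n" if "y \<in> closure \<Omega>" for n y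
      using order_trans[OF M2[OF that, of n] le(2)[of n]] unfolding gweight_def image_ratio_def .
    show "norm (gweight (image_ratio n) *\<^sub>R pair_hess x (image_ratio n) y) \<le> M * r ^ Suc n" if "y \<in> closure \<Omega>" for n y
      using order_trans[OF M3[OF that, of n] le(3)[of n]] unfolding gweight_def image_ratio_def .
  qed
qed

lemma harmonic_green_profile:
  fixes b :: "real ^ 'm"
  assumes "open U" "\<And>y. y \<in> U \<Longrightarrow> quad k b c' y > 0" "b \<bullet> b = 4 * k * c'"
  obtains G H where "c2_with U (\<lambda>y. green_profile CARD('m) (quad k b c' y)) G H" "\<And>y. y \<in> U \<Longrightarrow> trace (H y) = 0"
  using c2_with_green_profile[OF assms(1,2)] trace_green_profile[OF assms(3,2)] by blast

text \<open>Every summand is the profile of a null quadratic; as \<open>A\<close> and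
  \<open>B\<close> are null themselves, the planar correction is harmonic too.\<close>

lemma harmonic_regular_sum:
  assumes x: "x \<in> \<Omega>"
  shows "harmonic_on \<Omega> (regular_sum x)"
proof -
  have cl: "y \<in> closure \<Omega>" if "y \<in> \<Omega>" for y using that closure_subset by blast
  obtain G0 H0 where 0: "c2_with \<Omega> (\<lambda>y. green_profile CARD('n) (image_factor x 0 1 y)) G0 H0" "\<And>y. y \<in> \<Omega> \<Longrightarrow> trace (H0 y) = 0"
    using harmonic_green_profile[OF open_Omega, of "image_k x 0 1" "image_v x 0 1" "image_c x 0 1"] image_factor_0_1_pos[OF x] cl image_factor_null
    unfolding image_factor_quad by metis
  obtain GA HA where A: "c2_with \<Omega> (\<lambda>y. green_profile CARD('n) (A y)) GA HA" "\<And>y. y \<in> \<Omega> \<Longrightarrow> trace (HA y) = 0"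
    using harmonic_green_profile[OF open_Omega, of kA vA cA] A_B_bounds(2) cl null_A
    unfolding A_quad by metis
  obtain GB HB where B: "c2_with \<Omega> (\<lambda>y. green_profile CARD('n) (B y)) GB HB" "\<And>y. y \<in> \<Omega> \<Longrightarrow> trace (HB y) = 0"
    using harmonic_green_profile[OF open_Omega, of kB vA cB] A_B_bounds(1) cl null_B
    unfolding B_quad by metis
  obtain M where M: "summable M"
    "\<And>n y. y \<in> closure \<Omega> \<Longrightarrow> \<bar>gweight (image_ratio n) * pair_sum x (image_ratio n) y\<bar> \<le> M n"
    "\<And>n y. y \<in> closure \<Omega> \<Longrightarrow> norm (gweight (image_ratio n) *\<^sub>R pair_grad x (image_ratio n) y) \<le> M n"
    "\<And>n y. y \<in> closure \<Omega> \<Longrightarrow> norm (gweight (image_ratio n) *\<^sub>R pair_hess x (image_ratio n) y) \<le> M n" by (rule T_bound[OF x]) (rule that, assumption+)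
  have T: "c2_with \<Omega> (\<lambda>y. \<Sum>n. gweight (image_ratio n) * pair_sum x (image_ratio n) y) (\<lambda>y. \<Sum>n. gweight (image_ratio n) *\<^sub>R pair_grad x (image_ratio n) y)
     (\<lambda>y. \<Sum>n. gweight (image_ratio n) *\<^sub>R pair_hess x (image_ratio n) y)"
    by (rule c2_with_series[where M = M]) (use M cl image_ratio_bounds x in \<open>auto intro!: c2_with_scale c2_with_T\<close>)
  have trT: "trace (\<Sum>n. gweight (image_ratio n) *\<^sub>R pair_hess x (image_ratio n) y) = 0" if "y \<in> \<Omega>" for y
  proof (rule trace_suminf)
    show "summable (\<lambda>n. gweight (image_ratio n) *\<^sub>R pair_hess x (image_ratio n) y)"
      by (rule summable_comparison_test'[OF M(1), of 0]) (use M(4) cl that in auto)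
    show "trace (gweight (image_ratio n) *\<^sub>R pair_hess x (image_ratio n) y) = 0" for n
      unfolding trace_scaleR using trace_pair_hess[OF x image_ratio_bounds(2,3) that] by simp
  qed
  have "c2_with \<Omega> (\<lambda>y. (green_profile CARD('n) (image_factor x 0 1 y) + (\<Sum>n. gweight (image_ratio n) * pair_sum x (image_ratio n) y)) +
     planar_coef x * (green_profile CARD('n) (B y) + (- 1) * green_profile CARD('n) (A y)))
     (\<lambda>y. (G0 y + (\<Sum>n. gweight (image_ratio n) *\<^sub>R pair_grad x (image_ratio n) y)) + planar_coef x *\<^sub>R (GB y + (- 1) *\<^sub>R GA y))
     (\<lambda>y. (H0 y + (\<Sum>n. gweight (image_ratio n) *\<^sub>R pair_hess x (image_ratio n) y)) + planar_coef x *\<^sub>R (HB y + (- 1) *\<^sub>R HA y))"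
    by (intro c2_with_add c2_with_scale 0 A B T)
  from c2_with_harmonic_on[OF this] show ?thesis
    unfolding regular_sum_def[abs_def] by (simp only: trace_add trace_scaleR 0 A B trT) simp
qed

lemma continuous_on_green_compose:
  assumes "continuous_on K F" "\<And>y. y \<in> K \<Longrightarrow> F y > 0"
  shows "continuous_on K (\<lambda>y. green_profile N (F y))"
  by (rule continuous_on_compose2[OF continuous_on_green_profile(1) assms(1)]) (use assms(2) in auto)

lemma continuous_on_image_factor: "continuous_on K (image_factor x i q)"
  unfolding image_factor_quad quad_def[abs_def] by (intro continuous_intros)

lemma continuous_regular_sum:
  assumes x: "x \<in> \<Omega>"
  shows "continuous_on (closure \<Omega>) (regular_sum x)"
proof -
  obtain M where M: "summable M"
    "\<And>n y. y \<in> closure \<Omega> \<Longrightarrow> \<bar>gweight (image_ratio n) * pair_sum x (image_ratio n) y\<bar> \<le> M n" by (rule T_bound[OF x]) (rule that, assumption+)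
  have T: "continuous_on (closure \<Omega>) (\<lambda>y. \<Sum>n. gweight (image_ratio n) * pair_sum x (image_ratio n) y)"
  proof (rule uniform_limit_theorem)
    show "uniform_limit (closure \<Omega>) (\<lambda>n y. \<Sum>i<n. gweight (image_ratio i) * pair_sum x (image_ratio i) y) (\<lambda>y. \<Sum>n. gweight (image_ratio n) * pair_sum x (image_ratio n) y) sequentially"
      by (rule Weierstrass_m_test[OF _ M(1)]) (use M(2) in auto)
    show "\<forall>\<^sub>F n in sequentially. continuous_on (closure \<Omega>) (\<lambda>y. \<Sum>i<n. gweight (image_ratio i) * pair_sum x (image_ratio i) y)"
      unfolding pair_sum_def
      by (intro always_eventually allI continuous_intros continuous_on_green_compose continuous_on_image_factor)
         (use image_factor_pos[OF x _ image_ratio_bounds(2,3)] in auto)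
  qed simp
  show ?thesis unfolding regular_sum_def[abs_def]
    by (intro continuous_intros T continuous_on_green_compose continuous_on_image_factor)
       (use image_factor_0_1_pos[OF x] A_B_bounds in auto)
qed

lemma gweight_pair_sum:
  assumes "x \<in> \<Omega>" "y \<in> closure \<Omega>"
  shows "gweight (image_ratio n) * pair_sum x (image_ratio n) y =
    green_profile CARD('n) (image_factor x 0 (image_ratio n) y / image_ratio n) + green_profile CARD('n) (image_factor x 1 (image_ratio n) y / image_ratio n)
    - green_profile CARD('n) (image_factor x 2 (image_ratio n) y / image_ratio n) - green_profile CARD('n) (image_factor x 3 (image_ratio n) y / image_ratio n)"
proof -
  have pos: "image_factor x i (image_ratio n) y > 0" if "i < 4" for i
    by (rule image_factor_pos[OF assms image_ratio_bounds(2,3) that])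
  have s4: "(\<Sum>i<4. g i) = g 0 + g 1 + g 2 + g 3" for g :: "nat \<Rightarrow> real"
    by (simp add: eval_nat_numeral)
  have eq: "gweight (image_ratio n) * green_profile CARD('n) (image_factor x i (image_ratio n) y) =
    green_profile CARD('n) (image_factor x i (image_ratio n) y / image_ratio n) - (if CARD('n) = 2 then ln (image_ratio n) / 2 else 0)" if "i < 4" for i
    unfolding gweight_def by (rule green_profile_scale[OF image_ratio_bounds(1) pos[OF that]])
  have "gweight (image_ratio n) * pair_sum x (image_ratio n) y = 
    gweight (image_ratio n) * green_profile CARD('n) (image_factor x 0 (image_ratio n) y) + gweight (image_ratio n) * green_profile CARD('n) (image_factor x 1 (image_ratio n) y)
    - gweight (image_ratio n) * green_profile CARD('n) (image_factor x 2 (image_ratio n) y) - gweight (image_ratio n) * green_profile CARD('n) (image_factor x 3 (image_ratio n) y)"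
    unfolding pair_sum_def s4 image_sign_def by (simp add: algebra_simps)
  then show ?thesis by (simp add: eq)
qed

text \<open>Here A y = B y, so index 0 cancels against 2 and 1 against 3 for each q, and the
  correction vanishes; the reflection alone gives the boundary value.\<close>

lemma regular_sum_outer_boundary:
  assumes "x \<in> \<Omega>" "y \<in> closure \<Omega>" "al y = 0"
  shows "regular_sum x y = green_profile CARD('n) ((y - x) \<bullet> (y - x))"
proof -
  have AB: "A y = B y" using A_minus_B[of y] assms(3) by simp
  have s4: "(\<Sum>i<4. g i) = g 0 + g 1 + g 2 + g 3" for g :: "nat \<Rightarrow> real"
    by (simp add: eval_nat_numeral)
  have "image_factor x 0 q y = image_factor x 2 q y" "image_factor x 1 q y = image_factor x 3 q y" for q
    unfolding image_factor_0 image_factor_1 image_factor_2 image_factor_3 AB by (simp_all add: algebra_simps)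
  then have "pair_sum x q y = 0" for q unfolding pair_sum_def s4 image_sign_def by simp
  then show ?thesis by (simp add: regular_sum_def AB image_factor_0)
qed

text \<open>On the inner sphere odd images coincide with even images of the neighbouring index, so the series telescopes.\<close>

lemma regular_sum_inner_boundary:
  assumes "x \<in> \<Omega>" "y \<in> closure \<Omega>" "be y = 0"
  shows "regular_sum x y = green_profile CARD('n) ((y - x) \<bullet> (y - x))"
proof -
  let ?g = "green_profile CARD('n)"
  define d where "d = (y - x) \<bullet> (y - x)"
  define \<rho> where "\<rho> = r\<^sup>2"
  have \<rho>: "0 < \<rho>" "\<rho> < 1" using r_bounds by (auto simp: \<rho>_def)
  note xB = A_B_bounds[OF subsetD[OF closure_subset assms(1)]] and yB = A_B_bounds[OF assms(2)]
  have Be: "B y = \<rho> * A y" using B_minus_A[of y] assms(3) e_gt_1 by (simp add: \<rho>_def r_def field_simps)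
  have image_ratio: "image_ratio n = \<rho> ^ Suc n" for n by (simp only: image_ratio_def \<rho>_def power_mult)
  have dpos: "d > 0" 
    using A_B_strict(2)[OF assms(1)] B_minus_A[of y] assms(3) by (auto simp: d_def)
  \<comment> \<open>\<open>U\<close> and \<open>W\<close> are the contributions of the two even
    families, with q = 1 included: \<open>U 1\<close> cancels the separate reflection and
    \<open>W 0\<close> is the desired boundary value.\<close>
  define U where "U n = ?g (image_factor x 2 (\<rho> ^ n) y / \<rho> ^ n)" for n
  define W where "W n = ?g (image_factor x 3 (\<rho> ^ n) y / \<rho> ^ n)" for n
  \<comment> \<open>\<open>B y = \<rho> * A y\<close> makes an odd image agree with an even one
    whose ratio differs by the factor \<open>\<rho>\<close>.\<close>
  have D0: "image_factor x 0 q y / q = image_factor x 2 (q * \<rho>) y / (q * \<rho>)" if "q > 0" for q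
    unfolding image_factor_0 image_factor_2 Be d_def[symmetric] using that \<rho> by (simp add: field_simps)
  have D1: "image_factor x 1 (q * \<rho>) y / (q * \<rho>) = image_factor x 3 q y / q" if "q > 0" for q
    unfolding image_factor_1 image_factor_3 Be d_def[symmetric] using that \<rho> by (simp add: field_simps)
  have U1: "?g (image_factor x 0 1 y) = U 1"
    using D0[of 1] by (simp add: U_def)
  have W0: "W 0 = ?g d" by (simp add: W_def image_factor_3 d_def)
  have T: "gweight (image_ratio n) * pair_sum x (image_ratio n) y = (U (Suc (Suc n)) - W (Suc n)) - (U (Suc n) - W n)" for n
  proof -
    have "image_factor x 0 (image_ratio n) y / image_ratio n = image_factor x 2 (\<rho> ^ Suc (Suc n)) y / \<rho> ^ Suc (Suc n)"
      using D0[of "\<rho> ^ Suc n"] \<rho> by (simp add: image_ratio mult_ac)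
    moreover have "image_factor x 1 (image_ratio n) y / image_ratio n = image_factor x 3 (\<rho> ^ n) y / \<rho> ^ n"
      using D1[of "\<rho> ^ n"] \<rho> by (simp add: image_ratio mult_ac)
    ultimately show ?thesis unfolding gweight_pair_sum[OF assms(1,2)] U_def W_def image_ratio[symmetric] by simp
  qed
  have q0: "(\<lambda>n. \<rho> ^ n) \<longlonglongrightarrow> 0" using \<rho> by (simp add: LIMSEQ_power_zero)
  have q0': "(\<lambda>n. \<rho> ^ Suc n) \<longlonglongrightarrow> 0" by (rule LIMSEQ_Suc[OF q0])
  have contIQ: "continuous_on UNIV (\<lambda>q. image_factor x 2 q y)" "continuous_on UNIV (\<lambda>q. image_factor x 3 q y)"
    unfolding image_factor_2 image_factor_3 by (intro continuous_intros)+
  have l2: "(\<lambda>n. image_factor x 2 (\<rho> ^ Suc n) y) \<longlonglongrightarrow> image_factor x 2 0 y"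
    using continuous_on_tendsto_compose[OF contIQ(1) q0'] by simp
  have l3: "(\<lambda>n. image_factor x 3 (\<rho> ^ n) y) \<longlonglongrightarrow> image_factor x 3 0 y"
    using continuous_on_tendsto_compose[OF contIQ(2) q0] by simp
  have z2: "image_factor x 2 0 y = A x * (\<rho> * A y)" and z3: "image_factor x 3 0 y = B x * A y" by (simp_all add: image_factor_2 image_factor_3 Be)
  have p2: "image_factor x 2 (\<rho> ^ Suc n) y > 0" for n
    using image_factor_pos[OF assms(1,2) image_ratio_bounds(2,3), of 2 n] by (simp add: image_ratio)
  have p3: "image_factor x 3 (\<rho> ^ n) y > 0" for n
  proof (cases n)
    case 0
    then show ?thesis using dpos by (simp add: image_factor_3 d_def)
  next
    case (Suc m)
    then show ?thesis using image_factor_pos[OF assms(1,2) image_ratio_bounds(2,3), of 3 m] by (simp add: image_ratio)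
  qed
  \<comment> \<open>The limit left over by telescoping. For N > 2 the weights force it to 0; for N =
    2 the quotient of the two image factors converges to a value depending on x only, and
    \<open>planar_coef\<close> is chosen to cancel its logarithm.\<close>
  have lim: "(\<lambda>n. U (Suc n) - W n) \<longlonglongrightarrow> - planar_coef x * ln e"
  proof (cases "CARD('n) = 2")
    case True
    have "U (Suc n) - W n = - ln (image_factor x 2 (\<rho> ^ Suc n) y / (\<rho> * image_factor x 3 (\<rho> ^ n) y)) / 2" for n
    proof -
      have "U (Suc n) - W n = (ln (image_factor x 3 (\<rho> ^ n) y / \<rho> ^ n) - ln (image_factor x 2 (\<rho> ^ Suc n) y / \<rho> ^ Suc n)) / 2"
        by (simp add: U_def W_def green_profile_def True)
      also have "\<dots> = - ln (image_factor x 2 (\<rho> ^ Suc n) y / (\<rho> * image_factor x 3 (\<rho> ^ n) y)) / 2"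
        using p2[of n] p3[of n] \<rho> by (simp add: ln_div ln_mult)
      finally show ?thesis .
    qed
    moreover have "(\<lambda>n. - ln (image_factor x 2 (\<rho> ^ Suc n) y / (\<rho> * image_factor x 3 (\<rho> ^ n) y)) / 2)
       \<longlonglongrightarrow> - ln (image_factor x 2 0 y / (\<rho> * image_factor x 3 0 y)) / 2"
      using xB yB \<rho> by (intro tendsto_intros l2 l3) (auto simp: z2 z3)
    moreover have "- ln (image_factor x 2 0 y / (\<rho> * image_factor x 3 0 y)) / 2 = - planar_coef x * ln e"
      using True xB yB \<rho> e_gt_1 by (simp add: z2 z3 planar_coef_def)
    ultimately show ?thesis by simp
  next
    case False
    have ge: "real CARD('n) / 2 - 1 > 0" using False dim by simp
    have Ue: "U (Suc n) = (\<rho> ^ Suc n) powr (real CARD('n) / 2 - 1) * ?g (image_factor x 2 (\<rho> ^ Suc n) y)" for n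
      unfolding U_def by (subst green_profile_scale) (use p2 \<rho> False in auto)
    have We: "W n = (\<rho> ^ n) powr (real CARD('n) / 2 - 1) * ?g (image_factor x 3 (\<rho> ^ n) y)" for n
      unfolding W_def by (subst green_profile_scale) (use p3 \<rho> False in auto)
    have cg: "isCont ?g z" if "z > 0" for z
      using green_profile_derivs(1)[OF that] DERIV_isCont by blast
    have "(\<lambda>n. (\<rho> ^ Suc n) powr (real CARD('n) / 2 - 1) * ?g (image_factor x 2 (\<rho> ^ Suc n) y)) \<longlonglongrightarrow>
        0 powr (real CARD('n) / 2 - 1) * ?g (image_factor x 2 0 y)"
      by (intro tendsto_mult tendsto_powr2 isCont_tendsto_compose[OF cg] q0' l2 tendsto_const)
         (use ge \<rho> xB yB in \<open>auto simp: z2\<close>)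
    moreover have "(\<lambda>n. (\<rho> ^ n) powr (real CARD('n) / 2 - 1) * ?g (image_factor x 3 (\<rho> ^ n) y)) \<longlonglongrightarrow>
        0 powr (real CARD('n) / 2 - 1) * ?g (image_factor x 3 0 y)"
      by (intro tendsto_mult tendsto_powr2 isCont_tendsto_compose[OF cg] q0 l3 tendsto_const)
         (use ge \<rho> xB yB in \<open>auto simp: z3\<close>)
    ultimately show ?thesis unfolding Ue We using tendsto_diff False by (fastforce simp: planar_coef_def)
  qed
  have "(\<lambda>n. gweight (image_ratio n) * pair_sum x (image_ratio n) y) sums (- planar_coef x * ln e - (U (Suc 0) - W 0))"
    unfolding T by (rule telescope_sums[OF lim])
  then have sum: "(\<Sum>n. gweight (image_ratio n) * pair_sum x (image_ratio n) y) = - planar_coef x * ln e - (U 1 - ?g d)"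
    by (simp add: sums_iff W0)
  have "planar_coef x * (?g (B y) - ?g (A y)) = planar_coef x * ln e"
    using yB \<rho> e_gt_1 by (simp add: planar_coef_def green_profile_def Be ln_mult) 
      (simp add: \<rho>_def r_def ln_div power_one_over ln_realpow diff_divide_distrib)
  then show ?thesis unfolding regular_sum_def U1 sum d_def[symmetric] by simp
qed

section \<open>Identification with the Robin function\<close>

definition green_const :: real where
  "green_const = (if CARD('n) = 2 then 1 / (2 * pi) else 1 / (real CARD('n) * measure lborel (ball (0 :: real ^ 'n) 1)))"

lemma green_const_pos: "green_const > 0"
proof -
  have "measure lborel (ball (0 :: real ^ 'n) 1) > 0"
    using content_ball_pos[of 1 "0 :: real ^ 'n"] by simp
  then show ?thesis using dim by (simp add: green_const_def)
qed

lemma fundamental_solution_eq: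
  fixes x y :: "real ^ 'n"
  assumes "x \<noteq> y"
  shows "fundamental_solution x y = green_const * green_profile CARD('n) ((y - x) \<bullet> (y - x))"
proof -
  have n: "norm (x - y) > 0" using assms by simp
  have d: "(y - x) \<bullet> (y - x) = (norm (x - y))\<^sup>2"
    by (simp add: dot_square_norm norm_minus_commute)
  show ?thesis
  proof (cases "CARD('n) = 2")
    case True
    then show ?thesis using n by (simp add: fundamental_solution_def green_const_def green_profile_def d ln_realpow)
  next
    case False
    have "((norm (x - y))\<^sup>2) powr (1 - real CARD('n) / 2) = norm (x - y) powr (real_of_int (2 - int CARD('n)))"
      using n powr_powr[of "norm (x - y)" 2 "1 - real CARD('n) / 2"] by (simp add: powr_numeral right_diff_distrib)
    also have "\<dots> = norm (x - y) powi (2 - int CARD('n))"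
      by (rule powr_real_of_int') (use n in auto)
    finally show ?thesis using False
      by (simp add: fundamental_solution_def green_const_def green_profile_def d)
  qed
qed

theorem robin_function_eq:
  assumes x: "x \<in> \<Omega>"
  shows "robin_function \<Omega> x = green_const * regular_sum x x"
proof -
  have cl: "x \<in> closure \<Omega>" using x closure_subset by blast
  \<comment> \<open>The value 0 off the closure follows the convention in
    \<open>regular_part\<close>.\<close>
  have "regular_part \<Omega> x = (\<lambda>y. if y \<in> closure \<Omega> then green_const * regular_sum x y else 0)"
  proof (rule regular_part_eqI[OF open_Omega bounded_Omega])
    have hC: "C2_on \<Omega> (regular_sum x)" "\<And>y. y \<in> \<Omega> \<Longrightarrow> laplacian (regular_sum x) y = 0"
      using harmonic_regular_sum[OF x] by (auto simp: harmonic_on_def)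
    note C = C2_on_imp_c2_with[OF open_Omega hC(1)]
    obtain G H where GH: "c2_with \<Omega> (regular_sum x) G H" "\<And>y. y \<in> \<Omega> \<Longrightarrow> trace (H y) = 0"
      by (rule that[OF C]) (use c2_with_laplacian[OF C] hC(2) in simp)
    have "c2_with \<Omega> (\<lambda>y. if y \<in> closure \<Omega> then green_const * regular_sum x y else 0)
        (\<lambda>y. green_const *\<^sub>R G y) (\<lambda>y. green_const *\<^sub>R H y)"
      by (rule c2_with_cong[OF c2_with_scale[OF GH(1)]]) (use closure_subset in auto)
    then show "harmonic_on \<Omega> (\<lambda>y. if y \<in> closure \<Omega> then green_const * regular_sum x y else 0)"
      by (rule c2_with_harmonic_on) (use GH(2) in \<open>simp add: trace_scaleR\<close>)
    have "continuous_on (closure \<Omega>) (\<lambda>y. green_const * regular_sum x y)"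
      by (intro continuous_intros continuous_regular_sum[OF x])
    then show "continuous_on (closure \<Omega>) (\<lambda>y. if y \<in> closure \<Omega> then green_const * regular_sum x y else 0)"
      by (rule continuous_on_eq) simp
    fix y assume "y \<in> frontier \<Omega>"
    then have y: "y \<in> closure \<Omega>" "al y = 0 \<or> be y = 0" using frontier_Omega by auto
    have "x \<noteq> y" using x y(2) Omega_eq by auto
    then show "(if y \<in> closure \<Omega> then green_const * regular_sum x y else 0) = fundamental_solution x y"
      using y regular_sum_outer_boundary[OF x y(1)] regular_sum_inner_boundary[OF x y(1)] fundamental_solution_eq by auto
  qed simp
  then show ?thesis using cl by (simp add: robin_function_def)
qed

end

section \<open>The planar radial profile\<close>

text \<open>Domination is required only near each point: in the applications the summands blow up at
  \<open>rmin e\<close>, so no global majorant exists.\<close>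

lemma series_twice_differentiable:
  fixes t t1 t2 :: "nat \<Rightarrow> real \<Rightarrow> real"
  assumes d1: "\<And>n x. x \<in> U \<Longrightarrow> (t n has_real_derivative t1 n x) (at x)"
    and d2: "\<And>n x. x \<in> U \<Longrightarrow> (t1 n has_real_derivative t2 n x) (at x)"
    and c2: "\<And>n. continuous_on U (t2 n)"
    and dom: "\<And>x. x \<in> U \<Longrightarrow> \<exists>V M. open V \<and> x \<in> V \<and> V \<subseteq> U \<and> summable M \<and>
      (\<forall>n. \<forall>y\<in>V. \<bar>t n y\<bar> \<le> M n \<and> \<bar>t1 n y\<bar> \<le> M n \<and> \<bar>t2 n y\<bar> \<le> M n)"
  shows "\<And>x. x \<in> U \<Longrightarrow> ((\<lambda>x. \<Sum>n. t n x) has_real_derivative (\<Sum>n. t1 n x)) (at x)"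
    "\<And>x. x \<in> U \<Longrightarrow> ((\<lambda>x. \<Sum>n. t1 n x) has_real_derivative (\<Sum>n. t2 n x)) (at x)"
    "continuous_on U (\<lambda>x. \<Sum>n. t2 n x)"
    "\<And>x. x \<in> U \<Longrightarrow> summable (\<lambda>n. t n x) \<and> summable (\<lambda>n. t1 n x) \<and> summable (\<lambda>n. t2 n x)"
proof -
  have dom': thesis if "x \<in> U" "\<And>V M. open V \<Longrightarrow> x \<in> V \<Longrightarrow> V \<subseteq> U \<Longrightarrow> summable M \<Longrightarrow>
     (\<And>n y. y \<in> V \<Longrightarrow> \<bar>t n y\<bar> \<le> M n) \<Longrightarrow> (\<And>n y. y \<in> V \<Longrightarrow> \<bar>t1 n y\<bar> \<le> M n) \<Longrightarrow>
     (\<And>n y. y \<in> V \<Longrightarrow> \<bar>t2 n y\<bar> \<le> M n) \<Longrightarrow> thesis" for x thesis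
    using dom[OF that(1)] that(2) by (elim exE conjE) blast
  fix x assume x: "x \<in> U"
  show "((\<lambda>x. \<Sum>n. t n x) has_real_derivative (\<Sum>n. t1 n x)) (at x)"
  proof (rule dom'[OF x])
    fix V M assume V: "open V" "x \<in> V" "V \<subseteq> U" and M: "summable M" "\<And>n y. y \<in> V \<Longrightarrow> \<bar>t n y\<bar> \<le> M n"
     "\<And>n y. y \<in> V \<Longrightarrow> \<bar>t1 n y\<bar> \<le> M n"
    show ?thesis unfolding has_field_derivative_def
      by (rule has_derivative_series_bilinear[OF V(1) bounded_bilinear_mult _ _ _ _ M(1) V(2)])
         (use V(3) M d1[unfolded has_field_derivative_def] in \<open>auto simp: abs_mult\<close>)
  qed
  show "((\<lambda>x. \<Sum>n. t1 n x) has_real_derivative (\<Sum>n. t2 n x)) (at x)"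
  proof (rule dom'[OF x])
    fix V M assume V: "open V" "x \<in> V" "V \<subseteq> U" and M: "summable M" "\<And>n y. y \<in> V \<Longrightarrow> \<bar>t1 n y\<bar> \<le> M n"
     "\<And>n y. y \<in> V \<Longrightarrow> \<bar>t2 n y\<bar> \<le> M n"
    show ?thesis unfolding has_field_derivative_def
      by (rule has_derivative_series_bilinear[OF V(1) bounded_bilinear_mult _ _ _ _ M(1) V(2)])
         (use V(3) M d2[unfolded has_field_derivative_def] in \<open>auto simp: abs_mult\<close>)
  qed
  show "summable (\<lambda>n. t n x) \<and> summable (\<lambda>n. t1 n x) \<and> summable (\<lambda>n. t2 n x)"
  proof (rule dom'[OF x])
    fix V M assume V: "x \<in> V" and M: "summable M" "\<And>n y. y \<in> V \<Longrightarrow> \<bar>t n y\<bar> \<le> M n"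
      "\<And>n y. y \<in> V \<Longrightarrow> \<bar>t1 n y\<bar> \<le> M n" "\<And>n y. y \<in> V \<Longrightarrow> \<bar>t2 n y\<bar> \<le> M n"
    show ?thesis
      by (intro conjI summable_comparison_test'[OF M(1), of 0]) (use M(2-4) V in auto)
  qed
next
  show "continuous_on U (\<lambda>x. \<Sum>n. t2 n x)"
  proof (rule continuous_at_imp_continuous_on, rule ballI)
    fix x assume x: "x \<in> U"
    obtain V M where V: "open V" "x \<in> V" "V \<subseteq> U" and M: "summable M" "\<And>n y. y \<in> V \<Longrightarrow> \<bar>t2 n y\<bar> \<le> M n"
      using dom[OF x] by (elim exE conjE) blast
    have "continuous_on V (\<lambda>x. \<Sum>n. t2 n x)"
    proof (rule uniform_limit_theorem)
      show "uniform_limit V (\<lambda>n x. \<Sum>i<n. t2 i x) (\<lambda>x. \<Sum>n. t2 n x) sequentially"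
        by (rule Weierstrass_m_test[OF _ M(1)]) (use M(2) in auto)
      show "\<forall>\<^sub>F n in sequentially. continuous_on V (\<lambda>x. \<Sum>i<n. t2 i x)"
        by (intro always_eventually allI continuous_intros continuous_on_subset[OF c2 V(3)])
    qed simp
    then show "isCont (\<lambda>x. \<Sum>n. t2 n x) x" using V by (simp add: continuous_on_eq_continuous_at)
  qed
qed

text \<open>These are \<open>sinh ((n+1) L)\<close> and \<open>cosh ((n+1) L)\<close> for \<open>e = exp L\<close>, and \<open>rmin e = coth L\<close>.\<close>

definition sh :: "real \<Rightarrow> nat \<Rightarrow> real" where "sh e n = (e ^ Suc n - (1 / e) ^ Suc n) / 2"
definition ch :: "real \<Rightarrow> nat \<Rightarrow> real" where "ch e n = (e ^ Suc n + (1 / e) ^ Suc n) / 2"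
definition kap :: "real \<Rightarrow> nat \<Rightarrow> real" where "kap e n = 1 / (sh e n)\<^sup>2"
definition rmin :: "real \<Rightarrow> real" where "rmin e = sqrt (1 + kap e 0)"

section \<open>Growth of \<open>sh\<close> and summability of the image weights\<close>

lemma ch_sh: assumes "e > 1" shows "(ch e n)\<^sup>2 - (sh e n)\<^sup>2 = 1"
proof -
  define x y where "x = e ^ Suc n" and "y = (1 / e) ^ Suc n"
  have "x * y = 1" using assms by (simp add: x_def y_def power_mult_distrib[symmetric] del: power_Suc)
  then show ?thesis unfolding ch_def sh_def x_def[symmetric] y_def[symmetric]
    by (simp add: power2_eq_square field_simps)
qed

lemma sh_Suc: assumes "e > 1" shows "sh e (Suc n) \<ge> e * sh e n"
proof -
  have "(1 / e) ^ Suc (Suc n) \<le> (1 / e) ^ n" using assms by (intro power_decreasing) auto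
  then have "e * (1 / e) ^ Suc n \<ge> (1 / e) ^ Suc (Suc n)" using assms by simp
  then have "(e * e ^ Suc n - e * (1 / e) ^ Suc n) / 2 \<le> (e * e ^ Suc n - (1 / e) ^ Suc (Suc n)) / 2"
    by (intro divide_right_mono diff_left_mono) simp_all
  moreover have "e * sh e n = (e * e ^ Suc n - e * (1 / e) ^ Suc n) / 2"
    unfolding sh_def by (simp only: right_diff_distrib times_divide_eq_right)
  moreover have "sh e (Suc n) = (e * e ^ Suc n - (1 / e) ^ Suc (Suc n)) / 2"
    by (simp only: sh_def power_Suc[of e "Suc n"])
  ultimately show ?thesis by (simp only:)
qed

lemma sh_0_pos: assumes "e > 1" shows "sh e 0 > 0"
proof -
  have "1 / e < 1" using assms by simp
  from less_trans[OF this assms] show ?thesis by (simp add: sh_def)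
qed

lemma sh_ge: assumes "e > 1" shows "sh e n \<ge> sh e 0 * e ^ n"
proof (induction n)
  case (Suc n)
  have "sh e 0 * e ^ Suc n = e * (sh e 0 * e ^ n)" by simp
  also have "\<dots> \<le> e * sh e n" using Suc assms by (intro mult_left_mono) auto
  finally show ?case using sh_Suc[OF assms, of n] by linarith
qed simp

lemma sh_ge_0: assumes "e > 1" shows "sh e n \<ge> sh e 0" "sh e n > 0"
proof -
  have "sh e 0 * 1 \<le> sh e 0 * e ^ n" using assms sh_0_pos[OF assms] by (intro mult_left_mono) auto
  then show "sh e n \<ge> sh e 0" using sh_ge[OF assms, of n] by linarith
  then show "sh e n > 0" using sh_0_pos[OF assms] by linarith
qed

lemma kap_bounds: assumes "e > 1" shows "kap e n > 0" "kap e n \<le> kap e 0"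
  using sh_ge_0[OF assms, of n] sh_0_pos[OF assms] by (auto simp: kap_def intro!: divide_left_mono power_mono)

text \<open>This is coth ((n+1) L), the place where the n-th summand becomes singular. The largest
  is \<open>rmin e\<close>, at n = 0, which corresponds to the inner sphere.\<close>

lemma sqrt_kap: assumes "e > 1" shows "sqrt (1 + kap e n) = ch e n / sh e n"
proof -
  have "1 + kap e n = (ch e n / sh e n)\<^sup>2"
    using ch_sh[OF assms, of n] sh_ge_0(2)[OF assms, of n] by (simp add: kap_def power_divide field_simps)
  moreover have "ch e n > 0" using assms by (simp add: ch_def add_pos_pos)
  ultimately show ?thesis using sh_ge_0(2)[OF assms, of n] by simp
qed

lemma rmin_gt_1: assumes "e > 1" shows "rmin e > 1"
  using kap_bounds[OF assms, of 0] by (simp add: rmin_def)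

lemma rmin_sq: assumes "e > 1" shows "(rmin e)\<^sup>2 = 1 + kap e 0"
  using kap_bounds[OF assms, of 0] by (simp add: rmin_def)

lemma summable_inverse_sh: assumes "e > 1" shows "summable (\<lambda>n. 1 / sh e n)"
proof (rule summable_comparison_test')
  show "summable (\<lambda>n. 1 / sh e 0 * (1 / e) ^ n)"
    using assms by (intro summable_mult summable_geometric) simp
  show "norm (1 / sh e n) \<le> 1 / sh e 0 * (1 / e) ^ n" for n
  proof -
    have "1 / sh e n \<le> 1 / (sh e 0 * e ^ n)"
      using sh_ge[OF assms, of n] sh_0_pos[OF assms] assms sh_ge_0(2)[OF assms, of n] by (intro divide_left_mono) auto
    then show ?thesis using sh_ge_0(2)[OF assms, of n] by (simp add: power_one_over)
  qed
qed

lemma summable_kap: assumes "e > 1" shows "summable (kap e)"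
proof (rule summable_comparison_test')
  show "summable (\<lambda>n. 1 / sh e 0 * (1 / sh e n))"
    by (intro summable_mult summable_inverse_sh assms)
  show "norm (kap e n) \<le> 1 / sh e 0 * (1 / sh e n)" for n
    using sh_ge_0[OF assms, of n] sh_0_pos[OF assms] 
    by (simp add: kap_def power2_eq_square) (intro divide_left_mono mult_right_mono mult_pos_pos, auto)
qed

text \<open>For \<open>C = cosh d\<close> the last inequality is convexity in \<open>d\<close>.\<close>

definition radial_profile :: "real \<Rightarrow> (real \<Rightarrow> real) \<Rightarrow> (real \<Rightarrow> real) \<Rightarrow> (real \<Rightarrow> real) \<Rightarrow> bool" where
  "radial_profile e w w1 w2 \<longleftrightarrow>
    (\<forall>C>rmin e. (w has_real_derivative w1 C) (at C) \<and> (w1 has_real_derivative w2 C) (at C) \<and>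
       w C \<ge> 0 \<and> w1 C < 0 \<and> (C\<^sup>2 - 1) * w2 C + C * w1 C \<ge> 0) \<and>
    continuous_on {rmin e<..} w2 \<and> (\<forall>K. \<exists>C>rmin e. w C > K)"

lemma gt_rmin:
  assumes "e > 1" "C > rmin e"
  shows "C > 1" "C\<^sup>2 - 1 > 0" "q \<le> kap e 0 \<Longrightarrow> C\<^sup>2 - 1 - q > 0"
proof -
  show "C > 1" using rmin_gt_1[OF assms(1)] assms(2) by simp
  have "(rmin e)\<^sup>2 < C\<^sup>2" using rmin_gt_1[OF assms(1)] assms(2) by (intro power_strict_mono) auto
  then show "C\<^sup>2 - 1 > 0" "q \<le> kap e 0 \<Longrightarrow> C\<^sup>2 - 1 - q > 0"
    using rmin_sq[OF assms(1)] kap_bounds(1)[OF assms(1), of 0] by auto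
qed

text \<open>The four logarithms of one group of images on the diagonal, with q = 1 / sinh^2 ((n+1)
  L) and C^2 - 1 - q factoring at C = +-coth ((n+1) L).\<close>

definition planar_term :: "real \<Rightarrow> real \<Rightarrow> real" where "planar_term q C = ln (C\<^sup>2 - 1) - ln (C\<^sup>2 - 1 - q)"
definition planar_term1 :: "real \<Rightarrow> real \<Rightarrow> real" where "planar_term1 q C = 2 * C * (inverse (C\<^sup>2 - 1) - inverse (C\<^sup>2 - 1 - q))"
definition planar_term2 :: "real \<Rightarrow> real \<Rightarrow> real" where
  "planar_term2 q C = 2 * (inverse (C\<^sup>2 - 1) - inverse (C\<^sup>2 - 1 - q))
     - 4 * C\<^sup>2 * ((inverse (C\<^sup>2 - 1))\<^sup>2 - (inverse (C\<^sup>2 - 1 - q))\<^sup>2)"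

lemma planar_term_derivs:
  assumes "C\<^sup>2 - 1 > 0" "C\<^sup>2 - 1 - q > 0"
  shows "(planar_term q has_real_derivative planar_term1 q C) (at C)" "(planar_term1 q has_real_derivative planar_term2 q C) (at C)"
proof -
  show "(planar_term q has_real_derivative planar_term1 q C) (at C)"
    unfolding planar_term_def[abs_def] planar_term1_def using assms
    by (auto intro!: derivative_eq_intros simp: inverse_eq_divide right_diff_distrib)
  show "(planar_term1 q has_real_derivative planar_term2 q C) (at C)"
    unfolding planar_term1_def[abs_def] planar_term2_def using assms
    by (auto intro!: derivative_eq_intros simp: power2_eq_square algebra_simps)
qed

text \<open>With p = C^2 - 1 and s = p - q the derivative and the convexity expression become
  multiples of 1/s - 1/p > 0, and the sign of the other factor is visible.\<close>

lemma planar_term_signs: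
  assumes "C > 1" "C\<^sup>2 - 1 - q > 0" "q > 0"
  shows "planar_term q C > 0" "planar_term1 q C < 0" "(C\<^sup>2 - 1) * planar_term2 q C + C * planar_term1 q C > 0"
proof -
  define p where "p = C\<^sup>2 - 1"
  define s where "s = p - q"
  have s: "s > 0" "s < p" "p > 0" using assms by (auto simp: p_def s_def)
  have C2: "C\<^sup>2 = p + 1" by (simp add: p_def)
  show "planar_term q C > 0" unfolding planar_term_def p_def[symmetric] s_def[symmetric] using s by simp
  have inv: "inverse p < inverse s" using s by simp
  show b: "planar_term1 q C < 0" unfolding planar_term1_def p_def[symmetric] s_def[symmetric]
    using inv assms(1) by (intro mult_pos_neg) auto
  have "(C\<^sup>2 - 1) * planar_term2 q C + C * planar_term1 q C =
     p * (2 * (inverse p - inverse s) - 4 * (p + 1) * ((inverse p)\<^sup>2 - (inverse s)\<^sup>2)) + 2 * (p + 1) * (inverse p - inverse s)"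
    unfolding planar_term1_def planar_term2_def p_def[symmetric] s_def[symmetric] C2[symmetric] by (simp add: power2_eq_square)
  also have "\<dots> = (inverse s - inverse p) * (4 * (p + 1) * p * (inverse p + inverse s) - 2 * p - 2 * (p + 1))"
    by (simp add: power2_eq_square algebra_simps)
  also have "4 * (p + 1) * p * (inverse p + inverse s) = 4 * (p + 1) + 4 * (p + 1) * p * inverse s"
    using s by (simp add: field_simps)
  also have "(inverse s - inverse p) * (4 * (p + 1) + 4 * (p + 1) * p * inverse s - 2 * p - 2 * (p + 1)) > 0"
    using inv s by (intro mult_pos_pos) (auto simp: algebra_simps intro!: add_pos_pos add_pos_nonneg)
  finally show "(C\<^sup>2 - 1) * planar_term2 q C + C * planar_term1 q C > 0" .
qed

lemma lip_at0_inverse: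
  assumes "lip_at0 q1 K F" "\<eta> > 0" "\<And>q y. 0 \<le> q \<Longrightarrow> q \<le> q1 \<Longrightarrow> y \<in> K \<Longrightarrow> F q y \<ge> (\<eta> :: real)"
  shows "lip_at0 q1 K (\<lambda>q y. inverse (F q y))"
  by (rule lip_at0_compose[OF assms, where g' = "\<lambda>z. - (inverse z ^ 2)"])
     (auto intro!: derivative_eq_intros continuous_intros simp: power2_eq_square)

lemma lip_at0_ln:
  assumes "lip_at0 q1 K F" "\<eta> > 0" "\<And>q y. 0 \<le> q \<Longrightarrow> q \<le> q1 \<Longrightarrow> y \<in> K \<Longrightarrow> F q y \<ge> (\<eta> :: real)"
  shows "lip_at0 q1 K (\<lambda>q y. ln (F q y))"
  by (rule lip_at0_compose[OF assms, where g' = "\<lambda>z. inverse z"])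
     (auto intro!: derivative_eq_intros continuous_intros simp: divide_inverse)

lemma lip_at0_diff:
  assumes "lip_at0 q1 K F" "lip_at0 q1 K G"
  shows "lip_at0 q1 K (\<lambda>q y. F q y - G q y)"
  using lip_at0_add[OF assms(1) lip_at0_scaleR[OF lip_at0_const[of _ _ "- 1"] assms(2)]] by simp

lemma lip_at0_id_Icc: "lip_at0 q1 {c1..c2 :: real} (\<lambda>q y. y)"
  by (rule lip_at0_param[of _ _ "max \<bar>c1\<bar> \<bar>c2\<bar>"]) auto

lemma lip_at0_power2: "lip_at0 q1 K F \<Longrightarrow> lip_at0 q1 K (\<lambda>q y. (F q y :: real)\<^sup>2)"
  unfolding power2_eq_square by (rule lip_at0_mult)

lemma Icc_nhd:
  fixes C c0 :: real assumes "C > c0"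
  obtains c1 c2 where "c0 < c1" "C \<in> {c1<..<c2}" "{c1<..<c2} \<subseteq> {c0<..}" "{c1..c2} \<subseteq> {c0<..}"
  by (rule that[of "(C + c0) / 2" "C + 1"]) (use assms in auto)

text \<open>The terms vanish at q = 0, so this bounds them by M q with q = \<open>kap e n\<close>,
  which is summable.\<close>

lemma planar_term_lipschitz:
  assumes e: "e > 1" and c: "rmin e < c1"
  shows "lip_at0 (kap e 0) {c1..c2} planar_term" "lip_at0 (kap e 0) {c1..c2} planar_term1" "lip_at0 (kap e 0) {c1..c2} planar_term2"
proof -
  define \<eta> where "\<eta> = c1\<^sup>2 - 1 - kap e 0"
  have \<eta>: "\<eta> > 0" using gt_rmin(3)[OF e c, of "kap e 0"] by (simp add: \<eta>_def)
  have low: "y\<^sup>2 - 1 - q \<ge> \<eta>" "y\<^sup>2 - 1 \<ge> \<eta>" if "0 \<le> q" "q \<le> kap e 0" "y \<in> {c1..c2}" for q y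
  proof -
    have "c1\<^sup>2 \<le> y\<^sup>2" using that gt_rmin(1)[OF e c] by (intro power_mono) auto
    then show "y\<^sup>2 - 1 - q \<ge> \<eta>" "y\<^sup>2 - 1 \<ge> \<eta>" using that by (auto simp: \<eta>_def)
  qed
  note L = lip_at0_diff lip_at0_power2 lip_at0_mult lip_at0_const lip_at0_q lip_at0_id_Icc 
    lip_at0_ln[OF _ \<eta>] lip_at0_inverse[OF _ \<eta>] low
  show "lip_at0 (kap e 0) {c1..c2} planar_term" "lip_at0 (kap e 0) {c1..c2} planar_term1" "lip_at0 (kap e 0) {c1..c2} planar_term2"
    unfolding planar_term_def[abs_def] planar_term1_def[abs_def] planar_term2_def[abs_def] by (intro L; assumption)+
qed

lemma planar_term_at_0: "planar_term 0 C = 0" "planar_term1 0 C = 0" "planar_term2 0 C = 0"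
  by (simp_all add: planar_term_def planar_term1_def planar_term2_def)

lemma lip_at0_bound_0:
  assumes "lip_at0 q1 K F" "\<And>y. y \<in> K \<Longrightarrow> F 0 y = (0 :: real)"
  obtains M where "M \<ge> 0" "\<And>q y. 0 \<le> q \<Longrightarrow> q \<le> q1 \<Longrightarrow> y \<in> K \<Longrightarrow> \<bar>F q y\<bar> \<le> M * q"
proof -
  obtain M where "M \<ge> 0" "\<And>q y. 0 \<le> q \<Longrightarrow> q \<le> q1 \<Longrightarrow> y \<in> K \<Longrightarrow> norm (F q y - F 0 y) \<le> M * q"
    by (rule lip_at0E[OF assms(1)]) (rule that, assumption+)
  with assms(2) show ?thesis by (intro that[of M]) auto
qed

lemma planar_term_series:
  assumes e: "e > 1"
  shows "\<And>C. C > rmin e \<Longrightarrow> ((\<lambda>C. \<Sum>n. planar_term (kap e n) C) has_real_derivative (\<Sum>n. planar_term1 (kap e n) C)) (at C)"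
    "\<And>C. C > rmin e \<Longrightarrow> ((\<lambda>C. \<Sum>n. planar_term1 (kap e n) C) has_real_derivative (\<Sum>n. planar_term2 (kap e n) C)) (at C)"
    "continuous_on {rmin e<..} (\<lambda>C. \<Sum>n. planar_term2 (kap e n) C)"
    "\<And>C. C > rmin e \<Longrightarrow> summable (\<lambda>n. planar_term (kap e n) C) \<and> summable (\<lambda>n. planar_term1 (kap e n) C) \<and> summable (\<lambda>n. planar_term2 (kap e n) C)"
proof -
  have "\<exists>V M. open V \<and> C \<in> V \<and> V \<subseteq> {rmin e<..} \<and> summable M \<and>
      (\<forall>n. \<forall>y\<in>V. \<bar>planar_term (kap e n) y\<bar> \<le> M n \<and> \<bar>planar_term1 (kap e n) y\<bar> \<le> M n \<and> \<bar>planar_term2 (kap e n) y\<bar> \<le> M n)"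
    if C: "C \<in> {rmin e<..}" for C
  proof -
    obtain c1 c2 where c: "rmin e < c1" "C \<in> {c1<..<c2}" "{c1<..<c2} \<subseteq> {rmin e<..}"
      by (rule Icc_nhd[OF C[unfolded greaterThan_iff]]) (rule that, assumption+)
    obtain Ma where Ma: "\<And>q y. 0 \<le> q \<Longrightarrow> q \<le> kap e 0 \<Longrightarrow> y \<in> {c1..c2} \<Longrightarrow> \<bar>planar_term q y\<bar> \<le> Ma * q"
      by (rule lip_at0_bound_0[OF planar_term_lipschitz(1)[OF e c(1)] planar_term_at_0(1)]) (rule that, assumption+)
    obtain Mb where Mb: "\<And>q y. 0 \<le> q \<Longrightarrow> q \<le> kap e 0 \<Longrightarrow> y \<in> {c1..c2} \<Longrightarrow> \<bar>planar_term1 q y\<bar> \<le> Mb * q"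
      by (rule lip_at0_bound_0[OF planar_term_lipschitz(2)[OF e c(1)] planar_term_at_0(2)]) (rule that, assumption+)
    obtain Mc where Mc: "\<And>q y. 0 \<le> q \<Longrightarrow> q \<le> kap e 0 \<Longrightarrow> y \<in> {c1..c2} \<Longrightarrow> \<bar>planar_term2 q y\<bar> \<le> Mc * q"
      by (rule lip_at0_bound_0[OF planar_term_lipschitz(3)[OF e c(1)] planar_term_at_0(3)]) (rule that, assumption+)
    define M where "M = max Ma (max Mb Mc)"
    have le: "Ma * kap e n \<le> M * kap e n" "Mb * kap e n \<le> M * kap e n" "Mc * kap e n \<le> M * kap e n" for n
      using kap_bounds[OF e, of n] by (auto simp: M_def intro!: mult_right_mono)
    have "\<bar>planar_term (kap e n) y\<bar> \<le> M * kap e n \<and> \<bar>planar_term1 (kap e n) y\<bar> \<le> M * kap e n \<and> \<bar>planar_term2 (kap e n) y\<bar> \<le> M * kap e n"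
      if "y \<in> {c1<..<c2}" for n y
      by (intro conjI order_trans[OF Ma le(1)] order_trans[OF Mb le(2)] order_trans[OF Mc le(3)])
         (use kap_bounds[OF e, of n] that in auto)
    moreover have "summable (\<lambda>n. M * kap e n)" by (intro summable_mult summable_kap e)
    ultimately show ?thesis using c by (intro exI[of _ "{c1<..<c2}"] exI[of _ "\<lambda>n. M * kap e n"]) auto
  qed
  note dom = this
  have d: "(planar_term (kap e n) has_real_derivative planar_term1 (kap e n) C) (at C)" "(planar_term1 (kap e n) has_real_derivative planar_term2 (kap e n) C) (at C)"
    if "C \<in> {rmin e<..}" for n C
    using that gt_rmin(2)[OF e, of C] gt_rmin(3)[OF e, of C "kap e n"] kap_bounds[OF e, of n] by (auto intro!: planar_term_derivs)
  have c: "continuous_on {rmin e<..} (planar_term2 (kap e n))" for n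
    unfolding planar_term2_def using gt_rmin(2,3)[OF e] kap_bounds[OF e, of n]
    by (intro continuous_intros) (auto, force+)
  note S = series_twice_differentiable[of "{rmin e<..}" "\<lambda>n. planar_term (kap e n)" "\<lambda>n. planar_term1 (kap e n)" "\<lambda>n. planar_term2 (kap e n)", OF d c dom]
  show "\<And>C. C > rmin e \<Longrightarrow> ((\<lambda>C. \<Sum>n. planar_term (kap e n) C) has_real_derivative (\<Sum>n. planar_term1 (kap e n) C)) (at C)"
    "\<And>C. C > rmin e \<Longrightarrow> ((\<lambda>C. \<Sum>n. planar_term1 (kap e n) C) has_real_derivative (\<Sum>n. planar_term2 (kap e n) C)) (at C)"
    "continuous_on {rmin e<..} (\<lambda>C. \<Sum>n. planar_term2 (kap e n) C)"
    "\<And>C. C > rmin e \<Longrightarrow> summable (\<lambda>n. planar_term (kap e n) C) \<and> summable (\<lambda>n. planar_term1 (kap e n) C) \<and> summable (\<lambda>n. planar_term2 (kap e n) C)"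
    using S by auto
qed

text \<open>The first summand is the planar correction on the diagonal, where A/B = (C + 1)/(C - 1).
  For C = cosh d with d > 0 the logarithm of this ratio is twice the dual distance introduced
  below.\<close>

definition planar_profile :: "real \<Rightarrow> real \<Rightarrow> real" where
  "planar_profile e C = (ln (C + 1) - ln (C - 1))\<^sup>2 / (4 * ln e) + (\<Sum>n. planar_term (kap e n) C)"

lemma planar_radial_profile:
  assumes e: "e > 1"
  obtains w1 w2 where "radial_profile e (planar_profile e) w1 w2"
proof
  define v where "v C = ln (C + 1) - ln (C - 1)" for C :: real
  define L where "L = ln e"
  have L: "L > 0" using e by (simp add: L_def)
  let ?w1 = "\<lambda>C. - v C / (L * (C\<^sup>2 - 1)) + (\<Sum>n. planar_term1 (kap e n) C)"
  let ?w2 = "\<lambda>C. (2 + 2 * C * v C) / (L * (C\<^sup>2 - 1)\<^sup>2) + (\<Sum>n. planar_term2 (kap e n) C)"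
  show "radial_profile e (planar_profile e) ?w1 ?w2"
    unfolding radial_profile_def
  proof (intro conjI allI impI)
    fix C assume C: "C > rmin e"
    note C1 = gt_rmin(1,2)[OF e C]
    have dv: "(v has_real_derivative (- 2 / (C\<^sup>2 - 1))) (at C)"
    proof -
      have "(v has_real_derivative (1 / (C + 1) - 1 / (C - 1))) (at C)"
        unfolding v_def[abs_def] using C1 by (auto intro!: derivative_eq_intros)
      moreover have "C\<^sup>2 - 1 = (C + 1) * (C - 1)" by (simp add: power2_eq_square algebra_simps)
      then have "1 / (C + 1) - 1 / (C - 1) = - 2 / (C\<^sup>2 - 1)"
        using C1 by (simp add: diff_frac_eq)
      ultimately show ?thesis by simp
    qed
    have vpos: "v C > 0" using C1 by (simp add: v_def)
    have p: "C\<^sup>2 - 1 \<noteq> 0" using C1(2) by linarith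
    have "((\<lambda>C. (v C)\<^sup>2 / (4 * L)) has_real_derivative (- v C / (L * (C\<^sup>2 - 1)))) (at C)"
      using L p by (auto intro!: derivative_eq_intros dv simp: field_simps)
    from DERIV_add[OF this planar_term_series(1)[OF e C]]
    show "(planar_profile e has_real_derivative ?w1 C) (at C)"
      by (simp add: planar_profile_def[abs_def] v_def[abs_def] L_def)
    have "((\<lambda>C. - v C / (L * (C\<^sup>2 - 1))) has_real_derivative (- (- 2 / (C\<^sup>2 - 1)) * (L * (C\<^sup>2 - 1)) - (- v C) * (L * (2 * C))) / (L * (C\<^sup>2 - 1) * (L * (C\<^sup>2 - 1)))) (at C)"
    proof (rule DERIV_divide[OF DERIV_minus[OF dv]])
      show "((\<lambda>C. L * (C\<^sup>2 - 1)) has_real_derivative L * (2 * C)) (at C)"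
        by (auto intro!: derivative_eq_intros)
    qed (use L p in auto)
    also have "(- (- 2 / (C\<^sup>2 - 1)) * (L * (C\<^sup>2 - 1)) - (- v C) * (L * (2 * C))) / (L * (C\<^sup>2 - 1) * (L * (C\<^sup>2 - 1)))
        = (2 + 2 * C * v C) / (L * (C\<^sup>2 - 1)\<^sup>2)"
    proof -
      define z where "z = C\<^sup>2 - 1"
      have "z \<noteq> 0" using p by (simp add: z_def)
      then show ?thesis using L unfolding z_def[symmetric] by (simp add: field_simps power2_eq_square)
    qed
    finally show "(?w1 has_real_derivative ?w2 C) (at C)"
      by (rule DERIV_add[OF _ planar_term_series(2)[OF e C]])
    have kp: "C\<^sup>2 - 1 - kap e n > 0" "kap e n > 0" for n
      using gt_rmin(3)[OF e C] kap_bounds[OF e, of n] by auto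
    note image_sign = planar_term_signs[OF C1(1) kp]
    note sm = planar_term_series(4)[OF e C]
    have "(\<Sum>n. planar_term (kap e n) C) \<ge> 0"
      using sm image_sign(1) by (intro suminf_nonneg) (auto intro: less_imp_le)
    then show "planar_profile e C \<ge> 0" using L by (simp add: planar_profile_def L_def)
    have b: "(\<Sum>n. planar_term1 (kap e n) C) \<le> 0"
      using sm image_sign(2) suminf_le[of "\<lambda>n. planar_term1 (kap e n) C" "\<lambda>_. 0"] by (auto intro: less_imp_le)
    have "v C / (L * (C\<^sup>2 - 1)) > 0" using vpos L C1 by simp
    with b show "?w1 C < 0" by simp
    have "(\<Sum>n. (C\<^sup>2 - 1) * planar_term2 (kap e n) C + C * planar_term1 (kap e n) C) \<ge> 0"
      using sm image_sign(3) by (intro suminf_nonneg) (auto intro: less_imp_le summable_add summable_mult)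
    moreover have "(\<Sum>n. (C\<^sup>2 - 1) * planar_term2 (kap e n) C + C * planar_term1 (kap e n) C) =
       (C\<^sup>2 - 1) * (\<Sum>n. planar_term2 (kap e n) C) + C * (\<Sum>n. planar_term1 (kap e n) C)"
      using sm by (simp add: suminf_add[symmetric] suminf_mult summable_mult)
    moreover have "(C\<^sup>2 - 1) * ((2 + 2 * C * v C) / (L * (C\<^sup>2 - 1)\<^sup>2)) + C * (- v C / (L * (C\<^sup>2 - 1))) \<ge> 0"
    proof -
      define z where "z = C\<^sup>2 - 1"
      have z: "z > 0" using C1 by (simp add: z_def)
      have "z * ((2 + 2 * C * v C) / (L * z\<^sup>2)) + C * (- v C / (L * z)) = (2 + C * v C) / (L * z)"
        using z L by (simp add: divide_simps power2_eq_square)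
      moreover have "\<dots> \<ge> 0" using z L vpos C1 by simp
      ultimately show ?thesis unfolding z_def by simp
    qed
    ultimately show "(C\<^sup>2 - 1) * ?w2 C + C * ?w1 C \<ge> 0" by (simp add: algebra_simps)
  next
    have "continuous_on {rmin e<..} v"
      unfolding v_def[abs_def] using gt_rmin(1)[OF e] by (intro continuous_intros) (auto, force+)
    then show "continuous_on {rmin e<..} ?w2"
      using L gt_rmin(2)[OF e] by (intro continuous_intros planar_term_series(3) e) (auto, force)
  next
    fix K :: real
    have k0: "kap e 0 > 0" using kap_bounds[OF e, of 0] by simp
    \<comment> \<open>With C^2 = 1 + \<open>kap e 0\<close> + d the term n = 0 equals ln
      (\<open>kap e 0\<close> + d) - ln d, and this d is small enough to lift it above K.\<close>
    define d where "d = min (kap e 0 * exp (- \<bar>K\<bar>)) 1"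
    have d: "d > 0" using k0 by (simp add: d_def)
    define C where "C = sqrt (1 + kap e 0 + d)"
    have C: "C > rmin e" using d by (simp add: C_def rmin_def)
    have Csq: "C\<^sup>2 = 1 + kap e 0 + d" using k0 d by (simp add: C_def)
    have kp: "C\<^sup>2 - 1 - kap e n > 0" "kap e n > 0" for n
      using gt_rmin(3)[OF e C] kap_bounds[OF e, of n] by auto
    have "ln d \<le> ln (kap e 0 * exp (- \<bar>K\<bar>))" using d by (subst ln_le_cancel_iff) (auto simp: d_def k0)
    also have "\<dots> = ln (kap e 0) - \<bar>K\<bar>" using k0 by (simp add: ln_mult)
    also have "\<dots> < ln (kap e 0 + d) - \<bar>K\<bar>" using k0 d by simp
    finally have "K < planar_term (kap e 0) C" by (simp add: planar_term_def Csq)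
    also have "\<dots> \<le> (\<Sum>n. planar_term (kap e n) C)"
      using sum_le_suminf[of "\<lambda>n. planar_term (kap e n) C" "{0}"] planar_term_series(4)[OF e C] planar_term_signs(1)[OF gt_rmin(1)[OF e C] kp]
      by (auto intro: less_imp_le)
    also have "\<dots> \<le> planar_profile e C" using e by (simp add: planar_profile_def)
    finally show "\<exists>C>rmin e. planar_profile e C > K" using C by blast
  qed
qed

section \<open>Midpoint log-convexity\<close>

lemma sinh_ge_self: assumes "x \<ge> 0" shows "sinh x \<ge> (x :: real)"
proof -
  have "sinh 0 - 0 \<le> sinh x - x"
    by (rule DERIV_nonneg_imp_nondecreasing[OF assms])
       (auto intro!: exI derivative_eq_intros simp: cosh_real_ge_1)
  then show ?thesis by simp
qed

lemma sinh_le_self_cosh: assumes "x \<ge> 0" shows "sinh x \<le> x * cosh (x :: real)"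
proof -
  have "0 * cosh 0 - sinh 0 \<le> x * cosh x - sinh x"
  proof (rule DERIV_nonneg_imp_nondecreasing[OF assms])
    fix z :: real assume "0 \<le> z"
    then show "\<exists>y. ((\<lambda>x. x * cosh x - sinh x) has_real_derivative y) (at z) \<and> 0 \<le> y"
      by (intro exI[of _ "z * sinh z"]) (auto intro!: derivative_eq_intros)
  qed
  then show ?thesis by simp
qed

text \<open>The involution \<open>d \<mapsto> u\<close> with \<open>sinh d * sinh u = 1\<close>.\<close>

definition dual_dist :: "real \<Rightarrow> real" where "dual_dist d = ln (cosh d + 1) - ln (sinh d)"

lemma dual_dist_deriv:
  assumes "d > 0"
  shows "(dual_dist has_real_derivative - 1 / sinh d) (at d)"
proof -
  have s: "sinh d > 0" using assms by simp
  have c: "cosh d + 1 > 0" using cosh_real_ge_1[of d] by simp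
  have "(dual_dist has_real_derivative (sinh d / (cosh d + 1) - cosh d / sinh d)) (at d)"
    unfolding dual_dist_def[abs_def] using s c by (auto intro!: derivative_eq_intros)
  moreover have "sinh d / (cosh d + 1) - cosh d / sinh d = ((sinh d)\<^sup>2 - (cosh d)\<^sup>2 - cosh d) / ((cosh d + 1) * sinh d)"
    using s c by (simp add: diff_frac_eq power2_eq_square algebra_simps)
  moreover have "\<dots> = - (cosh d + 1) / ((cosh d + 1) * sinh d)" by (simp add: cosh_square_eq)
  moreover have "\<dots> = - 1 / sinh d" using c by (metis less_irrefl minus_divide_left nonzero_divide_mult_cancel_left)
  ultimately show ?thesis by simp
qed

lemma exp_dual_dist:
  assumes "d > 0"
  shows "exp (dual_dist d) = (cosh d + 1) / sinh d" "exp (- dual_dist d) = (cosh d - 1) / sinh d"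
proof -
  have s: "sinh d > 0" using assms by simp
  have c: "cosh d + 1 > 0" using cosh_real_ge_1[of d] by simp
  show *: "exp (dual_dist d) = (cosh d + 1) / sinh d"
    using s c by (simp add: dual_dist_def exp_diff)
  have "(cosh d + 1) * (cosh d - 1) = sinh d * sinh d"
    using cosh_square_eq[of d] by (simp add: power2_eq_square algebra_simps)
  then show "exp (- dual_dist d) = (cosh d - 1) / sinh d"
    unfolding exp_minus * using s c by (simp add: divide_simps mult.commute)
qed

lemma sinh_dual_dist: assumes "d > 0" shows "sinh (dual_dist d) = 1 / sinh d" "cosh (dual_dist d) = cosh d / sinh d"
  unfolding sinh_field_def[of "dual_dist d"] cosh_field_def[of "dual_dist d"] exp_dual_dist[OF assms]
  using assms by (simp_all add: diff_divide_distrib[symmetric] add_divide_distrib[symmetric])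

lemma dual_dist_pos: assumes "d > 0" shows "dual_dist d > 0"
  using sinh_dual_dist(1)[OF assms] assms by (metis sinh_real_pos_iff zero_less_divide_1_iff)

text \<open>Write u for the dual distance. The second derivative has the sign of sinh (k u) cosh (k
  u) cosh d - k, and sinh (k u) >= k u while u cosh d = u coth u >= 1.\<close>

lemma convex_ln_sinh_dual_dist:
  assumes k: "k > 0"
  shows "convex_on {0<..} (\<lambda>d. ln (sinh (k * dual_dist d)))"
proof (rule f''_ge0_imp_convex)
  let ?u = dual_dist
  let ?f1 = "\<lambda>d. - k * cosh (k * ?u d) / (sinh (k * ?u d) * sinh d)"
  let ?f2 = "\<lambda>d. k * (sinh (k * ?u d) * cosh (k * ?u d) * cosh d - k) / ((sinh (k * ?u d))\<^sup>2 * (sinh d)\<^sup>2)"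
  fix d :: real assume "d \<in> {0<..}"
  then have d: "d > 0" by simp
  have u: "?u d > 0" by (rule dual_dist_pos[OF d])
  have s: "sinh d > 0" "sinh (k * ?u d) > 0" using d u k by auto
  note du = dual_dist_deriv[OF d]
  show "((\<lambda>d. ln (sinh (k * ?u d))) has_real_derivative ?f1 d) (at d)"
    using s u k by (auto intro!: derivative_eq_intros du simp: field_simps)
  have dn: "((\<lambda>d. - k * cosh (k * ?u d)) has_real_derivative - k * (sinh (k * ?u d) * (k * (- 1 / sinh d)))) (at d)"
    by (auto intro!: derivative_eq_intros du)
  have dd: "((\<lambda>d. sinh (k * ?u d) * sinh d) has_real_derivative
      cosh (k * ?u d) * (k * (- 1 / sinh d)) * sinh d + cosh d * sinh (k * ?u d)) (at d)"
    by (rule DERIV_mult; auto intro!: derivative_eq_intros du)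
  have ne: "sinh (k * ?u d) * sinh d \<noteq> 0" using s by (metis less_irrefl mult_eq_0_iff)
  have eq: "(- k * (sK * (k * (- 1 / sd))) * (sK * sd) - (- k * cK) * (cK * (k * (- 1 / sd)) * sd + cd * sK)) / (sK * sd * (sK * sd))
     = k * (sK * cK * cd - k) / (sK\<^sup>2 * sd\<^sup>2)" if "sK > 0" "sd > 0" "cK\<^sup>2 = sK\<^sup>2 + 1" for sK sd cK cd :: real
  proof -
    have "- k * (sK * (k * (- 1 / sd))) * (sK * sd) = k * k * sK\<^sup>2"
      using that by (simp add: power2_eq_square)
    moreover have "(- k * cK) * (cK * (k * (- 1 / sd)) * sd + cd * sK) = k * k * (sK\<^sup>2 + 1) - k * cK * cd * sK"
      unfolding that(3)[symmetric] using that(2) by (simp add: power2_eq_square algebra_simps)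
    ultimately have "- k * (sK * (k * (- 1 / sd))) * (sK * sd) - (- k * cK) * (cK * (k * (- 1 / sd)) * sd + cd * sK)
       = k * (sK * cK * cd - k)" by (simp add: algebra_simps)
    then show ?thesis by (simp add: power2_eq_square mult_ac)
  qed
  show "(?f1 has_real_derivative ?f2 d) (at d)"
    using DERIV_divide[OF dn dd ne] eq[OF s(2,1) cosh_square_eq, of "cosh d"] by simp
  have "sinh (k * ?u d) \<ge> k * ?u d" using u k by (intro sinh_ge_self) simp
  moreover have "cosh d = cosh (?u d) / sinh (?u d)" using s by (simp add: sinh_dual_dist[OF d])
  moreover have "1 \<le> ?u d * cosh (?u d) / sinh (?u d)"
    using sinh_le_self_cosh[of "?u d"] u by (simp add: pos_le_divide_eq)
  ultimately have "sinh (k * ?u d) \<ge> k * ?u d" "?u d * cosh d \<ge> 1" by simp_all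
  note uk = this
  have "k * 1 \<le> k * (?u d * cosh d)" by (rule mult_left_mono) (use uk(2) k in auto)
  also have "\<dots> = (k * ?u d) * cosh d" by simp
  also have "\<dots> \<le> sinh (k * ?u d) * cosh d" by (rule mult_right_mono) (use uk(1) in auto)
  also have "\<dots> \<le> sinh (k * ?u d) * cosh d * cosh (k * ?u d)"
    using mult_left_mono[OF cosh_real_ge_1[of "k * ?u d"], of "sinh (k * ?u d) * cosh d"]
      mult_nonneg_nonneg[OF less_imp_le[OF s(2)], of "cosh d"] by simp
  finally have "sinh (k * ?u d) * cosh (k * ?u d) * cosh d - k \<ge> 0" by (simp add: mult_ac)
  then show "?f2 d \<ge> 0" using k by simp
qed auto

lemma mid_sinh_dual_dist:
  assumes "k > 0" "d1 > 0" "d2 > 0"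
  shows "(sinh (k * dual_dist ((d1 + d2) / 2)))\<^sup>2 \<le> sinh (k * dual_dist d1) * sinh (k * dual_dist d2)"
proof -
  let ?f = "\<lambda>d. sinh (k * dual_dist d)"
  have p: "?f d > 0" if "d > 0" for d using dual_dist_pos[OF that] assms by simp
  have "ln (?f ((1 - 1/2) *\<^sub>R d1 + (1/2) *\<^sub>R d2)) \<le> (1 - 1/2) * ln (?f d1) + (1/2) * ln (?f d2)"
    by (rule convex_onD[OF convex_ln_sinh_dual_dist[OF assms(1)]]) (use assms in auto)
  then have *: "2 * ln (?f ((d1 + d2) / 2)) \<le> ln (?f d1) + ln (?f d2)" by (simp add: add_divide_distrib)
  then have "ln ((?f ((d1 + d2) / 2))\<^sup>2) \<le> ln (?f d1 * ?f d2)"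
  proof -
    have "?f ((d1 + d2) / 2) > 0" "?f d1 > 0" "?f d2 > 0" by (intro p; use assms in simp)+
    then have "ln ((?f ((d1 + d2) / 2))\<^sup>2) = 2 * ln (?f ((d1 + d2) / 2))" "ln (?f d1 * ?f d2) = ln (?f d1) + ln (?f d2)"
      by (simp_all only: ln_realpow ln_mult_pos of_nat_numeral)
    with * show ?thesis by simp
  qed
  moreover have "?f ((d1 + d2) / 2) > 0" "?f d1 > 0" "?f d2 > 0" by (intro p; use assms in simp)+
  ultimately show ?thesis by (subst (asm) ln_le_cancel_iff) (simp_all only: zero_less_power mult_pos_pos)
qed

text \<open>The case k = 1 of the previous bound, as sinh of the dual distance is 1 / sinh
  d.\<close>

lemma mid_sinh:
  assumes "d1 > 0" "d2 > 0"
  shows "(1 / sinh ((d1 + d2) / 2))\<^sup>2 \<le> (1 / sinh d1) * (1 / sinh (d2 :: real))"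
  using mid_sinh_dual_dist[of 1 d1 d2] assms by (simp add: sinh_dual_dist)

text \<open>Midpoint log-convexity x^2 <= a b implies linear inequalities, one for each t > 0, and
  linear inequalities can be summed over a series; the choice of t is made only after
  summation.\<close>

lemma weighted_am_gm:
  fixes a b x t :: real
  assumes "x\<^sup>2 \<le> a * b" "a \<ge> 0" "b \<ge> 0" "t > 0"
  shows "2 * x \<le> t * a + b / t"
proof -
  have "\<bar>x\<bar> \<le> sqrt (a * b)" using assms(1) by (metis real_sqrt_abs real_sqrt_le_mono)
  moreover have "sqrt (a * b) = sqrt (t * a) * sqrt (b / t)"
    using assms(4) by (simp add: real_sqrt_mult[symmetric])
  moreover have "2 * (sqrt (t * a) * sqrt (b / t)) \<le> (sqrt (t * a))\<^sup>2 + (sqrt (b / t))\<^sup>2"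
    using sum_squares_bound[of "sqrt (t * a)" "sqrt (b / t)"] by simp
  ultimately show ?thesis using assms by simp
qed

section \<open>The radial profile in higher dimensions\<close>

text \<open>The coefficients of (1 - z)^(-m), that is, (m + i - 1) choose i when m >= 1; their sign
  is what matters.\<close>

definition neg_binom :: "nat \<Rightarrow> nat \<Rightarrow> real" where "neg_binom m i = (- 1) ^ i * ((- real m) gchoose i)"

lemma neg_binom_nonneg: assumes "m \<ge> 1" shows "neg_binom m i \<ge> 0"
proof -
  have "neg_binom m i = ((- 1) ^ i * (- 1) ^ i) * ((real m + real i - 1) gchoose i)"
    unfolding neg_binom_def gbinomial_minus by simp
  also have "(- 1) ^ i * (- 1 :: real) ^ i = 1" by (simp add: power_mult_distrib[symmetric])
  also have "real m + real i - 1 = real (m + i - 1)" using assms by (simp add: of_nat_diff)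
  finally show ?thesis by (simp add: binomial_gbinomial[symmetric])
qed

text \<open>(1/y - y)^(-m) = y^m (1 - y^2)^(-m), expanded in powers of y^2.\<close>

lemma neg_binom_sums:
  assumes "0 < y" "y < 1"
  shows "(\<lambda>i. neg_binom m i * y ^ (m + 2 * i)) sums (1 / (1 / y - y) ^ m)"
proof -
  have y2: "y\<^sup>2 < 1" using mult_strict_mono'[of y 1 y 1] assms by (simp add: power2_eq_square)
  have "(\<lambda>i. ((- real m) gchoose i) * (- (y\<^sup>2)) ^ i) sums (1 + (- (y\<^sup>2))) powr (- real m)"
    by (rule gen_binomial_real) (use y2 in simp)
  then have "(\<lambda>i. y ^ m * (((- real m) gchoose i) * (- (y\<^sup>2)) ^ i)) sums (y ^ m * (1 + (- (y\<^sup>2))) powr (- real m))"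
    by (rule sums_mult)
  moreover have "y ^ m * (((- real m) gchoose i) * (- (y\<^sup>2)) ^ i) = neg_binom m i * y ^ (m + 2 * i)" for i
  proof -
    have "(- (y\<^sup>2)) ^ i = (- 1) ^ i * y ^ (2 * i)" by (metis mult_minus1 power_mult power_mult_distrib)
    then show ?thesis by (simp add: neg_binom_def power_add)
  qed
  moreover have "y ^ m * (1 + (- (y\<^sup>2))) powr (- real m) = 1 / (1 / y - y) ^ m"
  proof -
    have "1 / y - y = (1 - y\<^sup>2) / y" using assms by (simp add: field_simps power2_eq_square)
    then show ?thesis using y2 assms by (simp add: powr_minus powr_realpow power_divide divide_simps)
  qed
  ultimately show ?thesis by simp
qed

text \<open>One group of images on the diagonal at power p = N - 2, after splitting off the power of
  \<open>al\<close> and the weight sinh^(-p): the odd images give the first two summands, and the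
  even ones coincide in the third.\<close>

definition higher_term :: "real \<Rightarrow> real \<Rightarrow> real \<Rightarrow> real" where
  "higher_term p q C = (C - sqrt (1 + q)) powr (- p) + (C + sqrt (1 + q)) powr (- p) - 2 * (C\<^sup>2 - 1) powr (- p / 2)"
definition higher_term1 :: "real \<Rightarrow> real \<Rightarrow> real \<Rightarrow> real" where
  "higher_term1 p q C = - p * ((C - sqrt (1 + q)) powr (- p - 1) + (C + sqrt (1 + q)) powr (- p - 1)
     - 2 * C * (C\<^sup>2 - 1) powr (- p / 2 - 1))"
definition higher_term2 :: "real \<Rightarrow> real \<Rightarrow> real \<Rightarrow> real" where
  "higher_term2 p q C = - p * ((- p - 1) * (C - sqrt (1 + q)) powr (- p - 2) + (- p - 1) * (C + sqrt (1 + q)) powr (- p - 2)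
     - 2 * (C\<^sup>2 - 1) powr (- p / 2 - 1) - 2 * C * ((- p / 2 - 1) * (C\<^sup>2 - 1) powr (- p / 2 - 2) * (2 * C)))"

lemma higher_term_derivs:
  assumes "C - sqrt (1 + q) > 0" "C\<^sup>2 - 1 > 0" "q > 0"
  shows "(higher_term p q has_real_derivative higher_term1 p q C) (at C)" "(higher_term1 p q has_real_derivative higher_term2 p q C) (at C)"
proof -
  have k: "sqrt (1 + q) > 0" using assms by simp
  then have C: "C + sqrt (1 + q) > 0" using assms(1) by linarith
  have pw: "((\<lambda>C. (f C) powr s) has_real_derivative s * (f C) powr (s - 1) * f') (at C)"
    if "(f has_real_derivative f') (at C)" "f C > 0" for f f' and s :: real
    by (rule DERIV_cong[OF DERIV_fun_powr[OF that]]) simp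
  have d: "((\<lambda>C. C - sqrt (1 + q)) has_real_derivative 1) (at C)" "((\<lambda>C. C + sqrt (1 + q)) has_real_derivative 1) (at C)"
    "((\<lambda>C. C\<^sup>2 - 1) has_real_derivative 2 * C) (at C)"
    by (auto intro!: derivative_eq_intros)
  note pw3 = pw[OF d(1) assms(1)] pw[OF d(2) C] pw[OF d(3) assms(2)]
  show "(higher_term p q has_real_derivative higher_term1 p q C) (at C)"
    unfolding higher_term_def[abs_def] higher_term1_def
    by (rule derivative_eq_intros pw3 refl)+ (simp add: algebra_simps)
  show "(higher_term1 p q has_real_derivative higher_term2 p q C) (at C)"
    unfolding higher_term1_def[abs_def] higher_term2_def
    by (rule derivative_eq_intros pw3 refl)+ (simp add: algebra_simps)
qed

text \<open>With x and y = C -+ coth the product x y = C^2 - 1 - q lies below C^2 - 1, so the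
  arithmetic-geometric mean inequality beats the negative summand.\<close>

lemma higher_term_signs:
  assumes "C - sqrt (1 + q) > 0" "q > 0" "p > 0"
  shows "higher_term p q C \<ge> 0" "higher_term1 p q C < 0"
proof -
  define k where "k = sqrt (1 + q)"
  define x where "x = C - k" 
  define y where "y = C + k"
  have k: "k\<^sup>2 = 1 + q" "k > 0" using assms by (auto simp: k_def)
  have x: "x > 0" using assms by (simp add: x_def k_def)
  have y: "y > x" "y > 0" using k x by (simp_all add: x_def y_def)
  have xy: "x * y = C\<^sup>2 - 1 - q" using k by (simp add: x_def y_def power2_eq_square algebra_simps)
  have xy0: "x * y > 0" using x y by simp
  have lt: "x * y < C\<^sup>2 - 1" using xy assms by simp
  have am: "x powr (- p) + y powr (- p) \<ge> 2 * (x * y) powr (- p / 2)"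
  proof -
    have "2 * (x powr (- p / 2) * y powr (- p / 2)) \<le> (x powr (- p / 2))\<^sup>2 + (y powr (- p / 2))\<^sup>2"
      using sum_squares_bound[of "x powr (- p / 2)" "y powr (- p / 2)"] by simp
    moreover have "(z powr (- p / 2))\<^sup>2 = z powr (- p)" for z :: real
      by (simp add: power2_eq_square powr_add[symmetric])
    ultimately show ?thesis using x y by (simp add: powr_mult)
  qed
  have "(C\<^sup>2 - 1) powr (- p / 2) \<le> (x * y) powr (- p / 2)"
    using lt xy0 assms(3) by (intro powr_mono2') auto
  then show "higher_term p q C \<ge> 0" using am unfolding higher_term_def k_def[symmetric] x_def[symmetric] y_def[symmetric] by linarith
  \<comment> \<open>Chebyshev's sum inequality: x^(-p) and 1/x are ordered alike, so the sum of
    their products is at least half the product of the sums.\<close>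
  have ch: "(x powr (- p) - y powr (- p)) * (1 / x - 1 / y) \<ge> 0"
  proof (rule mult_nonneg_nonneg)
    show "x powr (- p) - y powr (- p) \<ge> 0" using powr_mono2'[of "- p" x y] x y assms(3) by simp
    show "1 / x - 1 / y \<ge> 0" using x y by (simp add: frac_le)
  qed
  have sub: "z powr (- p - 1) = z powr (- p) * (1 / z)" if "z > 0" for z
    using that powr_diff[of z "- p" 1] by simp
  have "2 * (x powr (- p - 1) + y powr (- p - 1)) \<ge> (x powr (- p) + y powr (- p)) * (1 / x + 1 / y)"
    unfolding sub[OF x] sub[OF y(2)] using ch by (simp add: algebra_simps)
  moreover have "1 / x + 1 / y = 2 * C / (x * y)" using x y by (simp add: field_simps) (simp add: x_def y_def)
  moreover have C: "C > 0" using x k by (simp add: x_def)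
  then have "(x powr (- p) + y powr (- p)) * (2 * C / (x * y)) \<ge> 2 * (x * y) powr (- p / 2) * (2 * C / (x * y))"
    using am xy0 by (intro mult_right_mono) auto
  moreover have "2 * (x * y) powr (- p / 2) * (2 * C / (x * y)) = 4 * C * (x * y) powr (- p / 2 - 1)"
  proof -
    have *: "(x * y) powr (- p / 2) * (1 / (x * y)) = (x * y) powr (- p / 2 - 1)"
      using xy0 powr_diff[of "x * y" "- p / 2" 1] by simp
    show ?thesis unfolding *[symmetric] by simp
  qed
  moreover have "(C\<^sup>2 - 1) powr (- p / 2 - 1) < (x * y) powr (- p / 2 - 1)"
    using lt xy0 assms(3) by (intro powr_less_mono2_neg) auto
  then have "4 * C * (C\<^sup>2 - 1) powr (- p / 2 - 1) < 4 * C * (x * y) powr (- p / 2 - 1)" using C by simp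
  ultimately have "x powr (- p - 1) + y powr (- p - 1) - 2 * C * (C\<^sup>2 - 1) powr (- p / 2 - 1) > 0" by simp
  then show "higher_term1 p q C < 0"
    unfolding higher_term1_def k_def[symmetric] x_def[symmetric] y_def[symmetric] using assms(3) by (simp add: mult_pos_pos)
qed

lemma lip_at0_powr:
  assumes "lip_at0 q1 K F" "\<eta> > 0" "\<And>q y. 0 \<le> q \<Longrightarrow> q \<le> q1 \<Longrightarrow> y \<in> K \<Longrightarrow> F q y \<ge> (\<eta> :: real)"
  shows "lip_at0 q1 K (\<lambda>q y. F q y powr s)"
  by (rule lip_at0_compose[OF assms, where g' = "\<lambda>z. s * z powr (s - 1)"])
     (auto intro!: has_real_derivative_powr continuous_intros)

lemma lip_at0_sqrt_1: "lip_at0 q1 K (\<lambda>q y. sqrt (1 + q))"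
  by (rule lip_at0_compose[OF lip_at0_add[OF lip_at0_const lip_at0_q], where \<eta> = 1 and g' = "\<lambda>z. inverse (sqrt z) / 2"])
     (auto intro!: DERIV_real_sqrt continuous_intros)

text \<open>Unlike in the plane only the uniform bound is exploited; convergence comes from
  \<open>term_weight\<close>.\<close>

lemma higher_term_lip_at0:
  assumes e: "e > 1" and c: "rmin e < c1"
  shows "lip_at0 (kap e 0) {c1..c2} (higher_term p)" "lip_at0 (kap e 0) {c1..c2} (higher_term1 p)" "lip_at0 (kap e 0) {c1..c2} (higher_term2 p)"
proof -
  define \<eta> where "\<eta> = min (c1 - rmin e) (c1\<^sup>2 - 1)"
  have \<eta>: "\<eta> > 0" using gt_rmin(2)[OF e c] c by (simp add: \<eta>_def)
  have low: "y - sqrt (1 + q) \<ge> \<eta>" "y + sqrt (1 + q) \<ge> \<eta>" "y\<^sup>2 - 1 \<ge> \<eta>" if "0 \<le> q" "q \<le> kap e 0" "y \<in> {c1..c2}" for q y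
  proof -
    have "c1\<^sup>2 \<le> y\<^sup>2" using that gt_rmin(1)[OF e c] by (intro power_mono) auto
    then show "y\<^sup>2 - 1 \<ge> \<eta>" using that by (auto simp: \<eta>_def)
    have "sqrt (1 + q) \<le> rmin e" using that by (simp add: rmin_def)
    then show "y - sqrt (1 + q) \<ge> \<eta>" using that by (auto simp: \<eta>_def)
    moreover have "sqrt (1 + q) \<ge> 0" using that by simp
    ultimately show "y + sqrt (1 + q) \<ge> \<eta>" by linarith
  qed
  note L = lip_at0_diff lip_at0_add lip_at0_power2 lip_at0_mult lip_at0_const lip_at0_q lip_at0_id_Icc lip_at0_sqrt_1
    lip_at0_powr[OF _ \<eta>] low
  show "lip_at0 (kap e 0) {c1..c2} (higher_term p)" "lip_at0 (kap e 0) {c1..c2} (higher_term1 p)" "lip_at0 (kap e 0) {c1..c2} (higher_term2 p)"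
    unfolding higher_term_def[abs_def] higher_term1_def[abs_def] higher_term2_def[abs_def] by (intro L; assumption)+
qed

definition term_weight :: "real \<Rightarrow> real \<Rightarrow> nat \<Rightarrow> real" where "term_weight e p n = sh e n powr (- p)"

lemma term_weight_pos: "e > 1 \<Longrightarrow> term_weight e p n > 0"
  using sh_ge_0(2)[of e n] by (simp add: term_weight_def)

lemma summable_term_weight: assumes e: "e > 1" and p: "p \<ge> 1" shows "summable (term_weight e p)"
proof (rule summable_comparison_test')
  let ?k = "sh e 0 powr (- p) * sh e 0"
  show "summable (\<lambda>n. ?k * (1 / sh e n))" by (intro summable_mult summable_inverse_sh e)
  show "norm (term_weight e p n) \<le> ?k * (1 / sh e n)" for n
  proof -
    note s = sh_ge_0[OF e, of n] sh_0_pos[OF e]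
    have "term_weight e p n = sh e 0 powr (- p) * (sh e n / sh e 0) powr (- p)"
      using s by (simp add: term_weight_def powr_divide)
    also have "\<dots> \<le> sh e 0 powr (- p) * (sh e n / sh e 0) powr (- 1)"
      using s p by (intro mult_left_mono powr_mono) auto
    also have "\<dots> = ?k * (1 / sh e n)" using s by (simp add: powr_minus divide_simps)
    finally show ?thesis using term_weight_pos[OF e, of p n] by simp
  qed
qed

lemma higher_term_series:
  assumes e: "e > 1" and p: "p \<ge> 1"
  shows "\<And>C. C > rmin e \<Longrightarrow> ((\<lambda>C. \<Sum>n. term_weight e p n * higher_term p (kap e n) C) has_real_derivative (\<Sum>n. term_weight e p n * higher_term1 p (kap e n) C)) (at C)"
    "\<And>C. C > rmin e \<Longrightarrow> ((\<lambda>C. \<Sum>n. term_weight e p n * higher_term1 p (kap e n) C) has_real_derivative (\<Sum>n. term_weight e p n * higher_term2 p (kap e n) C)) (at C)"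
    "continuous_on {rmin e<..} (\<lambda>C. \<Sum>n. term_weight e p n * higher_term2 p (kap e n) C)"
    "\<And>C. C > rmin e \<Longrightarrow> summable (\<lambda>n. term_weight e p n * higher_term p (kap e n) C) \<and> summable (\<lambda>n. term_weight e p n * higher_term1 p (kap e n) C)
       \<and> summable (\<lambda>n. term_weight e p n * higher_term2 p (kap e n) C)"
proof -
  have dom: "\<exists>V M. open V \<and> C \<in> V \<and> V \<subseteq> {rmin e<..} \<and> summable M \<and>
      (\<forall>n. \<forall>y\<in>V. \<bar>term_weight e p n * higher_term p (kap e n) y\<bar> \<le> M n \<and> \<bar>term_weight e p n * higher_term1 p (kap e n) y\<bar> \<le> M n \<and> \<bar>term_weight e p n * higher_term2 p (kap e n) y\<bar> \<le> M n)"
    if C: "C \<in> {rmin e<..}" for C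
  proof -
    obtain c1 c2 where c: "rmin e < c1" "C \<in> {c1<..<c2}" "{c1<..<c2} \<subseteq> {rmin e<..}"
      by (rule Icc_nhd[OF C[unfolded greaterThan_iff]]) (rule that, assumption+)
    obtain Ma where Ma: "\<And>q y. 0 \<le> q \<Longrightarrow> q \<le> kap e 0 \<Longrightarrow> y \<in> {c1..c2} \<Longrightarrow> norm (higher_term p q y) \<le> Ma"
      by (rule lip_at0E[OF higher_term_lip_at0(1)[OF e c(1)]]) (rule that, assumption+)
    obtain Mb where Mb: "\<And>q y. 0 \<le> q \<Longrightarrow> q \<le> kap e 0 \<Longrightarrow> y \<in> {c1..c2} \<Longrightarrow> norm (higher_term1 p q y) \<le> Mb"
      by (rule lip_at0E[OF higher_term_lip_at0(2)[OF e c(1)]]) (rule that, assumption+)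
    obtain Mc where Mc: "\<And>q y. 0 \<le> q \<Longrightarrow> q \<le> kap e 0 \<Longrightarrow> y \<in> {c1..c2} \<Longrightarrow> norm (higher_term2 p q y) \<le> Mc"
      by (rule lip_at0E[OF higher_term_lip_at0(3)[OF e c(1)]]) (rule that, assumption+)
    define M where "M = max Ma (max Mb Mc)"
    have M: "norm (higher_term p q y) \<le> M" "norm (higher_term1 p q y) \<le> M" "norm (higher_term2 p q y) \<le> M"
      if "0 \<le> q" "q \<le> kap e 0" "y \<in> {c1..c2}" for q y
      using Ma[OF that] Mb[OF that] Mc[OF that] by (auto simp: M_def)
    have "\<bar>term_weight e p n * higher_term p (kap e n) y\<bar> \<le> term_weight e p n * M \<and> \<bar>term_weight e p n * higher_term1 p (kap e n) y\<bar> \<le> term_weight e p n * M \<and> \<bar>term_weight e p n * higher_term2 p (kap e n) y\<bar> \<le> term_weight e p n * M"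
      if "y \<in> {c1<..<c2}" for n y
      using M[of "kap e n" y] kap_bounds[OF e, of n] term_weight_pos[OF e, of p n] that
      by (auto simp: abs_mult intro!: mult_left_mono)
    moreover have "summable (\<lambda>n. term_weight e p n * M)" by (intro summable_mult2 summable_term_weight e p)
    ultimately show ?thesis using c by (intro exI[of _ "{c1<..<c2}"] exI[of _ "\<lambda>n. term_weight e p n * M"]) auto
  qed
  have pos: "C - sqrt (1 + kap e n) > 0" "C\<^sup>2 - 1 > 0" "kap e n > 0" "C + sqrt (1 + kap e n) > 0" if "C \<in> {rmin e<..}" for n C
  proof -
    have "sqrt (1 + kap e n) \<le> rmin e" using kap_bounds[OF e, of n] by (simp add: rmin_def)
    then show "C - sqrt (1 + kap e n) > 0" using that by simp
    show k: "kap e n > 0" using kap_bounds[OF e] by simp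
    show "C\<^sup>2 - 1 > 0" using gt_rmin[OF e] that by simp
    show "C + sqrt (1 + kap e n) > 0" using gt_rmin(1)[OF e, of C] that real_sqrt_ge_zero[of "1 + kap e n"] k
      unfolding greaterThan_iff by linarith
  qed
  have d: "((\<lambda>C. term_weight e p n * higher_term p (kap e n) C) has_real_derivative term_weight e p n * higher_term1 p (kap e n) C) (at C)"
    "((\<lambda>C. term_weight e p n * higher_term1 p (kap e n) C) has_real_derivative term_weight e p n * higher_term2 p (kap e n) C) (at C)"
    if "C \<in> {rmin e<..}" for n C
    by (intro DERIV_cmult higher_term_derivs pos[OF that])+
  have c: "continuous_on {rmin e<..} (\<lambda>C. term_weight e p n * higher_term2 p (kap e n) C)" for n
  proof -
    have ne: "\<forall>C\<in>{rmin e<..}. C - sqrt (1 + kap e n) \<noteq> 0" "\<forall>C\<in>{rmin e<..}. C + sqrt (1 + kap e n) \<noteq> 0"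
      "\<forall>C\<in>{rmin e<..}. C\<^sup>2 - 1 \<noteq> 0"
      using pos less_irrefl by metis+
    show ?thesis unfolding higher_term2_def by (intro continuous_intros ne)
  qed
  note S = series_twice_differentiable[of "{rmin e<..}" "\<lambda>n C. term_weight e p n * higher_term p (kap e n) C" "\<lambda>n C. term_weight e p n * higher_term1 p (kap e n) C" "\<lambda>n C. term_weight e p n * higher_term2 p (kap e n) C", OF d c dom]
  show "\<And>C. C > rmin e \<Longrightarrow> ((\<lambda>C. \<Sum>n. term_weight e p n * higher_term p (kap e n) C) has_real_derivative (\<Sum>n. term_weight e p n * higher_term1 p (kap e n) C)) (at C)"
    "\<And>C. C > rmin e \<Longrightarrow> ((\<lambda>C. \<Sum>n. term_weight e p n * higher_term1 p (kap e n) C) has_real_derivative (\<Sum>n. term_weight e p n * higher_term2 p (kap e n) C)) (at C)"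
    "continuous_on {rmin e<..} (\<lambda>C. \<Sum>n. term_weight e p n * higher_term2 p (kap e n) C)"
    "\<And>C. C > rmin e \<Longrightarrow> summable (\<lambda>n. term_weight e p n * higher_term p (kap e n) C) \<and> summable (\<lambda>n. term_weight e p n * higher_term1 p (kap e n) C)
       \<and> summable (\<lambda>n. term_weight e p n * higher_term2 p (kap e n) C)"
    using S by auto
qed

text \<open>Expanding both images in negative binomial series exhibits each term as a positive combination of the
  log-convex functions \<open>(1 / sinh d)\<^sup>m (sinh (\<kappa> u))\<^sup>2\<close>.\<close>

lemma term_weight_higher_term_sums:
  assumes e: "e > 1" and d: "d > 0" "cosh d > rmin e" and m: "m \<ge> 1"
  shows "(\<lambda>i. (2 / sinh d) ^ m * (neg_binom m i * (1 / e ^ Suc n) ^ (m + 2 * i)) * (2 * sinh (real (m + 2 * i) / 2 * dual_dist d))\<^sup>2)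
    sums (term_weight e (real m) n * higher_term (real m) (kap e n) (cosh d))"
proof -
  define E where "E = e ^ Suc n"
  \<comment> \<open>Duality gives x + 1/x = 2 coth d and x - 1/x = 2 / sinh d. So cosh d and 1 are
    both sinh d times an expression in x, and \<open>a * C - b\<close>, \<open>a * C + b\<close>
    factor by the addition formulas.\<close>
  define x where "x = exp (dual_dist d)"
  define a where "a = sh e n"
  define b where "b = ch e n"
  define C where "C = cosh d"
  define p where "p = real m"
  define f where "f = sinh d"
  have E: "E > 0" "E > 1" using e by (auto simp: E_def one_less_power simp del: power_Suc)
  have a: "a > 0" unfolding a_def by (rule sh_ge_0(2)[OF e])
  have ab: "a = (E - 1 / E) / 2" "b = (E + 1 / E) / 2"
    by (simp_all add: a_def b_def sh_def ch_def E_def power_one_over del: power_Suc)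
  have f: "f > 0" using d by (simp add: f_def)
  have "x > 0" by (simp add: x_def)
  moreover have "x = (C + 1) / f" "1 / x = (C - 1) / f"
    using exp_dual_dist[OF d(1)] by (simp_all add: x_def C_def f_def exp_minus inverse_eq_divide)
  ultimately have x: "x = (C + 1) / f" "1 / x = (C - 1) / f" "x > 0" by blast+
  have k: "sqrt (1 + kap e n) = b / a" unfolding a_def b_def by (rule sqrt_kap[OF e])
  have Cb: "C > b / a"
    using d(2) kap_bounds[OF e, of n] unfolding k[symmetric] C_def rmin_def
    by (smt (verit) real_sqrt_le_iff)
  have Cf: "C = f * (x + 1 / x) / 2" "1 = f * (x - 1 / x) / 2" proof -
    have "x + 1 / x = (C + 1) / f + (C - 1) / f" "x - 1 / x = (C + 1) / f - (C - 1) / f"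
      using x(1,2) by linarith+
    then show "C = f * (x + 1 / x) / 2" "1 = f * (x - 1 / x) / 2" 
      using f by (simp_all add: add_divide_distrib[symmetric] diff_divide_distrib[symmetric])
  qed
  have id1: "(y - y') / 2 * (f * (x + x') / 2) - (y + y') / 2 * (f * (x - x') / 2) = f / 2 * (y * x' - x * y')"
    and id2: "(y - y') / 2 * (f * (x + x') / 2) + (y + y') / 2 * (f * (x - x') / 2) = f / 2 * (y * x - x' * y')" for y y' x'
    by (simp_all add: field_simps)
  have m1: "a * C - b = (f / 2) * (E / x - x / E)"
  proof -
    have "a * C - b * 1 = (E - 1 / E) / 2 * (f * (x + 1 / x) / 2) - (E + 1 / E) / 2 * (f * (x - 1 / x) / 2)"
      unfolding ab Cf(1)[symmetric] Cf(2)[symmetric] ..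
    also have "\<dots> = (f / 2) * (E * (1 / x) - x * (1 / E))" by (rule id1)
    finally show ?thesis by simp
  qed
  have m2: "a * C + b = (f / 2) * (E * x - 1 / (E * x))"
  proof -
    have "a * C + b * 1 = (E - 1 / E) / 2 * (f * (x + 1 / x) / 2) + (E + 1 / E) / 2 * (f * (x - 1 / x) / 2)"
      unfolding ab Cf(1)[symmetric] Cf(2)[symmetric] ..
    also have "\<dots> = (f / 2) * (E * x - (1 / x) * (1 / E))" by (rule id2)
    finally show ?thesis by (simp add: mult.commute)
  qed
  have acb: "a * C - b > 0" using Cb a by (simp add: field_simps)
  then have "E / x - x / E > 0" unfolding m1 using f by (simp add: zero_less_mult_iff)
  \<comment> \<open>The convergence condition for the first series; it restates C > coth ((n+1)
    L).\<close>
  then have xE: "x < E" using x(3) E by (simp add: field_simps power2_eq_square[symmetric]) (metis order_less_imp_le order_less_trans power2_less_imp_less zero_less_one)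
  have x1: "x > 1" using dual_dist_pos[OF d(1)] by (simp add: x_def)
  have p1: "(C - b / a) = (a * C - b) / a" "(C + b / a) = (a * C + b) / a" using a by (auto simp: field_simps)
  have acb2: "a * C + b > 0" using acb E by (simp add: ab)  (smt (verit) divide_pos_pos)
  have gen: "1 / ((f / 2) * z) ^ m = (2 / f) ^ m * (1 / z ^ m)" for z
    by (simp add: power_mult_distrib power_divide)
  have t1: "term_weight e p n * (C - b / a) powr (- p) = (2 / f) ^ m * (1 / (1 / (x / E) - x / E) ^ m)"
  proof -
    have "term_weight e p n * (C - b / a) powr (- p) = (a * C - b) powr (- p)"
      unfolding p1 term_weight_def a_def[symmetric] using a acb by (simp add: powr_divide powr_minus divide_simps)
    also have "\<dots> = 1 / (a * C - b) ^ m" using acb by (simp add: p_def powr_minus powr_realpow divide_inverse)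
    finally show ?thesis unfolding m1 gen by simp
  qed
  have t2: "term_weight e p n * (C + b / a) powr (- p) = (2 / f) ^ m * (1 / (1 / (1 / (E * x)) - 1 / (E * x)) ^ m)"
  proof -
    have "term_weight e p n * (C + b / a) powr (- p) = (a * C + b) powr (- p)"
      unfolding p1 term_weight_def a_def[symmetric] using a acb2 by (simp add: powr_divide powr_minus divide_simps)
    also have "\<dots> = 1 / (a * C + b) ^ m" using acb2 by (simp add: p_def powr_minus powr_realpow divide_inverse)
    finally show ?thesis unfolding m2 gen by simp
  qed
  have t3: "term_weight e p n * (C\<^sup>2 - 1) powr (- p / 2) = (2 / f) ^ m * (1 / (1 / (1 / E) - 1 / E) ^ m)"
  proof -
    have "C\<^sup>2 - 1 = f\<^sup>2" by (simp add: C_def f_def cosh_square_eq)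
    then have "(C\<^sup>2 - 1) powr (- p / 2) = f powr (- p)"
      using f powr_powr[of f 2 "- p / 2"] by (simp add: powr_numeral)
    then have "term_weight e p n * (C\<^sup>2 - 1) powr (- p / 2) = (a * f) powr (- p)"
      using f a by (simp add: term_weight_def a_def[symmetric] powr_mult)
    also have "\<dots> = 1 / (a * f) ^ m" using f a by (simp add: p_def powr_minus powr_realpow divide_inverse)
    finally have "term_weight e p n * (C\<^sup>2 - 1) powr (- p / 2) = 1 / (a * f) ^ m" .
    moreover have "a * f = (f / 2) * (1 / (1 / E) - 1 / E)" by (simp add: ab)
    ultimately show ?thesis unfolding gen[symmetric] by simp
  qed
  have s1: "(\<lambda>i. neg_binom m i * (x / E) ^ (m + 2 * i)) sums (1 / (1 / (x / E) - x / E) ^ m)"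
    by (rule neg_binom_sums) (use x(3) xE E in auto)
  have s2: "(\<lambda>i. neg_binom m i * (1 / (E * x)) ^ (m + 2 * i)) sums (1 / (1 / (1 / (E * x)) - 1 / (E * x)) ^ m)"
    by (rule neg_binom_sums) (use x(3) x1 E in \<open>auto simp: less_1_mult\<close>)
  have s3: "(\<lambda>i. neg_binom m i * (1 / E) ^ (m + 2 * i)) sums (1 / (1 / (1 / E) - 1 / E) ^ m)"
    by (rule neg_binom_sums) (use E in auto)
  have "(\<lambda>i. (2 / f) ^ m * (neg_binom m i * (x / E) ^ (m + 2 * i) + neg_binom m i * (1 / (E * x)) ^ (m + 2 * i) - 2 * (neg_binom m i * (1 / E) ^ (m + 2 * i))))
    sums ((2 / f) ^ m * ((1 / (1 / (x / E) - x / E) ^ m) + (1 / (1 / (1 / (E * x)) - 1 / (E * x)) ^ m) - 2 * (1 / (1 / (1 / E) - 1 / E) ^ m)))"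
    by (intro sums_mult sums_diff sums_add s1 s2 s3)
  moreover have "(2 / f) ^ m * ((1 / (1 / (x / E) - x / E) ^ m) + (1 / (1 / (1 / (E * x)) - 1 / (E * x)) ^ m) - 2 * (1 / (1 / (1 / E) - 1 / E) ^ m))
     = term_weight e p n * higher_term p (kap e n) C"
    unfolding higher_term_def k using t1 t2 t3 by (simp add: algebra_simps)
  \<comment> \<open>The three series combine to x^l + x^(-l) - 2 with l = m + 2 i, the square of 2
    sinh (l u / 2) for the dual distance u; the negative third series has disappeared into a
    square.\<close>
  moreover have "(2 / f) ^ m * (neg_binom m i * (x / E) ^ (m + 2 * i) + neg_binom m i * (1 / (E * x)) ^ (m + 2 * i) - 2 * (neg_binom m i * (1 / E) ^ (m + 2 * i)))
    = (2 / f) ^ m * (neg_binom m i * (1 / E) ^ (m + 2 * i)) * (2 * sinh (real (m + 2 * i) / 2 * dual_dist d))\<^sup>2" for i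
  proof -
    define l where "l = m + 2 * i"
    have "(2 * sinh (real l / 2 * dual_dist d))\<^sup>2 = exp (real l * dual_dist d) + exp (- (real l * dual_dist d)) - 2"
    proof -
      define z where "z = real l / 2 * dual_dist d"
      have h: "2 * sinh z = exp z - exp (- z)" by (simp add: sinh_def)
      have "(2 * sinh z)\<^sup>2 = exp z * exp z + exp (- z) * exp (- z) - 2 * (exp z * exp (- z))"
        unfolding h by (simp add: power2_eq_square algebra_simps)
      also have "\<dots> = exp (2 * z) + exp (- (2 * z)) - 2" by (simp add: mult_exp_exp)
      finally show ?thesis by (simp add: z_def)
    qed
    also have "exp (real l * dual_dist d) = x ^ l" by (simp add: x_def exp_of_nat_mult)
    also have "exp (- (real l * dual_dist d)) = (1 / x) ^ l" by (simp add: x_def exp_minus exp_of_nat_mult power_one_over inverse_eq_divide)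
    finally have "(2 * sinh (real l / 2 * dual_dist d))\<^sup>2 = x ^ l + (1 / x) ^ l - 2" .
    note h2 = this
    have h3: "(x / E) ^ l = x ^ l * (1 / E) ^ l" "(1 / (E * x)) ^ l = (1 / x) ^ l * (1 / E) ^ l"
      by (simp_all add: power_mult_distrib[symmetric] mult.commute)
    show ?thesis unfolding l_def[symmetric] h2 h3 by (simp only: algebra_simps)
  qed
  ultimately show ?thesis by (simp only: E_def C_def p_def f_def)
qed

text \<open>The leading 1 is the reflection at the outer sphere, the image with q = 1.\<close>

definition higher_V :: "real \<Rightarrow> real \<Rightarrow> real \<Rightarrow> real" where
  "higher_V e p C = 1 + (\<Sum>n. term_weight e p n * higher_term p (kap e n) C)"

lemma higher_V_midpoint:
  fixes m :: nat
  assumes e: "e > 1" and m: "m \<ge> 1" and d1: "d1 > 0" "cosh d1 > rmin e" and d2: "d2 > 0" "cosh d2 > rmin e"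
    and d0: "cosh ((d1 + d2) / 2) > rmin e" and t: "t > 0"
  shows "2 * higher_V e (real m) (cosh ((d1 + d2) / 2)) \<le> t * higher_V e (real m) (cosh d1) + higher_V e (real m) (cosh d2) / t"
proof -
  let ?d0 = "(d1 + d2) / 2"
  have d0p: "?d0 > 0" using d1 d2 by simp
  let ?T = "\<lambda>n i d. (2 / sinh d) ^ m * (neg_binom m i * (1 / e ^ Suc n) ^ (m + 2 * i)) * (2 * sinh (real (m + 2 * i) / 2 * dual_dist d))\<^sup>2"
  \<comment> \<open>Up to a nonnegative constant a summand is a power of 1 / sinh times a squared
    sinh of a multiple of the dual distance; each factor satisfies the squared midpoint inequality,
    hence so does the product.\<close>
  have T: "2 * ?T n i ?d0 \<le> t * ?T n i d1 + ?T n i d2 / t" for n i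
  proof (rule weighted_am_gm)
    define k where "k = neg_binom m i * (1 / e ^ Suc n) ^ (m + 2 * i)"
    have k: "k \<ge> 0" unfolding k_def using neg_binom_nonneg[OF m] e by (intro mult_nonneg_nonneg) auto
    define S where "S d = sinh (real (m + 2 * i) / 2 * dual_dist d)" for d
    have Sp: "S d > 0" if "d > 0" for d
      unfolding S_def using dual_dist_pos[OF that] m by simp
    have mS: "(S ?d0)\<^sup>2 \<le> S d1 * S d2" unfolding S_def by (rule mid_sinh_dual_dist) (use m d1 d2 in auto)
    have mf: "(2 / sinh ?d0)\<^sup>2 \<le> (2 / sinh d1) * (2 / sinh d2)"
      using mid_sinh[OF d1(1) d2(1)] by (simp add: power_divide)
    have "((2 / sinh ?d0) ^ m * k * (2 * S ?d0)\<^sup>2)\<^sup>2 = ((2 / sinh ?d0)\<^sup>2) ^ m * (k * k * 16) * ((S ?d0)\<^sup>2)\<^sup>2"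
    proof -
      have "(u ^ m * k * (2 * z)\<^sup>2)\<^sup>2 = (u\<^sup>2) ^ m * (k * k * 16) * (z\<^sup>2)\<^sup>2" for u z :: real
      proof -
        have "(u ^ m)\<^sup>2 = (u\<^sup>2) ^ m" by (metis power_mult mult.commute)
        then show ?thesis by (simp add: power_mult_distrib) (simp add: power2_eq_square)
      qed
      then show ?thesis .
    qed
    also have "\<dots> \<le> ((2 / sinh d1) * (2 / sinh d2)) ^ m * (k * k * 16) * (S d1 * S d2)\<^sup>2"
      using mS mf k d1 d2 Sp by (intro mult_mono power_mono) auto
    also have "\<dots> = ((2 / sinh d1) ^ m * k * (2 * S d1)\<^sup>2) * ((2 / sinh d2) ^ m * k * (2 * S d2)\<^sup>2)"
      by (simp only: power_mult_distrib) (simp add: power2_eq_square mult_ac)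
    finally show "(?T n i ?d0)\<^sup>2 \<le> ?T n i d1 * ?T n i d2" unfolding S_def k_def .
    show "?T n i d1 \<ge> 0" "?T n i d2 \<ge> 0" using k d1 d2 unfolding k_def by (auto intro!: mult_nonneg_nonneg)
  qed (rule t)
  define G where "G n d = term_weight e (real m) n * higher_term (real m) (kap e n) (cosh d)" for n d
  have G: "2 * G n ?d0 \<le> t * G n d1 + G n d2 / t" for n
    unfolding G_def
    by (rule sums_le[OF T sums_mult[OF term_weight_higher_term_sums[OF e d0p d0 m]]
          sums_add[OF sums_mult[OF term_weight_higher_term_sums[OF e d1 m]] sums_divide[OF term_weight_higher_term_sums[OF e d2 m]]]])
  have sm: "summable (\<lambda>n. G n d)" if "cosh d > rmin e" for d
    unfolding G_def using higher_term_series(4)[OF e _ that, of "real m"] m by simp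
  have "(\<Sum>n. 2 * G n ?d0) \<le> (\<Sum>n. t * G n d1 + G n d2 / t)"
    by (intro suminf_le G summable_mult summable_add summable_divide sm d0 d1 d2)
  also have "\<dots> = t * (\<Sum>n. G n d1) + (\<Sum>n. G n d2) / t"
    using sm[OF d1(2)] sm[OF d2(2)] by (simp add: suminf_add[symmetric] suminf_mult suminf_divide summable_mult summable_divide)
  also have "(\<Sum>n. 2 * G n ?d0) = 2 * (\<Sum>n. G n ?d0)" by (intro suminf_mult sm d0)
  finally have "2 * (\<Sum>n. G n ?d0) \<le> t * (\<Sum>n. G n d1) + (\<Sum>n. G n d2) / t" .
  moreover have "2 * 1 \<le> t * 1 + 1 / t" by (rule weighted_am_gm) (use t in auto)
  ultimately show ?thesis unfolding higher_V_def G_def by (simp add: algebra_simps add_divide_distrib)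
qed

section \<open>The Robin function on the annulus\<close>

definition higher_profile :: "real \<Rightarrow> real \<Rightarrow> real \<Rightarrow> real" where
  "higher_profile e p C = ln (higher_V e p C) / p"

text \<open>For C = cosh a the even function w(cosh (a + h)) + w(cosh (a - h)) has a minimum at h =
  0, where its second derivative is twice the claimed expression. Thus no convexity theory for the
  composite is needed beyond midpoints.\<close>

lemma second_derivative_of_midpoint_convex:
  fixes w :: "real \<Rightarrow> real"
  assumes d: "\<And>C. C > c0 \<Longrightarrow> (w has_real_derivative w1 C) (at C)"
    and d2: "\<And>C. C > c0 \<Longrightarrow> (w1 has_real_derivative w2 C) (at C)"
    and mid: "\<And>x y. x > 0 \<Longrightarrow> y > 0 \<Longrightarrow> cosh x > c0 \<Longrightarrow> cosh y > c0 \<Longrightarrow> cosh ((x + y) / 2) > c0 \<Longrightarrow>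
      2 * w (cosh ((x + y) / 2)) \<le> w (cosh x) + w (cosh y)"
    and C: "C > c0" "C > 1"
  shows "(C\<^sup>2 - 1) * w2 C + C * w1 C \<ge> 0"
proof -
  define a where "a = arcosh C"
  have a: "cosh a = C" "a > 0" using C by (auto simp: a_def)
  have "open {x :: real. x > 0 \<and> cosh x > c0}"
    by (intro open_Collect_conj open_Collect_less continuous_intros)
  then obtain \<delta> where \<delta>: "\<delta> > 0" "ball a \<delta> \<subseteq> {x. x > 0 \<and> cosh x > c0}"
    using a C open_contains_ball by (metis (mono_tags, lifting) mem_Collect_eq)
  have in1: "a + h > 0" "cosh (a + h) > c0" "a - h > 0" "cosh (a - h) > c0" if "\<bar>h\<bar> < \<delta>" for h
  proof -
    have "a + h \<in> ball a \<delta>" "a - h \<in> ball a \<delta>" using that by (auto simp: dist_real_def)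
    then show "a + h > 0" "cosh (a + h) > c0" "a - h > 0" "cosh (a - h) > c0" using \<delta>(2) by blast+
  qed
  define \<phi> where "\<phi> h = w (cosh (a + h)) + w (cosh (a - h))" for h
  define \<phi>' where "\<phi>' h = w1 (cosh (a + h)) * sinh (a + h) - w1 (cosh (a - h)) * sinh (a - h)" for h
  have dc: "((\<lambda>h. cosh (a + h)) has_real_derivative sinh (a + h)) (at h)"
     "((\<lambda>h. cosh (a - h)) has_real_derivative - sinh (a - h)) (at h)"
     "((\<lambda>h. sinh (a + h)) has_real_derivative cosh (a + h)) (at h)"
     "((\<lambda>h. sinh (a - h)) has_real_derivative - cosh (a - h)) (at h)" for h
    by (auto intro!: derivative_eq_intros)
  have "2 * (w2 C * (sinh a)\<^sup>2 + w1 C * cosh a) \<ge> 0"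
  proof (rule local_min_second_derivative[OF \<delta>(1), of 0 \<phi> \<phi>'])
    fix t assume "\<bar>t - 0\<bar> < \<delta>"
    then have t: "\<bar>t\<bar> < \<delta>" by simp
    show "(\<phi> has_real_derivative \<phi>' t) (at t)"
      unfolding \<phi>_def \<phi>'_def
      using DERIV_add[OF DERIV_chain2[OF d[OF in1(2)[OF t]] dc(1)] DERIV_chain2[OF d[OF in1(4)[OF t]] dc(2)]] by simp
    show "\<phi> 0 \<le> \<phi> t"
      using mid[OF in1(1,3,2,4)[OF t]] a C unfolding \<phi>_def by simp
  next
    have 0: "\<bar>0 :: real\<bar> < \<delta>" using \<delta> by simp
    have "(\<phi>' has_real_derivative
       (w2 (cosh (a + 0)) * sinh (a + 0) * sinh (a + 0) + cosh (a + 0) * w1 (cosh (a + 0)))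
       - (w2 (cosh (a - 0)) * (- sinh (a - 0)) * sinh (a - 0) + (- cosh (a - 0)) * w1 (cosh (a - 0)))) (at 0)"
      unfolding \<phi>'_def
      by (intro DERIV_diff DERIV_mult dc DERIV_chain2[OF d2[OF in1(2)[OF 0]] dc(1)] DERIV_chain2[OF d2[OF in1(4)[OF 0]] dc(2)])
    then show "(\<phi>' has_real_derivative 2 * (w2 C * (sinh a)\<^sup>2 + w1 C * cosh a)) (at 0)"
      by (simp add: a power2_eq_square algebra_simps)
  qed
  then show ?thesis using a by (simp add: cosh_square_eq[of a, symmetric] sinh_square_eq mult.commute)
qed

lemma higher_V_ge_1:
  assumes e: "e > 1" and m: "m \<ge> 1" and C: "C > rmin e"
  shows "higher_V e (real m) C \<ge> 1" "(\<Sum>n. term_weight e (real m) n * higher_term1 (real m) (kap e n) C) < 0"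
    "higher_V e (real m) C \<ge> 1 + term_weight e (real m) 0 * higher_term (real m) (kap e 0) C"
proof -
  have p: "real m \<ge> 1" "real m > 0" using m by auto
  have low: "C - sqrt (1 + kap e n) > 0" "kap e n > 0" for n
  proof -
    have "sqrt (1 + kap e n) \<le> rmin e" using kap_bounds[OF e, of n] by (simp add: rmin_def)
    then show "C - sqrt (1 + kap e n) > 0" using C by simp
    show "kap e n > 0" using kap_bounds[OF e] by simp
  qed
  note image_sign = higher_term_signs[OF low p(2)]
  note sm = higher_term_series(4)[OF e p(1) C]
  have nn: "term_weight e (real m) n * higher_term (real m) (kap e n) C \<ge> 0" for n
    using image_sign(1)[of n] term_weight_pos[OF e, of "real m" n] by simp
  show "higher_V e (real m) C \<ge> 1"
    unfolding higher_V_def using suminf_nonneg[OF _ nn] sm by simp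
  have "(\<Sum>n. - (term_weight e (real m) n * higher_term1 (real m) (kap e n) C)) > 0"
  proof (rule suminf_pos)
    show "summable (\<lambda>n. - (term_weight e (real m) n * higher_term1 (real m) (kap e n) C))"
      by (intro summable_minus) (use sm in blast)
    show "- (term_weight e (real m) n * higher_term1 (real m) (kap e n) C) > 0" for n
      using mult_pos_neg[OF term_weight_pos[OF e, of "real m" n] image_sign(2)[of n]] by linarith
  qed
  then show "(\<Sum>n. term_weight e (real m) n * higher_term1 (real m) (kap e n) C) < 0"
    using suminf_minus[of "\<lambda>n. term_weight e (real m) n * higher_term1 (real m) (kap e n) C"] sm by simp
  show "higher_V e (real m) C \<ge> 1 + term_weight e (real m) 0 * higher_term (real m) (kap e 0) C"
    unfolding higher_V_def
    using sum_le_suminf[of "\<lambda>n. term_weight e (real m) n * higher_term (real m) (kap e n) C" "{0}"] sm nn by simp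
qed

lemma higher_radial_profile:
  assumes e: "e > 1" and m: "m \<ge> 1"
  obtains w1 w2 where "radial_profile e (higher_profile e (real m)) w1 w2"
proof
  let ?p = "real m"
  have p: "?p \<ge> 1" "?p > 0" using m by auto
  define V where "V = higher_V e ?p"
  define V1 where "V1 C = (\<Sum>n. term_weight e ?p n * higher_term1 ?p (kap e n) C)" for C
  define V2 where "V2 C = (\<Sum>n. term_weight e ?p n * higher_term2 ?p (kap e n) C)" for C
  have V0: "V C \<ge> 1" "V1 C < 0" if "C > rmin e" for C
    using higher_V_ge_1[OF e m that] by (auto simp: V_def V1_def)
  have dV: "(V has_real_derivative V1 C) (at C)" if "C > rmin e" for C
    using DERIV_add[OF DERIV_const higher_term_series(1)[OF e p(1) that], of 1]
    by (simp add: V_def V1_def higher_V_def[abs_def])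
  have dV1: "(V1 has_real_derivative V2 C) (at C)" if "C > rmin e" for C
    using higher_term_series(2)[OF e p(1) that] by (simp add: V1_def[abs_def] V2_def)
  define w1 where "w1 C = V1 C / V C / ?p" for C
  define w2 where "w2 C = (V2 C * V C - V1 C * V1 C) / (V C * V C) / ?p" for C
  have dw: "(higher_profile e ?p has_real_derivative w1 C) (at C)" if "C > rmin e" for C
    unfolding higher_profile_def[abs_def] V_def[symmetric] w1_def using V0(1)[OF that] p
    by (auto intro!: derivative_eq_intros dV that)
  have dw1: "(w1 has_real_derivative w2 C) (at C)" if "C > rmin e" for C
    unfolding w1_def[abs_def] w2_def
    by (intro DERIV_cdivide DERIV_divide dV dV1 that) (use V0(1)[OF that] in auto)
  show "radial_profile e (higher_profile e ?p) w1 w2"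
    unfolding radial_profile_def
  proof (intro conjI allI impI)
    fix C assume C: "C > rmin e"
    show "(higher_profile e ?p has_real_derivative w1 C) (at C)" by (rule dw[OF C])
    show "(w1 has_real_derivative w2 C) (at C)" by (rule dw1[OF C])
    show "higher_profile e ?p C \<ge> 0" unfolding higher_profile_def V_def[symmetric] using V0(1)[OF C] by simp
    show "w1 C < 0" unfolding w1_def using V0[OF C] p by (simp add: divide_neg_pos)
    show "(C\<^sup>2 - 1) * w2 C + C * w1 C \<ge> 0"
    proof (rule second_derivative_of_midpoint_convex[OF dw dw1])
      fix x y :: real
      assume xy: "x > 0" "y > 0" "cosh x > rmin e" "cosh y > rmin e" "cosh ((x + y) / 2) > rmin e"
      let ?X = "V (cosh x)" and ?Y = "V (cosh y)" and ?Z = "V (cosh ((x + y) / 2))"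
      have pos: "?X \<ge> 1" "?Y \<ge> 1" "?Z \<ge> 1" using V0(1) xy by auto
      \<comment> \<open>The minimiser of t X + Y / t, which turns the linear inequalities back into
        Z <= sqrt (X Y).\<close>
      define t where "t = sqrt (?Y / ?X)"
      have t: "t > 0" using pos by (simp add: t_def)
      have "2 * ?Z \<le> t * ?X + ?Y / t"
        unfolding V_def using higher_V_midpoint[OF e m xy(1,3,2,4,5) t] by simp
      also have "t * ?X + ?Y / t = sqrt (?X * ?Y) + sqrt (?X * ?Y)"
      proof -
        define x' where "x' = sqrt ?X"
        define y' where "y' = sqrt ?Y"
        have xy': "?X = x' * x'" "?Y = y' * y'" "x' > 0" "y' > 0" using pos by (auto simp: x'_def y'_def)
        have "t = y' / x'" "sqrt (?X * ?Y) = x' * y'"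
          by (simp_all add: t_def real_sqrt_divide real_sqrt_mult x'_def y'_def)
        then show ?thesis using xy' by simp
      qed
      finally have "?Z \<le> sqrt (?X * ?Y)" by simp
      then have "ln ?Z \<le> ln (sqrt (?X * ?Y))" using pos by (subst ln_le_cancel_iff) auto
      also have "\<dots> = (ln ?X + ln ?Y) / 2" using pos by (simp add: ln_sqrt ln_mult)
      finally show "2 * higher_profile e ?p (cosh ((x + y) / 2)) \<le> higher_profile e ?p (cosh x) + higher_profile e ?p (cosh y)"
        unfolding higher_profile_def V_def[symmetric] using p
        by (simp add: add_divide_distrib[symmetric] divide_right_mono)
    qed (use C gt_rmin(1)[OF e C] in auto)
  next
    have cV: "continuous_on {rmin e<..} V" "continuous_on {rmin e<..} V1"
      by (auto intro!: continuous_at_imp_continuous_on DERIV_isCont dV dV1)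
    have cV2: "continuous_on {rmin e<..} V2"
      unfolding V2_def[abs_def] by (rule higher_term_series(3)[OF e p(1)])
    have ne: "\<forall>C\<in>{rmin e<..}. V C * V C \<noteq> 0" "\<forall>C\<in>{rmin e<..}. real m \<noteq> 0" using V0(1) p by fastforce+
    show "continuous_on {rmin e<..} w2"
      unfolding w2_def[abs_def] by (intro continuous_intros cV cV2 ne)
  next
    fix K :: real
    \<comment> \<open>The value to be taken by (C - \<open>rmin e\<close>)^(-p): the first part pays
      for the negative summand of the term n = 0, and the second leaves exp (p K) after
      weighting.\<close>
    define D where "D = 2 * kap e 0 powr (- ?p / 2) + exp (?p * K) / term_weight e ?p 0"
    have w0: "term_weight e ?p 0 > 0" by (rule term_weight_pos[OF e])
    have k0: "kap e 0 > 0" using kap_bounds[OF e] by simp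
    have D: "D > 0" using w0 k0 by (simp add: D_def add_pos_pos)
    define C where "C = rmin e + D powr (- 1 / ?p)"
    have C: "C > rmin e" using D by (simp add: C_def)
    have "(C - sqrt (1 + kap e 0)) powr (- ?p) = D"
      using D p by (simp add: C_def rmin_def powr_powr)
    moreover have "(C + sqrt (1 + kap e 0)) powr (- ?p) \<ge> 0" by simp
    moreover have "(C\<^sup>2 - 1) powr (- ?p / 2) \<le> kap e 0 powr (- ?p / 2)"
      using gt_rmin(3)[OF e C, of "kap e 0"] k0 p by (intro powr_mono2') auto
    ultimately have "higher_term ?p (kap e 0) C \<ge> exp (?p * K) / term_weight e ?p 0"
      unfolding higher_term_def D_def by linarith
    then have "term_weight e ?p 0 * higher_term ?p (kap e 0) C \<ge> exp (?p * K)"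
      using w0 by (simp add: field_simps)
    then have "V C > exp (?p * K)" using higher_V_ge_1(3)[OF e m C] by (simp add: V_def)
    then have "ln (V C) > ?p * K" using V0(1)[OF C] by (metis exp_gt_zero ln_exp ln_less_cancel_iff order_less_trans)
    then have "higher_profile e ?p C > K" unfolding higher_profile_def V_def[symmetric] using p by (simp add: field_simps)
    then show "\<exists>C>rmin e. higher_profile e ?p C > K" using C by blast
  qed
qed

section \<open>The regular part on the diagonal\<close>

context eccentric_annulus begin

text \<open>The hyperbolic cosine of the hyperbolic distance from \<open>x\<close> to the hyperbolic centre of the hole.\<close>

definition axial_cosh :: "real ^ 'n \<Rightarrow> real" where "axial_cosh x = (A x + B x) / (2 * al x)"

lemma A_B_axial_cosh: assumes "al x > 0" shows "A x = al x * (axial_cosh x + 1)" "B x = al x * (axial_cosh x - 1)"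
  using assms A_minus_B[of x] by (auto simp: axial_cosh_def field_simps)

lemma rmin_eq: "rmin e = (e\<^sup>2 + 1) / (e\<^sup>2 - 1)"
proof -
  have e2: "e\<^sup>2 > 1" using e_gt_1 by (simp add: one_less_power)
  have "rmin e = (e + 1 / e) / (e - 1 / e)"
  proof -
    have "(x / 2) / (y / 2) = x / y" for x y :: real by simp
    then show ?thesis unfolding rmin_def sqrt_kap[OF e_gt_1] ch_def sh_def by (simp only: power_Suc power_0 mult_1_right)
  qed
  also have "\<dots> = (e * (e + 1 / e)) / (e * (e - 1 / e))" using e_gt_1 by simp
  also have "\<dots> = (e\<^sup>2 + 1) / (e\<^sup>2 - 1)" using e_gt_1 by (simp add: distrib_left right_diff_distrib power2_eq_square)
  finally show ?thesis .
qed

text \<open>A/B = (C + 1)/(C - 1), so the inner sphere A/B = e^2 is the level C = (e^2 + 1)/(e^2 -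
  1) = coth L.\<close>

lemma Omega_iff_axial_cosh: "x \<in> \<Omega> \<longleftrightarrow> al x > 0 \<and> axial_cosh x > rmin e"
proof (cases "al x > 0")
  case True
  have e2: "e\<^sup>2 > 1" using e_gt_1 by (simp add: one_less_power)
  have "be x > 0 \<longleftrightarrow> e\<^sup>2 * B x - A x > 0"
    unfolding B_minus_A using e_gt_1 by (simp add: zero_less_mult_iff)
  also have "e\<^sup>2 * B x - A x = al x * ((e\<^sup>2 - 1) * axial_cosh x - (e\<^sup>2 + 1))"
    unfolding A_B_axial_cosh[OF True] by (simp add: algebra_simps)
  also have "\<dots> > 0 \<longleftrightarrow> (e\<^sup>2 - 1) * axial_cosh x - (e\<^sup>2 + 1) > 0" using True by (simp add: zero_less_mult_iff)
  also have "\<dots> \<longleftrightarrow> axial_cosh x > rmin e" unfolding rmin_eq using e2 by (simp add: pos_divide_less_eq mult.commute)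
  finally show ?thesis using True by (simp add: Omega_eq)
qed (simp add: Omega_eq)

text \<open>At y = x the distance term drops out and the pencil parts become (A - q B)^2, (B - q
  A)^2 and (1 - q)^2 A B. Substituting A = al (C + 1), B = al (C - 1) pulls out al^2.\<close>

lemma diagonal_image_factor:
  assumes "al x > 0"
  shows "image_factor x 0 1 x = (2 * al x)\<^sup>2"
    "image_factor x 0 (image_ratio n) x / image_ratio n = (2 * al x * (sh e n * (axial_cosh x + sqrt (1 + kap e n))))\<^sup>2"
    "image_factor x 1 (image_ratio n) x / image_ratio n = (2 * al x * (sh e n * (axial_cosh x - sqrt (1 + kap e n))))\<^sup>2"
    "image_factor x 2 (image_ratio n) x / image_ratio n = (2 * al x * sh e n)\<^sup>2 * ((axial_cosh x)\<^sup>2 - 1)"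
    "image_factor x 3 (image_ratio n) x / image_ratio n = (2 * al x * sh e n)\<^sup>2 * ((axial_cosh x)\<^sup>2 - 1)"
proof -
  define E where "E = e ^ Suc n"
  have E: "E > 0" using e_gt_1 by (simp add: E_def)
  have q: "image_ratio n = 1 / E\<^sup>2" unfolding image_ratio_def r_def E_def
    by (simp only: power_one_over power_mult[symmetric] mult.commute)
  have sc: "2 * sh e n = E - 1 / E" "2 * ch e n = E + 1 / E"
    by (simp_all add: sh_def ch_def E_def power_one_over del: power_Suc)
  have k: "sh e n * (axial_cosh x + sqrt (1 + kap e n)) = sh e n * axial_cosh x + ch e n" "sh e n * (axial_cosh x - sqrt (1 + kap e n)) = sh e n * axial_cosh x - ch e n"
    unfolding sqrt_kap[OF e_gt_1] using sh_ge_0(2)[OF e_gt_1, of n] by (simp_all add: algebra_simps)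
  note AB = A_B_axial_cosh[OF assms]
  show "image_factor x 0 1 x = (2 * al x)\<^sup>2" unfolding image_factor_0 AB by (simp add: power2_eq_square algebra_simps)
  have sq: "z * z / (1 / E\<^sup>2) = (E * z)\<^sup>2" for z by (simp add: power2_eq_square)
  have "image_factor x 0 (image_ratio n) x / image_ratio n = (E * (A x - (1 / E\<^sup>2) * B x))\<^sup>2"
    unfolding image_factor_0 q sq[symmetric] by simp
  also have "E * (A x - (1 / E\<^sup>2) * B x) = al x * ((E - 1 / E) * axial_cosh x + (E + 1 / E))"
    unfolding AB using E by (simp add: field_simps power2_eq_square)
  also have "\<dots> = 2 * al x * (sh e n * axial_cosh x + ch e n)" unfolding sc[symmetric] by (simp add: algebra_simps)
  finally show "image_factor x 0 (image_ratio n) x / image_ratio n = (2 * al x * (sh e n * (axial_cosh x + sqrt (1 + kap e n))))\<^sup>2" unfolding k .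
  have "image_factor x 1 (image_ratio n) x / image_ratio n = (E * (B x - (1 / E\<^sup>2) * A x))\<^sup>2"
    unfolding image_factor_1 q sq[symmetric] by simp
  also have "E * (B x - (1 / E\<^sup>2) * A x) = al x * ((E - 1 / E) * axial_cosh x - (E + 1 / E))"
    unfolding AB using E by (simp add: field_simps power2_eq_square)
  also have "\<dots> = 2 * al x * (sh e n * axial_cosh x - ch e n)" unfolding sc[symmetric] by (simp add: algebra_simps)
  finally show "image_factor x 1 (image_ratio n) x / image_ratio n = (2 * al x * (sh e n * (axial_cosh x - sqrt (1 + kap e n))))\<^sup>2" unfolding k .
  have h: "(1 - 1 / E\<^sup>2) * (u * v - 1 / E\<^sup>2 * (v * u)) / (1 / E\<^sup>2) = (E - 1 / E)\<^sup>2 * (u * v)" for u v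
    using E by (simp add: field_simps power2_eq_square)
  have uv: "A x * B x = (al x)\<^sup>2 * ((axial_cosh x)\<^sup>2 - 1)" "B x * A x = (al x)\<^sup>2 * ((axial_cosh x)\<^sup>2 - 1)"
    unfolding AB by (simp_all add: power2_eq_square algebra_simps)
  show "image_factor x 2 (image_ratio n) x / image_ratio n = (2 * al x * sh e n)\<^sup>2 * ((axial_cosh x)\<^sup>2 - 1)"
    "image_factor x 3 (image_ratio n) x / image_ratio n = (2 * al x * sh e n)\<^sup>2 * ((axial_cosh x)\<^sup>2 - 1)"
    using h[of "A x" "B x"] h[of "B x" "A x"]
    unfolding image_factor_2 image_factor_3 q uv sc[symmetric] by (simp_all add: power_mult_distrib mult_ac)
qed

lemma axial_cosh_gt:
  assumes "x \<in> \<Omega>"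
  shows "al x > 0" "axial_cosh x > 1" "(axial_cosh x)\<^sup>2 - 1 > 0" "axial_cosh x - sqrt (1 + kap e n) > 0" "axial_cosh x + sqrt (1 + kap e n) > 0"
proof -
  have C: "axial_cosh x > rmin e" and a: "al x > 0" using assms Omega_iff_axial_cosh by auto
  show "al x > 0" by (rule a)
  show "axial_cosh x > 1" "(axial_cosh x)\<^sup>2 - 1 > 0" using gt_rmin[OF e_gt_1 C] by auto
  have "sqrt (1 + kap e n) \<le> rmin e" using kap_bounds[OF e_gt_1, of n] by (simp add: rmin_def)
  then show "axial_cosh x - sqrt (1 + kap e n) > 0" using C by simp
  moreover have "sqrt (1 + kap e n) \<ge> 0" using kap_bounds[OF e_gt_1, of n] by simp
  ultimately show "axial_cosh x + sqrt (1 + kap e n) > 0" by linarith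
qed

text \<open>Within a group the logarithms of \<open>al\<close> and of \<open>sh\<close> cancel by
  signs, so only the reflection retains \<open>al\<close>.\<close>

lemma regular_sum_diagonal_planar:
  assumes N: "CARD('n) = 2" and x: "x \<in> \<Omega>"
  shows "regular_sum x x = - ln (2 * al x) + planar_profile e (axial_cosh x)"
proof -
  have xc: "x \<in> closure \<Omega>" using x closure_subset by blast
  note C = axial_cosh_gt[OF x]
  have T: "gweight (image_ratio n) * pair_sum x (image_ratio n) x = planar_term (kap e n) (axial_cosh x)" for n
  proof -
    note s = sh_ge_0(2)[OF e_gt_1, of n]
    have k0: "kap e n > 0" using kap_bounds[OF e_gt_1] by simp
    have prod: "(axial_cosh x)\<^sup>2 - 1 - kap e n = (axial_cosh x + sqrt (1 + kap e n)) * (axial_cosh x - sqrt (1 + kap e n))"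
      using k0 by (simp add: algebra_simps power2_eq_square)
    have sq: "green_profile 2 (z\<^sup>2) = - ln z" if "z > 0" for z using that by (simp add: green_profile_def ln_realpow)
    define u where "u = axial_cosh x + sqrt (1 + kap e n)"
    define v where "v = axial_cosh x - sqrt (1 + kap e n)"
    have uv: "u > 0" "v > 0" using C(4,5)[of n] by (auto simp: u_def v_def)
    have "gweight (image_ratio n) * pair_sum x (image_ratio n) x = - ln (2 * al x * (sh e n * u)) - ln (2 * al x * (sh e n * v))
       - 2 * green_profile 2 ((2 * al x * sh e n)\<^sup>2 * ((axial_cosh x)\<^sup>2 - 1))"
      unfolding gweight_pair_sum[OF x xc] diagonal_image_factor(2-)[OF C(1)] N u_def[symmetric] v_def[symmetric]
      using uv s C(1) by (simp add: sq)
    also have "\<dots> = ln ((axial_cosh x)\<^sup>2 - 1) - ln u - ln v"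
    proof -
      define z where "z = 2 * al x * sh e n"
      have z: "z > 0" using s C(1) by (simp add: z_def)
      have "2 * al x * (sh e n * u) = z * u" "2 * al x * (sh e n * v) = z * v" by (simp_all add: z_def)
      note zz = this
      show ?thesis unfolding zz z_def[symmetric] green_profile_def
        using z uv C(3) by (simp add: ln_mult_pos ln_realpow diff_divide_distrib del: zero_less_diff diff_gt_0_iff_gt)
    qed
    also have "\<dots> = planar_term (kap e n) (axial_cosh x)"
      unfolding planar_term_def prod u_def[symmetric] v_def[symmetric] using uv by (simp add: ln_mult_pos)
    finally show ?thesis .
  qed
  have AB: "A x > 0" "B x > 0" using A_B_bounds[OF xc] by auto
  have l: "ln (A x) = ln (al x) + ln (axial_cosh x + 1)" "ln (B x) = ln (al x) + ln (axial_cosh x - 1)"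
    unfolding A_B_axial_cosh[OF C(1)] using C(1,2) by (simp_all add: ln_mult_pos)
  have "planar_coef x * (green_profile 2 (B x) - green_profile 2 (A x)) = (ln (A x) - ln (B x))\<^sup>2 / (4 * ln e)"
  proof -
    have "green_profile 2 (B x) - green_profile 2 (A x) = (ln (A x) - ln (B x)) / 2"
      by (simp add: green_profile_def diff_divide_distrib)
    moreover have "planar_coef x = (ln (A x) - ln (B x)) / (2 * ln e)"
      using N AB by (simp add: planar_coef_def ln_div)
    moreover have "u / (2 * k) * (u / 2) = u\<^sup>2 / (4 * k)" for u k :: real by (simp add: power2_eq_square)
    ultimately show ?thesis by (simp only:)
  qed
  also have "\<dots> = (ln (axial_cosh x + 1) - ln (axial_cosh x - 1))\<^sup>2 / (4 * ln e)" by (simp add: l)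
  finally have corr: "planar_coef x * (green_profile 2 (B x) - green_profile 2 (A x)) = (ln (axial_cosh x + 1) - ln (axial_cosh x - 1))\<^sup>2 / (4 * ln e)" .
  have z: "green_profile 2 (z\<^sup>2) = - ln z" if "z > 0" for z
    using that by (simp add: green_profile_def ln_realpow)
  have z1: "green_profile 2 ((2 * al x)\<^sup>2) = - ln (2 * al x)" by (rule z) (use C(1) in simp)
  show ?thesis unfolding regular_sum_def T diagonal_image_factor(1)[OF C(1)] N z1 corr planar_profile_def by simp
qed

text \<open>Every image carries the same power of \<open>al\<close>, which factors out of the whole
  series.\<close>

lemma regular_sum_diagonal_higher:
  assumes N: "CARD('n) \<noteq> 2" and x: "x \<in> \<Omega>" and p: "p = real CARD('n) - 2"
  shows "regular_sum x x = (2 * al x) powr (- p) / p * higher_V e p (axial_cosh x)"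
proof -
  have xc: "x \<in> closure \<Omega>" using x closure_subset by blast
  note C = axial_cosh_gt[OF x]
  have gp: "green_profile CARD('n) D = D powr (- p / 2) / p" for D
    using N by (simp add: green_profile_def p diff_divide_distrib)
  have sq: "(z\<^sup>2) powr (- p / 2) = z powr (- p)" if "z > 0" for z
    using that powr_powr[of z 2 "- p / 2"] by (simp add: powr_numeral)
  have T: "gweight (image_ratio n) * pair_sum x (image_ratio n) x = (2 * al x) powr (- p) / p * (term_weight e p n * higher_term p (kap e n) (axial_cosh x))" for n
  proof -
    note s = sh_ge_0(2)[OF e_gt_1, of n]
    define u where "u = axial_cosh x + sqrt (1 + kap e n)"
    define v where "v = axial_cosh x - sqrt (1 + kap e n)"
    define z where "z = 2 * al x"
    define a where "a = sh e n"
    have pos: "u > 0" "v > 0" "z > 0" "a > 0" using C(1) C(4,5)[of n] s by (auto simp: u_def v_def z_def a_def)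
    have m: "((z * (a * t))\<^sup>2) powr (- p / 2) = z powr (- p) * (a powr (- p) * t powr (- p))" if "t > 0" for t
      using sq[of "z * (a * t)"] that pos by (simp add: powr_mult)
    have m2: "((z * a)\<^sup>2 * ((axial_cosh x)\<^sup>2 - 1)) powr (- p / 2) = z powr (- p) * (a powr (- p) * ((axial_cosh x)\<^sup>2 - 1) powr (- p / 2))"
      using pos C(3) sq[of "z * a"] by (simp add: powr_mult)
    have "gweight (image_ratio n) * pair_sum x (image_ratio n) x = z powr (- p) * (a powr (- p) * u powr (- p)) / p + z powr (- p) * (a powr (- p) * v powr (- p)) / p
       - z powr (- p) * (a powr (- p) * ((axial_cosh x)\<^sup>2 - 1) powr (- p / 2)) / p - z powr (- p) * (a powr (- p) * ((axial_cosh x)\<^sup>2 - 1) powr (- p / 2)) / p"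
      unfolding gweight_pair_sum[OF x xc] diagonal_image_factor(2-)[OF C(1)] gp u_def[symmetric] v_def[symmetric] z_def[symmetric] a_def[symmetric]
        m[OF pos(1)] m[OF pos(2)] m2 ..
    also have "\<dots> = z powr (- p) / p * (a powr (- p) * (v powr (- p) + u powr (- p) - 2 * ((axial_cosh x)\<^sup>2 - 1) powr (- p / 2)))"
      by (simp add: algebra_simps add_divide_distrib diff_divide_distrib)
    finally show ?thesis by (simp add: term_weight_def higher_term_def u_def v_def z_def a_def)
  qed
  have p1: "p \<ge> 1" using dim N p by linarith
  have "axial_cosh x > rmin e" using x Omega_iff_axial_cosh by simp
  then have sm: "summable (\<lambda>n. term_weight e p n * higher_term p (kap e n) (axial_cosh x))" using higher_term_series(4)[OF e_gt_1 p1] by blast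
  show ?thesis unfolding regular_sum_def T suminf_mult[OF sm] diagonal_image_factor(1)[OF C(1)] higher_V_def gp
    using sq[of "2 * al x"] C(1) N by (simp add: planar_coef_def algebra_simps)
qed

text \<open>\<open>F\<close> is affine for N = 2 and exponential for N > 2; the statement hides this
  difference, so that the study of critical points is uniform in the dimension.\<close>

theorem robin_profile:
  obtains F F1 F2 w w1 w2 where "radial_profile e w w1 w2"
    "\<And>z. (F has_real_derivative F1 z) (at z)" "\<And>z. (F1 has_real_derivative F2 z) (at z)" "\<And>z. F1 z > 0"
    "continuous_on UNIV F2" "\<And>x. x \<in> \<Omega> \<Longrightarrow> robin_function \<Omega> x = F (- ln (al x) + w (axial_cosh x))"
proof (cases "CARD('n) = 2")
  case True
  obtain w1 w2 where w: "radial_profile e (planar_profile e) w1 w2"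
    by (rule planar_radial_profile[OF e_gt_1])
  show ?thesis
  proof (rule that[OF w])
    show "((\<lambda>z. green_const * (z - ln 2)) has_real_derivative green_const) (at z)" for z
      by (auto intro!: derivative_eq_intros)
    show "((\<lambda>z. green_const) has_real_derivative 0) (at z)" for z by simp
    show "robin_function \<Omega> x = green_const * (- ln (al x) + planar_profile e (axial_cosh x) - ln 2)" if "x \<in> \<Omega>" for x
      unfolding robin_function_eq[OF that] regular_sum_diagonal_planar[OF True that] using axial_cosh_gt(1)[OF that]
      by (simp add: ln_mult_pos)
  qed (use green_const_pos in auto)
next
  case False
  define m where "m = CARD('n) - 2"
  have m: "m \<ge> 1" "real m = real CARD('n) - 2" using False dim by (auto simp: m_def)
  define p where "p = real m"
  have p: "p > 0" using m by (simp add: p_def)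
  obtain w1 w2 where w: "radial_profile e (higher_profile e p) w1 w2"
    unfolding p_def by (rule higher_radial_profile[OF e_gt_1 m(1)])
  show ?thesis
  proof (rule that[OF w])
    show "((\<lambda>z. green_const / p * exp (p * (z - ln 2))) has_real_derivative green_const * exp (p * (z - ln 2))) (at z)" for z
      using p by (auto intro!: derivative_eq_intros)
    show "((\<lambda>z. green_const * exp (p * (z - ln 2))) has_real_derivative green_const * p * exp (p * (z - ln 2))) (at z)" for z
      by (auto intro!: derivative_eq_intros)
    show "green_const * exp (p * (z - ln 2)) > 0" for z using green_const_pos by simp
    show "continuous_on UNIV (\<lambda>z. green_const * p * exp (p * (z - ln 2)))" by (intro continuous_intros)
    fix x assume x: "x \<in> \<Omega>"
    have V: "higher_V e p (axial_cosh x) \<ge> 1"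
      unfolding p_def using higher_V_ge_1(1)[OF e_gt_1 m(1)] x Omega_iff_axial_cosh by blast
    have a: "al x > 0" by (rule axial_cosh_gt(1)[OF x])
    have "p * (- ln (al x) + higher_profile e p (axial_cosh x) - ln 2) = (- p) * ln (2 * al x) + ln (higher_V e p (axial_cosh x))"
      using a p by (simp add: higher_profile_def ln_mult_pos algebra_simps)
    then have "exp (p * (- ln (al x) + higher_profile e p (axial_cosh x) - ln 2)) = (2 * al x) powr (- p) * higher_V e p (axial_cosh x)"
      using a V by (simp add: exp_diff exp_minus powr_def divide_inverse)
    then show "robin_function \<Omega> x = green_const / p * exp (p * (- ln (al x) + higher_profile e p (axial_cosh x) - ln 2))"
      unfolding robin_function_eq[OF x] regular_sum_diagonal_higher[OF False x m(2)[folded p_def]] by simp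
  qed
qed

end

section \<open>Zeros along the axis\<close>

text \<open>The derivative of \<open>ln (1 + cosh z) + w (cosh (z - l))\<close>.\<close>

definition axial_derivative :: "(real \<Rightarrow> real) \<Rightarrow> real \<Rightarrow> real \<Rightarrow> real" where
  "axial_derivative w1 l z = sinh z / (1 + cosh z) + w1 (cosh (z - l)) * sinh (z - l)"

lemma axial_derivative_minus: "axial_derivative w1 l (- z) = - axial_derivative w1 (- l) z"
proof -
  have m: "- z - l = - (z + l)" by simp
  show ?thesis unfolding axial_derivative_def m sinh_minus cosh_minus diff_minus_eq_add by simp
qed

lemma cosh_gt_iff:
  assumes "a \<ge> 0"
  shows "cosh z > cosh a \<longleftrightarrow> \<bar>z\<bar> > (a :: real)"
proof -
  have "cosh z = cosh \<bar>z\<bar>" by (simp add: abs_if)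
  then show ?thesis using assms cosh_real_nonneg_less_iff[of a "\<bar>z\<bar>"] by simp
qed

text \<open>\<open>radial_profile\<close> gives only a nonnegative contribution; strictness comes
  from sinh z / (1 + cosh z), whose derivative is 1 / (1 + cosh z).\<close>

lemma axial_derivative_has_derivative:
  assumes w: "radial_profile e w w1 w2" and e: "e > 1" and z: "cosh (z - l) > rmin e"
  obtains D where "(axial_derivative w1 l has_real_derivative D) (at z)" "D > 0"
proof -
  have c1: "1 + cosh y \<noteq> 0" "1 + cosh y > 0" for y :: real using cosh_real_ge_1[of y] by linarith+
  let ?C = "cosh (z - l)" and ?S = "sinh (z - l)"
  have dw1: "(w1 has_real_derivative w2 ?C) (at ?C)" and pos: "(?C\<^sup>2 - 1) * w2 ?C + ?C * w1 ?C \<ge> 0"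
    using w z by (auto simp: radial_profile_def)
  have d: "((\<lambda>z. cosh (z - l)) has_real_derivative ?S) (at z)" "((\<lambda>z. sinh (z - l)) has_real_derivative ?C) (at z)"
    by (auto intro!: derivative_eq_intros)
  have "((\<lambda>z. sinh z / (1 + cosh z)) has_real_derivative ((cosh z * (1 + cosh z) - sinh z * sinh z) / ((1 + cosh z) * (1 + cosh z)))) (at z)"
    using c1 by (auto intro!: derivative_eq_intros)
  from DERIV_add[OF this DERIV_mult[OF DERIV_chain2[OF dw1 d(1)] d(2)]]
  have "(axial_derivative w1 l has_real_derivative
    ((cosh z * (1 + cosh z) - sinh z * sinh z) / ((1 + cosh z) * (1 + cosh z)) + (w2 ?C * ?S * ?S + ?C * w1 ?C))) (at z)"
    unfolding axial_derivative_def[abs_def] .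
  moreover have "cosh z * (1 + cosh z) - sinh z * sinh z = 1 + cosh z"
    using cosh_square_eq[of z] by (simp add: power2_eq_square algebra_simps)
  moreover have "(1 + cosh z) / ((1 + cosh z) * (1 + cosh z)) > 0" using c1 by simp
  moreover have "w2 ?C * ?S * ?S + ?C * w1 ?C \<ge> 0"
  proof -
    have "?C\<^sup>2 - 1 = ?S\<^sup>2" by (simp add: cosh_square_eq)
    with pos show ?thesis by (simp add: power2_eq_square mult_ac)
  qed
  ultimately show ?thesis using that by (smt (verit))
qed

text \<open>Existence is a minimum of \<open>\<Phi>\<close> on a compact interval whose ends lie
  above an interior value; uniqueness is strict monotonicity of the derivative.\<close>

lemma axial_derivative_unique_zero:
  assumes w: "radial_profile e w w1 w2" and e: "e > 1" and a: "a > 0" "cosh a = rmin e"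
  shows "\<exists>!z. z > l + a \<and> axial_derivative w1 l z = 0"
proof -
  have dom: "cosh (z - l) > rmin e" if "z > l + a" for z
    using cosh_gt_iff[of a "z - l"] a that by simp
  have c1: "1 + cosh y \<noteq> 0" "1 + cosh y > 0" for y :: real using cosh_real_ge_1[of y] by linarith+
  define \<Phi> where "\<Phi> z = ln (1 + cosh z) + w (cosh (z - l))" for z
  have d\<Phi>: "(\<Phi> has_real_derivative axial_derivative w1 l z) (at z)" if "z > l + a" for z
  proof -
    have dw: "(w has_real_derivative w1 (cosh (z - l))) (at (cosh (z - l)))"
      using w dom[OF that] by (auto simp: radial_profile_def)
    have d: "((\<lambda>z. cosh (z - l)) has_real_derivative sinh (z - l)) (at z)"
      by (auto intro!: derivative_eq_intros)
    have "((\<lambda>z. ln (1 + cosh z)) has_real_derivative sinh z / (1 + cosh z)) (at z)"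
      using c1 by (auto intro!: derivative_eq_intros simp: divide_inverse)
    from DERIV_add[OF this DERIV_chain2[OF dw d]]
    show ?thesis unfolding \<Phi>_def[abs_def] axial_derivative_def .
  qed
  have wpos: "w C \<ge> 0" if "C > rmin e" for C using w that by (auto simp: radial_profile_def)
  have wdec: "w C' \<le> w C" if "rmin e < C" "C \<le> C'" for C C'
  proof (rule DERIV_nonpos_imp_nonincreasing[OF that(2)])
    fix x assume "C \<le> x" "x \<le> C'"
    then have "(w has_real_derivative w1 x) (at x)" "w1 x < 0" using w that(1) by (auto simp: radial_profile_def)
    then show "\<exists>y. (w has_real_derivative y) (at x) \<and> y \<le> 0" by (auto intro: less_imp_le)
  qed
  define z0 where "z0 = l + a + 1"
  define K where "K = \<Phi> z0"
  \<comment> \<open>Blow-up at the hole is available only as unboundedness; the monotonicity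
    \<open>wdec\<close> later shows that this point lies between the hole and
    \<open>z0\<close>.\<close>
  obtain C1 where C1: "C1 > rmin e" "w C1 > K" using w unfolding radial_profile_def by blast
  define z1 where "z1 = l + arcosh C1"
  have C1g: "C1 > 1" using gt_rmin(1)[OF e C1(1)] .
  have cz1: "cosh (z1 - l) = C1" using C1g by (simp add: z1_def)
  have z1a: "z1 > l + a"
    using cosh_gt_iff[of a "arcosh C1"] a C1 C1g by (simp add: z1_def)
  have ln_pos: "ln (1 + cosh y) \<ge> 0" for y :: real using cosh_real_ge_1[of y] by simp
  have \<Phi>1: "\<Phi> z1 > K" unfolding \<Phi>_def cz1 using C1(2) ln_pos[of z1] by linarith
  have z10: "z1 < z0"
  proof (rule ccontr)
    assume "\<not> z1 < z0"
    then have le: "cosh (z0 - l) \<le> C1" unfolding cz1[symmetric] using a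
      by (intro cosh_real_nonneg_le_iff[THEN iffD2]) (auto simp: z0_def)
    have "w C1 \<le> w (cosh (z0 - l))" by (rule wdec[OF dom le]) (simp add: z0_def)
    moreover have "w (cosh (z0 - l)) \<le> K" using ln_pos[of z0] by (simp add: K_def \<Phi>_def)
    ultimately show False using C1(2) by linarith
  qed
  \<comment> \<open>Far out ln (1 + cosh z) >= z - ln 2 exceeds K, and w >= 0 cannot spoil
    this.\<close>
  define z2 where "z2 = max (z0 + 1) (K + ln 2 + 1)"
  have \<Phi>2: "\<Phi> z2 > K"
  proof -
    have "exp z2 / 2 \<le> 1 + cosh z2" unfolding cosh_field_def add_divide_distrib using exp_gt_zero[of "- z2"] by simp
    then have "ln (exp z2 / 2) \<le> ln (1 + cosh z2)" by (subst ln_le_cancel_iff) (auto simp: c1)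
    then have "z2 - ln 2 \<le> ln (1 + cosh z2)" by (simp add: ln_div)
    moreover have "w (cosh (z2 - l)) \<ge> 0" by (rule wpos[OF dom]) (simp add: z2_def z0_def)
    moreover have "z2 - ln 2 > K" by (simp add: z2_def)
    ultimately show ?thesis unfolding \<Phi>_def by linarith
  qed
  have z02: "z0 < z2" by (simp add: z2_def)
  have "continuous_on {z1..z2} \<Phi>"
    by (rule continuous_at_imp_continuous_on, rule ballI, rule DERIV_isCont[OF d\<Phi>]) (use z1a in auto)
  then obtain z where z: "z \<in> {z1..z2}" "\<And>y. y \<in> {z1..z2} \<Longrightarrow> \<Phi> z \<le> \<Phi> y"
    using continuous_attains_inf[of "{z1..z2}" \<Phi>] z10 z02 by auto
  have "\<Phi> z \<le> K" using z(2)[of z0] z10 z02 by (simp add: K_def)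
  then have "z \<noteq> z1" "z \<noteq> z2" using \<Phi>1 \<Phi>2 by auto
  then have zi: "z1 < z" "z < z2" using z(1) by auto
  have za: "z > l + a" using zi z1a by simp
  have "axial_derivative w1 l z = 0"
    by (rule DERIV_local_min[OF d\<Phi>[OF za], of "min (z - z1) (z2 - z)"])
       (use zi in \<open>auto intro!: z(2) simp: abs_if split: if_splits\<close>)
  moreover have "x = y" if xy: "x > l + a" "y > l + a" "axial_derivative w1 l x = 0" "axial_derivative w1 l y = 0" for x y
  proof -
    have inc: "axial_derivative w1 l u < axial_derivative w1 l v" if "l + a < u" "u < v" for u v
    proof (rule DERIV_pos_imp_increasing[OF that(2)])
      fix t assume "u \<le> t" "t \<le> v"
      then have "cosh (t - l) > rmin e" using that by (intro dom) simp
      then show "\<exists>y. (axial_derivative w1 l has_real_derivative y) (at t) \<and> 0 < y"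
        by (rule axial_derivative_has_derivative[OF w e]) blast
    qed
    show ?thesis using inc[of x y] inc[of y x] xy by (cases x y rule: linorder_cases) auto
  qed
  ultimately show ?thesis using za by blast
qed

text \<open>The side z < l - a is the other one reflected: z and l change sign together.\<close>

lemma axial_derivative_zeros:
  assumes w: "radial_profile e w w1 w2" and e: "e > 1"
  obtains z1 z2 where "z1 \<noteq> z2"
    "{z. cosh (z - l) > rmin e \<and> axial_derivative w1 l z = 0} = {z1, z2}"
proof -
  define a where "a = arcosh (rmin e)"
  have a: "a > 0" "cosh a = rmin e" using rmin_gt_1[OF e] by (auto simp: a_def)
  note U = axial_derivative_unique_zero[OF w e a]
  obtain z1 where z1: "z1 > l + a" "axial_derivative w1 l z1 = 0"
    "\<And>z. z > l + a \<Longrightarrow> axial_derivative w1 l z = 0 \<Longrightarrow> z = z1" using U[of l] by blast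
  obtain y where y: "y > - l + a" "axial_derivative w1 (- l) y = 0"
    "\<And>z. z > - l + a \<Longrightarrow> axial_derivative w1 (- l) z = 0 \<Longrightarrow> z = y" using U[of "- l"] by blast
  have y': "z < l - a \<and> axial_derivative w1 l z = 0 \<longleftrightarrow> z = - y" for z
  proof -
    have "axial_derivative w1 l z = 0 \<longleftrightarrow> axial_derivative w1 (- l) (- z) = 0"
      using axial_derivative_minus[of w1 l "- z"] by simp
    then show ?thesis using y(1,2) y(3)[of "- z"] by auto
  qed
  have "cosh (z - l) > rmin e \<longleftrightarrow> z > l + a \<or> z < l - a" for z
    using cosh_gt_iff[of a "z - l"] a by auto
  then have "{z. cosh (z - l) > rmin e \<and> axial_derivative w1 l z = 0} = {z1, - y}"
    using z1 y' by blast
  moreover have "z1 \<noteq> - y" using z1(1) y(1) a by auto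
  ultimately show ?thesis using that by blast
qed

section \<open>Critical points\<close>

text \<open>The matrix acts by \<kappa> on the complement of u and by \<kappa> + \<mu> on u.\<close>

lemma invertible_rank_one_update:
  fixes u :: "real ^ 'n"
  assumes "norm u = 1" "\<kappa> \<noteq> 0" "\<kappa> + \<mu> \<noteq> 0"
  shows "invertible (\<kappa> *\<^sub>R mat 1 + \<mu> *\<^sub>R outer u u)"
proof -
  let ?M = "\<kappa> *\<^sub>R mat 1 + \<mu> *\<^sub>R outer u u"
  have mv: "?M *v v = \<kappa> *\<^sub>R v + (\<mu> * (u \<bullet> v)) *\<^sub>R u" for v
    by (simp add: matrix_vector_mult_add_rdistrib scaleR_matrix_vector_assoc[symmetric] outer_mult_vec)
  have uu: "u \<bullet> u = 1" using assms(1) by (simp add: dot_square_norm)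
  have "v = 0" if "?M *v v = 0" for v
  proof -
    have eq: "\<kappa> *\<^sub>R v + (\<mu> * (u \<bullet> v)) *\<^sub>R u = 0" using that by (simp only: mv)
    then have "u \<bullet> (\<kappa> *\<^sub>R v + (\<mu> * (u \<bullet> v)) *\<^sub>R u) = 0" by (simp only: inner_zero_right)
    then have "(\<kappa> + \<mu>) * (u \<bullet> v) = 0" by (simp add: inner_add_right uu algebra_simps)
    then have "u \<bullet> v = 0" using assms(3) by simp
    then show ?thesis using eq assms(2) by simp
  qed
  then have "inj ((*v) ?M)"
    using linear_injective_0[OF matrix_vector_mul_linear[of ?M]] by blast
  then show ?thesis
    using matrix_left_invertible_injective[of ?M] invertible_left_inverse[of ?M] by blast
qed

lemma transpose_rank_one_update:
  "transpose (\<kappa> *\<^sub>R mat 1 + \<mu> *\<^sub>R outer u u) = \<kappa> *\<^sub>R mat 1 + \<mu> *\<^sub>R outer u (u :: real ^ 'n)"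
  by (simp add: transpose_def vec_eq_iff mat_def outer_def mult.commute)

lemma infinite_unit_sphere:
  assumes "CARD('n) \<ge> 2"
  shows "infinite {u :: real ^ 'n. norm u = 1}"
proof -
  obtain i j :: 'n where ij: "i \<noteq> j"
    using assms by (metis One_nat_def card_1_singleton_iff card_le_Suc0_iff_eq finite not_less_eq_eq numeral_2_eq_2 UNIV_I)
  define f where "f a = a *\<^sub>R axis i 1 + sqrt (1 - a\<^sup>2) *\<^sub>R axis j (1 :: real)" for a :: real
  have fi: "f a $ i = a" for a using ij by (simp add: f_def axis_def)
  have "inj_on f {0..1}" by (rule inj_onI) (metis fi)
  moreover have "infinite {0..1 :: real}" by (simp add: infinite_Icc)
  ultimately have "infinite (f ` {0..1})" using finite_imageD by blast
  moreover have "f ` {0..1} \<subseteq> {u. norm u = 1}"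
  proof clarify
    fix a :: real assume a: "a \<in> {0..1}"
    then have a2: "a\<^sup>2 \<le> 1" by (simp add: power_le_one)
    have "axis i (1::real) \<bullet> axis j 1 = 0" using ij by (simp add: inner_axis_axis)
    then have "f a \<bullet> f a = a\<^sup>2 + (sqrt (1 - a\<^sup>2))\<^sup>2"
      by (simp add: f_def inner_add_left inner_add_right inner_commute power2_eq_square inner_axis_axis)
    then have "f a \<bullet> f a = 1" using a2 by simp
    then show "norm (f a) = 1" by (simp add: norm_eq_sqrt_inner)
  qed
  ultimately show ?thesis using finite_subset by blast
qed

lemma tanh_half: "tanh (z / 2) = sinh z / (1 + cosh (z :: real))"
proof -
  define y where "y = z / 2"
  have z: "z = 2 * y" by (simp add: y_def)
  have c: "cosh y > 0" by simp
  have "1 + cosh (2 * y) = 2 * (cosh y)\<^sup>2" by (simp add: cosh_double_cosh)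
  then show ?thesis unfolding z using c by (simp add: sinh_double tanh_def power2_eq_square)
qed

section \<open>Gradient and Hessian of the potential\<close>

context eccentric_annulus begin

text \<open>The coefficient of |y|^2 in A + B, so that (A + B) / 2 has gradient \<open>g\<close> y +
  \<open>vA\<close>.\<close>

definition g :: real where "g = kA + kB"

text \<open>Multiplying by \<open>al\<close> clears denominators. The same scalar appears as the
  coefficient of x in the gradient and as \<open>al\<close> times \<kappa>; this coincidence makes
  \<kappa> accessible at critical points.\<close>

lemma c2_with_potential:
  assumes w: "radial_profile e w w1 w2"
  obtains G H where "c2_with \<Omega> (\<lambda>x. - ln (al x) + w (axial_cosh x)) G H"
    "\<And>x. x \<in> \<Omega> \<Longrightarrow> al x *\<^sub>R G x = (1 / R + w1 (axial_cosh x) * (g + axial_cosh x / R)) *\<^sub>R x + w1 (axial_cosh x) *\<^sub>R vA"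
    "\<And>x u t k. x \<in> \<Omega> \<Longrightarrow> x = t *\<^sub>R u \<Longrightarrow> vA = k *\<^sub>R u \<Longrightarrow>
       \<exists>\<kappa> \<mu>. H x = \<kappa> *\<^sub>R mat 1 + \<mu> *\<^sub>R outer u u \<and> al x * \<kappa> = 1 / R + w1 (axial_cosh x) * (g + axial_cosh x / R)"
proof -
  define ga where "ga y = (A y + B y) / 2" for y
  have ga_quad: "ga = quad (g / 2) vA ((cA + cB) / 2)"
    by (rule ext) (simp add: ga_def A_quad B_quad quad_def g_def algebra_simps add_divide_distrib)
  have al_quad: "al = quad (- 1 / (2 * R)) 0 (R / 2)"
    by (rule ext) (use R_pos in \<open>simp add: al_def quad_def diff_divide_distrib power2_eq_square\<close>)
  have pos: "al x > 0" "axial_cosh x > rmin e" "axial_cosh x > 1" "ga x = al x * axial_cosh x" "ga x > 0" if "x \<in> \<Omega>" for x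
  proof -
    show a: "al x > 0" "axial_cosh x > 1" using axial_cosh_gt[OF that] by auto
    show "axial_cosh x > rmin e" using that Omega_iff_axial_cosh by blast
    show "ga x = al x * axial_cosh x" using a by (simp add: ga_def axial_cosh_def)
    then show "ga x > 0" using a by simp
  qed
  have dln: "(ln has_real_derivative inverse y) (at y)" "(inverse has_real_derivative - (inverse y)\<^sup>2) (at y)"
    if "y > 0" for y :: real
    using that by (auto intro!: derivative_eq_intros simp: divide_inverse power2_eq_square)
  have cinv: "continuous_on S (\<lambda>y. - (inverse y)\<^sup>2)" if "S \<subseteq> {0<..}" for S :: "real set"
    using that by (intro continuous_intros) auto
  have cal: "c2_with \<Omega> (\<lambda>x. ln (al x)) (\<lambda>x. inverse (al x) *\<^sub>R ((2 * (- 1 / (2 * R))) *\<^sub>R x + 0))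
     (\<lambda>x. inverse (al x) *\<^sub>R ((2 * (- 1 / (2 * R))) *\<^sub>R mat 1) + (- (inverse (al x))\<^sup>2) *\<^sub>R
        outer ((2 * (- 1 / (2 * R))) *\<^sub>R x + 0) ((2 * (- 1 / (2 * R))) *\<^sub>R x + 0))"
    by (rule c2_with_compose[OF c2_with_quad[OF open_Omega, of "- 1 / (2 * R)" 0 "R / 2", folded al_quad]])
       (use pos(1) dln in \<open>auto intro!: cinv\<close>)
  have cga: "c2_with \<Omega> (\<lambda>x. ln (ga x)) (\<lambda>x. inverse (ga x) *\<^sub>R ((2 * (g / 2)) *\<^sub>R x + vA))
     (\<lambda>x. inverse (ga x) *\<^sub>R ((2 * (g / 2)) *\<^sub>R mat 1) + (- (inverse (ga x))\<^sup>2) *\<^sub>R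
        outer ((2 * (g / 2)) *\<^sub>R x + vA) ((2 * (g / 2)) *\<^sub>R x + vA))"
    by (rule c2_with_compose[OF c2_with_quad[OF open_Omega, of "g / 2" vA "(cA + cB) / 2", folded ga_quad]])
       (use pos(5) dln in \<open>auto intro!: cinv\<close>)
  define a where "a x = (- 1 / R) *\<^sub>R x" for x :: "real ^ 'n"
  define b where "b x = g *\<^sub>R x + vA" for x
  have cal': "c2_with \<Omega> (\<lambda>x. ln (al x)) (\<lambda>x. inverse (al x) *\<^sub>R a x)
     (\<lambda>x. (- inverse (al x) / R) *\<^sub>R mat 1 + (- (inverse (al x))\<^sup>2) *\<^sub>R outer (a x) (a x))"
    using cal by (simp add: a_def[abs_def])
  have cga': "c2_with \<Omega> (\<lambda>x. ln (ga x)) (\<lambda>x. inverse (ga x) *\<^sub>R b x)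
     (\<lambda>x. (inverse (ga x) * g) *\<^sub>R mat 1 + (- (inverse (ga x))\<^sup>2) *\<^sub>R outer (b x) (b x))"
    using cga by (simp add: b_def[abs_def])
  note T = c2_with_add[OF cga' c2_with_scale[OF cal', of "- 1"]]
  define pair_grad where "pair_grad x = inverse (ga x) *\<^sub>R b x + (- 1) *\<^sub>R (inverse (al x) *\<^sub>R a x)" for x
  define pair_hess where "pair_hess x = (inverse (ga x) * g) *\<^sub>R mat 1 + (- (inverse (ga x))\<^sup>2) *\<^sub>R outer (b x) (b x)
      + (- 1) *\<^sub>R ((- inverse (al x) / R) *\<^sub>R mat 1 + (- (inverse (al x))\<^sup>2) *\<^sub>R outer (a x) (a x))" for x
  have T': "c2_with \<Omega> (\<lambda>x. ln (ga x) + - 1 * ln (al x)) pair_grad pair_hess"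
    using T unfolding pair_grad_def[abs_def] pair_hess_def[abs_def] .
  have expT: "exp (ln (ga x) + - 1 * ln (al x)) = axial_cosh x" if "x \<in> \<Omega>" for x
    using pos[OF that] by (simp add: exp_diff)
  \<comment> \<open>Writing \<open>axial_cosh\<close> as exp (ln ga - ln al) avoids a quotient rule:
    \<open>W1\<close> and \<open>W2\<close> are the derivatives of w composed with exp.\<close>
  define W1 where "W1 t = w1 (exp t) * exp t" for t
  define W2 where "W2 t = w2 (exp t) * exp t * exp t + exp t * w1 (exp t)" for t
  have dw: "(w has_real_derivative w1 C) (at C)" "(w1 has_real_derivative w2 C) (at C)" if "C > rmin e" for C
    using w that by (auto simp: radial_profile_def)
  have dW: "((\<lambda>t. w (exp t)) has_real_derivative W1 t) (at t)" "(W1 has_real_derivative W2 t) (at t)"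
    if "exp t > rmin e" for t
    using DERIV_chain2[OF dw(1)[OF that] DERIV_exp] DERIV_mult[OF DERIV_chain2[OF dw(2)[OF that] DERIV_exp] DERIV_exp]
    unfolding W1_def[abs_def] W2_def by simp_all
  have cW2: "continuous_on {t. exp t > rmin e} W2"
  proof -
    have "continuous_on {rmin e<..} w2" using w by (simp add: radial_profile_def)
    then have "continuous_on {t. exp t > rmin e} (\<lambda>t. w2 (exp t))"
      by (rule continuous_on_compose2) (auto intro!: continuous_intros)
    moreover have "continuous_on {rmin e<..} w1"
      by (auto intro!: continuous_at_imp_continuous_on DERIV_isCont dw)
    then have "continuous_on {t. exp t > rmin e} (\<lambda>t. w1 (exp t))"
      by (rule continuous_on_compose2) (auto intro!: continuous_intros)
    ultimately show ?thesis unfolding W2_def[abs_def] by (intro continuous_intros)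
  qed
  have WT: "c2_with \<Omega> (\<lambda>x. w (exp (ln (ga x) + - 1 * ln (al x))))
     (\<lambda>x. W1 (ln (ga x) + - 1 * ln (al x)) *\<^sub>R pair_grad x)
     (\<lambda>x. W1 (ln (ga x) + - 1 * ln (al x)) *\<^sub>R pair_hess x + W2 (ln (ga x) + - 1 * ln (al x)) *\<^sub>R outer (pair_grad x) (pair_grad x))"
  proof (rule c2_with_compose[OF T'])
    show "continuous_on ((\<lambda>x. ln (ga x) + - 1 * ln (al x)) ` \<Omega>) W2"
      by (rule continuous_on_subset[OF cW2]) (use expT pos(2) in auto)
  qed (use expT pos(2) in \<open>auto intro!: dW\<close>)
  note F = c2_with_add[OF c2_with_scale[OF cal', of "- 1"] WT]
  define G where "G x = (- 1) *\<^sub>R (inverse (al x) *\<^sub>R a x) + W1 (ln (ga x) + - 1 * ln (al x)) *\<^sub>R pair_grad x" for x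
  define H where "H x = (- 1) *\<^sub>R ((- inverse (al x) / R) *\<^sub>R mat 1 + (- (inverse (al x))\<^sup>2) *\<^sub>R outer (a x) (a x))
     + (W1 (ln (ga x) + - 1 * ln (al x)) *\<^sub>R pair_hess x + W2 (ln (ga x) + - 1 * ln (al x)) *\<^sub>R outer (pair_grad x) (pair_grad x))" for x
  have c2: "c2_with \<Omega> (\<lambda>x. - ln (al x) + w (axial_cosh x)) G H"
    by (rule c2_with_cong[OF F[folded G_def[abs_def] H_def[abs_def]]]) (use expT in simp)
  have W1C: "W1 (ln (ga x) + - 1 * ln (al x)) = w1 (axial_cosh x) * axial_cosh x" if "x \<in> \<Omega>" for x
    unfolding W1_def expT[OF that] ..
  have inv: "axial_cosh x * inverse (ga x) = inverse (al x)" if "x \<in> \<Omega>" for x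
    using pos[OF that] by (simp add: field_simps)
  show ?thesis
  proof (rule that[OF c2])
    fix x assume x: "x \<in> \<Omega>"
    have "al x *\<^sub>R G x = (- (al x * inverse (al x))) *\<^sub>R a x + (w1 (axial_cosh x) * (al x * (axial_cosh x * inverse (ga x)))) *\<^sub>R b x
        - (w1 (axial_cosh x) * axial_cosh x * (al x * inverse (al x))) *\<^sub>R a x"
      unfolding G_def pair_grad_def W1C[OF x] by (simp add: scaleR_add_right scaleR_diff_right mult_ac)
    also have "\<dots> = (- 1) *\<^sub>R a x + w1 (axial_cosh x) *\<^sub>R b x - (w1 (axial_cosh x) * axial_cosh x) *\<^sub>R a x"
      unfolding inv[OF x] using pos(1)[OF x] by simp
    finally show "al x *\<^sub>R G x = (1 / R + w1 (axial_cosh x) * (g + axial_cosh x / R)) *\<^sub>R x + w1 (axial_cosh x) *\<^sub>R vA"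
      by (simp add: a_def b_def scaleR_add_right scaleR_add_left algebra_simps)
  next
    fix x u :: "real ^ 'n" and t k assume x: "x \<in> \<Omega>" and xt: "x = t *\<^sub>R u" and v: "vA = k *\<^sub>R u"
    have oo: "outer (z *\<^sub>R u) (z *\<^sub>R u) = (z * z) *\<^sub>R outer u u" for z
      by (simp add: outer_def vec_eq_iff mult_ac)
    have a: "a x = (- t / R) *\<^sub>R u" and b: "b x = (g * t + k) *\<^sub>R u"
      by (simp_all add: a_def b_def xt v scaleR_add_left)
    have TGu: "pair_grad x = (inverse (ga x) * (g * t + k) + inverse (al x) * (t / R)) *\<^sub>R u"
      unfolding pair_grad_def a b by (simp only: scaleR_scaleR scaleR_add_left[symmetric]) simp
    define \<kappa> where "\<kappa> = inverse (al x) / R + w1 (axial_cosh x) * axial_cosh x * (inverse (ga x) * g + inverse (al x) / R)"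
    have "\<exists>\<mu>. H x = \<kappa> *\<^sub>R mat 1 + \<mu> *\<^sub>R outer u u"
    proof -
      have gen: "\<exists>\<mu>. (- 1) *\<^sub>R (l1 *\<^sub>R I + m1 *\<^sub>R (m2 *\<^sub>R Q)) +
          (y *\<^sub>R (l2 *\<^sub>R I + m3 *\<^sub>R (m4 *\<^sub>R Q) + (- 1) *\<^sub>R (l1 *\<^sub>R I + m1 *\<^sub>R (m2 *\<^sub>R Q))) + m5 *\<^sub>R (m6 *\<^sub>R Q))
          = (- l1 + y * (l2 - l1)) *\<^sub>R I + \<mu> *\<^sub>R Q"
        for l1 m1 m2 y l2 m3 m4 m5 m6 :: real and I Q :: "real ^ 'n ^ 'n"
        by (rule exI[of _ "- (m1 * m2) + y * (m3 * m4 - m1 * m2) + m5 * m6"]) (simp add: algebra_simps)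
      have \<kappa>': "\<kappa> = - (- inverse (al x) / R) + w1 (axial_cosh x) * axial_cosh x * (inverse (ga x) * g - (- inverse (al x) / R))"
        by (simp add: \<kappa>_def)
      show ?thesis unfolding H_def pair_hess_def a b TGu W1C[OF x] oo \<kappa>' by (rule gen)
    qed
    moreover have "al x * \<kappa> = 1 / R + w1 (axial_cosh x) * (g + axial_cosh x / R)"
    proof -
      have "al x * \<kappa> = (al x * inverse (al x)) / R + w1 (axial_cosh x) * ((al x * (axial_cosh x * inverse (ga x))) * g + axial_cosh x * (al x * inverse (al x)) / R)"
        unfolding \<kappa>_def by (simp add: algebra_simps)
      then show ?thesis unfolding inv[OF x] using pos(1)[OF x] by simp
    qed
    ultimately show "\<exists>\<kappa> \<mu>. H x = \<kappa> *\<^sub>R mat 1 + \<mu> *\<^sub>R outer u u \<and> al x * \<kappa> = 1 / R + w1 (axial_cosh x) * (g + axial_cosh x / R)"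
      by blast
  qed
qed

end

lemma tanh_artanh:
  fixes x :: real
  assumes "\<bar>x\<bar> < 1"
  shows "tanh (artanh x) = x"
proof -
  have x: "1 + x > 0" "1 - x > 0" using assms by auto
  have "exp (- 2 * artanh x) = (1 - x) / (1 + x)"
    using x by (simp add: artanh_def exp_minus)
  then have "tanh (artanh x) = (1 - (1 - x) / (1 + x)) / (1 + (1 - x) / (1 + x))"
    unfolding tanh_real_altdef by simp
  also have "\<dots> = x" using x by (simp add: field_simps)
  finally show ?thesis .
qed

section \<open>The axis in hyperbolic coordinates and the count\<close>

context eccentric_annulus begin

text \<open>The parameter is hyperbolic arc length from \<open>0\<close>.\<close>

definition axis_pt :: "real ^ 'n \<Rightarrow> real \<Rightarrow> real ^ 'n" where
  "axis_pt u z = (R * tanh (z / 2)) *\<^sub>R u"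

text \<open>l is the hyperbolic coordinate of the centre of the hole. The third identity says that
  the gradient along the axis, cleared of \<open>al\<close>, is the derivative studied
  above.\<close>

lemma axis_formulas:
  fixes z p :: real
  assumes u: "norm u = 1" and P: "P = p *\<^sub>R u" and l: "sinh l = p / (\<epsilon> * s)"
  shows "al (axis_pt u z) = R / (1 + cosh z)"
    "axial_cosh (axis_pt u z) = cosh (z - l)"
    "R * tanh (z / 2) * (1 / R + y * (g + cosh (z - l) / R)) - y * (p / (\<epsilon> * s)) = axial_derivative (\<lambda>_. y) l z"
proof -
  define t where "t = tanh (z / 2)"
  define h where "h = 1 + cosh z"
  have h: "h > 0" using cosh_real_ge_1[of z] by (simp add: h_def)
  have th: "t = sinh z / h" by (simp add: t_def h_def tanh_half)
  have sq: "sinh z * sinh z = h * (h - 2)"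
    using cosh_square_eq[of z] by (simp add: h_def power2_eq_square algebra_simps)
  have t1: "t * h = sinh z" "t\<^sup>2 * h = h - 2" using h sq by (simp_all add: th power2_eq_square)
  have uu: "u \<bullet> u = 1" using u by (simp add: dot_square_norm)
  have PP: "P \<bullet> P = p\<^sup>2" by (simp add: P uu power2_eq_square)
  note nz = R_pos eps_pos s_pos
  have cR: "2 * R * \<epsilon> * c = R\<^sup>2 + \<epsilon>\<^sup>2 - p\<^sup>2" using nz by (simp add: c_def PP)
  \<comment> \<open>This is cosh l: k^2 = 1 + sinh^2 l follows from s^2 = c^2 - 1, and positivity,
    from c < R / \<open>\<epsilon>\<close>, selects the root.\<close>
  define k where "k = (R\<^sup>2 + p\<^sup>2 - \<epsilon>\<^sup>2) / (2 * R * \<epsilon> * s)"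
  have k0: "k > 0"
  proof -
    have "c < R / \<epsilon>"
    proof (rule ccontr)
      assume "\<not> c < R / \<epsilon>"
      then have "R \<le> c * \<epsilon>" using nz by (simp add: field_simps)
      then have "2 * R * R \<le> 2 * R * (c * \<epsilon>)" using nz by (intro mult_left_mono) auto
      then have "R\<^sup>2 + p\<^sup>2 \<le> \<epsilon>\<^sup>2" using cR by (simp add: power2_eq_square algebra_simps)
      then have "R\<^sup>2 \<le> \<epsilon>\<^sup>2" by (smt (verit) zero_le_power2)
      then have "R \<le> \<epsilon>" using nz by (simp add: power2_le_iff_abs_le)
      then show False using hole_inside norm_ge_zero[of P] by linarith
    qed
    then have "c * \<epsilon> < R" using nz by (simp add: field_simps)
    then have "2 * R * (c * \<epsilon>) < 2 * R * R" using nz by (intro mult_strict_left_mono) auto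
    then have "R\<^sup>2 + p\<^sup>2 - \<epsilon>\<^sup>2 > 0" using cR by (simp add: power2_eq_square algebra_simps)
    then show ?thesis using nz by (simp add: k_def)
  qed
  have k2: "k\<^sup>2 = 1 + (p / (\<epsilon> * s))\<^sup>2"
  proof -
    have "(R\<^sup>2 + p\<^sup>2 - \<epsilon>\<^sup>2)\<^sup>2 = (2 * R * \<epsilon> * c)\<^sup>2 - (2 * R * \<epsilon>)\<^sup>2 + (2 * R * p)\<^sup>2"
      unfolding cR by (simp add: power2_eq_square algebra_simps)
    also have "\<dots> = (2 * R * \<epsilon>)\<^sup>2 * s\<^sup>2 + (2 * R * p)\<^sup>2"
      unfolding s_sq by (simp add: power_mult_distrib algebra_simps)
    finally have *: "(R\<^sup>2 + p\<^sup>2 - \<epsilon>\<^sup>2)\<^sup>2 = (2 * R * \<epsilon>)\<^sup>2 * s\<^sup>2 + (2 * R * p)\<^sup>2" .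
    have "k\<^sup>2 = ((2 * R * \<epsilon>)\<^sup>2 * s\<^sup>2 + (2 * R * p)\<^sup>2) / (2 * R * \<epsilon> * s)\<^sup>2"
      by (simp only: k_def power_divide *)
    also have "\<dots> = 1 + (p / (\<epsilon> * s))\<^sup>2"
      using nz by (simp add: add_divide_distrib power_mult_distrib power_divide)
    finally show ?thesis .
  qed
  have kl: "cosh l = k"
  proof -
    have "(cosh l)\<^sup>2 = k\<^sup>2" unfolding cosh_square_eq l k2 by simp
    then show ?thesis using k0 by (metis abs_of_pos cosh_real_pos power2_abs power2_eq_iff_nonneg order_less_imp_le)
  qed
  have gk: "g = k / R"
  proof -
    have "R / \<epsilon> - c = (R\<^sup>2 + p\<^sup>2 - \<epsilon>\<^sup>2) / (2 * R * \<epsilon>)"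
    proof -
      have "(R / \<epsilon> - c) * (2 * R * \<epsilon>) = 2 * R * R - 2 * R * \<epsilon> * c" using nz by (simp add: field_simps)
      also have "\<dots> = R\<^sup>2 + p\<^sup>2 - \<epsilon>\<^sup>2" unfolding cR by (simp add: power2_eq_square)
      finally show ?thesis using nz by (simp add: eq_divide_eq)
    qed
    then have Rs: "(R / \<epsilon> - c) / s = k" unfolding k_def by simp
    have "g = (1 / \<epsilon> - (e + 1 / e) / (2 * R)) / s"
      unfolding g_def kA_def kB_def using nz by (simp add: add_divide_distrib diff_divide_distrib)
    also have "\<dots> = ((R / \<epsilon> - c) / s) / R" unfolding e_inverse using nz by (simp add: field_simps)
    finally show ?thesis unfolding Rs .
  qed
  have y: "axis_pt u z = (R * t) *\<^sub>R u" by (simp add: axis_pt_def t_def)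
  have "al (axis_pt u z) = (R\<^sup>2 - (R * t)\<^sup>2) / (2 * R)" unfolding y al_def by (simp add: uu power2_eq_square)
  also have "\<dots> = R * (1 - t\<^sup>2) / 2" using nz by (simp add: power2_eq_square field_simps)
  also have "1 - t\<^sup>2 = 2 / h" using t1(2) h by (simp add: field_simps)
  finally have "al (axis_pt u z) = R / h" by simp
  then show al: "al (axis_pt u z) = R / (1 + cosh z)" unfolding h_def .
  have alpos: "al (axis_pt u z) > 0" unfolding al h_def[symmetric] using nz h by simp
  have "be (axis_pt u z) = ((R * t - p)\<^sup>2 - \<epsilon>\<^sup>2) / (2 * \<epsilon>)"
  proof -
    have "axis_pt u z - P = (R * t - p) *\<^sub>R u" unfolding y P by (simp add: scaleR_diff_left)
    then show ?thesis unfolding be_def by (simp add: uu power2_eq_square)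
  qed
  moreover have "axial_cosh (axis_pt u z) = (be (axis_pt u z) / al (axis_pt u z) + c) / s"
  proof -
    have AB: "A v + B v = 2 * (be v + c * al v) / s" for v
    proof -
      have "A v + B v = (2 * be v + (e + 1 / e) * al v) / s"
        unfolding A_def B_def by (simp add: add_divide_distrib algebra_simps)
      then show ?thesis unfolding e_inverse by (simp add: algebra_simps)
    qed
    show ?thesis unfolding axial_cosh_def AB using alpos nz by (simp add: field_simps)
  qed
  moreover have "((R * t - p)\<^sup>2 - \<epsilon>\<^sup>2) / (2 * \<epsilon>) / (R / h) + c = s * (cosh z * k - sinh z * (p / (\<epsilon> * s)))"
  proof -
    have "((R * t - p)\<^sup>2 - \<epsilon>\<^sup>2) * h = R\<^sup>2 * (t\<^sup>2 * h) - 2 * R * p * (t * h) + (p\<^sup>2 - \<epsilon>\<^sup>2) * h"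
      by (simp add: power2_eq_square algebra_simps)
    also have "\<dots> = (h - 1) * (R\<^sup>2 + p\<^sup>2 - \<epsilon>\<^sup>2) - 2 * R * p * sinh z - 2 * R * \<epsilon> * c"
      unfolding t1 cR by (simp add: algebra_simps)
    finally have *: "((R * t - p)\<^sup>2 - \<epsilon>\<^sup>2) * h = cosh z * (R\<^sup>2 + p\<^sup>2 - \<epsilon>\<^sup>2) - 2 * R * p * sinh z - 2 * R * \<epsilon> * c"
      by (simp add: h_def)
    have "((R * t - p)\<^sup>2 - \<epsilon>\<^sup>2) / (2 * \<epsilon>) / (R / h) + c = (((R * t - p)\<^sup>2 - \<epsilon>\<^sup>2) * h + 2 * R * \<epsilon> * c) / (2 * R * \<epsilon>)"
      using nz h by (simp add: field_simps)
    also have "\<dots> = (cosh z * (R\<^sup>2 + p\<^sup>2 - \<epsilon>\<^sup>2) - 2 * R * p * sinh z) / (2 * R * \<epsilon>)" unfolding * by simp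
    also have "\<dots> = s * (cosh z * k - sinh z * (p / (\<epsilon> * s)))"
      unfolding k_def using nz by (simp add: diff_divide_distrib right_diff_distrib)
    finally show ?thesis .
  qed
  ultimately show "axial_cosh (axis_pt u z) = cosh (z - l)"
    using nz by (simp add: al h_def[symmetric] cosh_diff kl l)
  show "R * tanh (z / 2) * (1 / R + y * (g + cosh (z - l) / R)) - y * (p / (\<epsilon> * s)) = axial_derivative (\<lambda>_. y) l z"
  proof -
    have "R * t * (1 / R + y * (g + cosh (z - l) / R)) - y * sinh l = t + y * (t * (k + cosh (z - l)) - sinh l)"
      unfolding gk using nz by (simp add: field_simps)
    also have "t * (k + cosh (z - l)) - sinh l = (t * h) * cosh l - (t * sinh z + 1) * sinh l"
      by (simp add: cosh_diff kl h_def algebra_simps)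
    also have "t * sinh z + 1 = cosh z"
    proof -
      have "t * sinh z = t\<^sup>2 * h" by (simp add: power2_eq_square t1(1)[symmetric])
      then have "t * sinh z + 1 = h - 1" unfolding t1(2) by simp
      then show ?thesis by (simp add: h_def)
    qed
    also have "(t * h) * cosh l - cosh z * sinh l = sinh (z - l)" unfolding t1 by (simp add: sinh_diff)
    finally show ?thesis unfolding axial_derivative_def l[symmetric] t_def[symmetric]
      by (simp add: th h_def)
  qed
qed

lemma axis_pt_in_Omega:
  assumes "norm u = 1" "P = p *\<^sub>R u" "sinh l = p / (\<epsilon> * s)"
  shows "axis_pt u z \<in> \<Omega> \<longleftrightarrow> cosh (z - l) > rmin e"
  unfolding Omega_iff_axial_cosh axis_formulas[OF assms] using R_pos cosh_real_ge_1[of z] by (simp add: add_pos_pos)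

lemma vA_axis: assumes "P = p *\<^sub>R u" shows "vA = (- (p / (\<epsilon> * s))) *\<^sub>R u"
proof -
  have "vA = (- 1 / (\<epsilon> * s)) *\<^sub>R (p *\<^sub>R u)"
    unfolding vA_def by (rule arg_cong[OF assms])
  then show ?thesis by simp
qed

lemma axis_gradient:
  assumes u: "norm u = 1" and P: "P = p *\<^sub>R u" and l: "sinh l = p / (\<epsilon> * s)"
    and G: "\<And>x. x \<in> \<Omega> \<Longrightarrow> al x *\<^sub>R G x = (1 / R + w1 (axial_cosh x) * (g + axial_cosh x / R)) *\<^sub>R x + w1 (axial_cosh x) *\<^sub>R vA"
    and z: "axis_pt u z \<in> \<Omega>"
  shows "(R / (1 + cosh z)) *\<^sub>R G (axis_pt u z) = axial_derivative w1 l z *\<^sub>R u"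
proof -
  have "axial_derivative w1 l z = axial_derivative (\<lambda>_. w1 (cosh (z - l))) l z" by (simp add: axial_derivative_def)
  also have "\<dots> = R * tanh (z / 2) * (1 / R + w1 (cosh (z - l)) * (g + cosh (z - l) / R)) - w1 (cosh (z - l)) * (p / (\<epsilon> * s))"
    by (rule axis_formulas(3)[OF u P l, symmetric])
  finally have *: "axial_derivative w1 l z = \<dots>" .
  show ?thesis using G[OF z]
    unfolding axis_formulas(1,2)[OF u P l] vA_axis[OF P] * by (simp add: axis_pt_def algebra_simps)
qed

lemma inj_axis_pt: assumes "norm u = 1" shows "inj (axis_pt u)"
proof (rule injI)
  fix x y assume "axis_pt u x = axis_pt u y"
  then have "R * tanh (x / 2) = R * tanh (y / 2)" using assms by (auto simp: axis_pt_def)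
  then show "x = y" using R_pos by simp
qed

text \<open>A vanishing gradient reads b x = k u. Since w1 < 0 and p is nonzero, k is nonzero; hence
  so is b, and x is a multiple of u.\<close>

lemma critical_points_on_axis:
  assumes u: "norm u = 1" and P: "P = p *\<^sub>R u" "p \<noteq> 0" and l: "sinh l = p / (\<epsilon> * s)"
    and w: "\<And>C. C > rmin e \<Longrightarrow> w1 C < 0"
    and G: "\<And>x. x \<in> \<Omega> \<Longrightarrow> al x *\<^sub>R G x = (1 / R + w1 (axial_cosh x) * (g + axial_cosh x / R)) *\<^sub>R x + w1 (axial_cosh x) *\<^sub>R vA"
  shows "{x \<in> \<Omega>. G x = 0} = axis_pt u ` {z. cosh (z - l) > rmin e \<and> axial_derivative w1 l z = 0}"
proof (intro equalityI subsetI)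
  fix x assume "x \<in> {x \<in> \<Omega>. G x = 0}"
  then have x: "x \<in> \<Omega>" "G x = 0" by auto
  define b where "b = 1 / R + w1 (axial_cosh x) * (g + axial_cosh x / R)"
  define k where "k = w1 (axial_cosh x) * (p / (\<epsilon> * s))"
  have "w1 (axial_cosh x) < 0" using w x Omega_iff_axial_cosh by blast
  then have k: "k \<noteq> 0" using P(2) eps_pos s_pos by (simp add: k_def)
  have bx: "b *\<^sub>R x = k *\<^sub>R u" using G[OF x(1)] x(2) unfolding vA_axis[OF P(1)] b_def k_def by simp
  have b: "b \<noteq> 0" using bx k u by auto
  have xt: "x = (k / b) *\<^sub>R u"
  proof -
    have "x = (1 / b) *\<^sub>R (b *\<^sub>R x)" using b by simp
    then show ?thesis unfolding bx by simp
  qed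
  \<comment> \<open>x lies in the ball, so artanh provides its coordinate on the axis.\<close>
  have "\<bar>k / b\<bar> < R"
  proof -
    have "al x > 0" using x Omega_iff_axial_cosh by blast
    then have "x \<bullet> x < R\<^sup>2" using R_pos by (simp add: al_def zero_less_divide_iff)
    then have "(k / b)\<^sup>2 < R\<^sup>2" using u by (simp add: xt dot_square_norm power2_eq_square)
    then show ?thesis using power2_less_imp_less[of "\<bar>k / b\<bar>" R] R_pos by (simp del: abs_divide)
  qed
  then have "\<bar>k / b / R\<bar> < 1" unfolding abs_divide[of "k / b" R] abs_of_pos[OF R_pos] pos_divide_less_eq[OF R_pos] by simp
  then have "tanh (artanh (k / b / R)) = k / b / R" by (rule tanh_artanh)
  then have xz: "x = axis_pt u (2 * artanh (k / b / R))" using R_pos by (simp add: axis_pt_def xt)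
  define z where "z = 2 * artanh (k / b / R)"
  have xz: "x = axis_pt u z" using xz by (simp add: z_def)
  have "axial_derivative w1 l z *\<^sub>R u = 0"
    using axis_gradient[OF u P(1) l G] x unfolding xz by force
  then have "axial_derivative w1 l z = 0" using u by auto
  moreover have "cosh (z - l) > rmin e" using axis_pt_in_Omega[OF u P(1) l] x(1) xz by simp
  ultimately show "x \<in> axis_pt u ` {z. cosh (z - l) > rmin e \<and> axial_derivative w1 l z = 0}" using xz by blast
next
  fix x assume "x \<in> axis_pt u ` {z. cosh (z - l) > rmin e \<and> axial_derivative w1 l z = 0}"
  then obtain z where z: "x = axis_pt u z" "cosh (z - l) > rmin e" "axial_derivative w1 l z = 0" by blast
  have x: "x \<in> \<Omega>" using axis_pt_in_Omega[OF u P(1) l] z by simp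
  have "(R / (1 + cosh z)) *\<^sub>R G x = 0" using axis_gradient[OF u P(1) l G, of z] x z by simp
  moreover have "R / (1 + cosh z) \<noteq> 0" using R_pos cosh_real_ge_1[of z] by simp
  ultimately show "x \<in> {x \<in> \<Omega>. G x = 0}" using x by simp
qed

text \<open>The derivative of the u-component of G along the axis is computed twice: by the chain
  rule it is a multiple of \<kappa> + \<mu>, and through \<open>axial_derivative\<close> it is D (1
  + cosh z) / R > 0.\<close>

lemma axial_second_derivative_nonzero:
  assumes u: "norm u = 1" and P: "P = p *\<^sub>R u" and l: "sinh l = p / (\<epsilon> * s)"
    and w: "radial_profile e w w1 w2"
    and G: "\<And>x. x \<in> \<Omega> \<Longrightarrow> al x *\<^sub>R G x = (1 / R + w1 (axial_cosh x) * (g + axial_cosh x / R)) *\<^sub>R x + w1 (axial_cosh x) *\<^sub>R vA"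
    and c2: "c2_with \<Omega> f G H"
    and z: "cosh (z - l) > rmin e" "axial_derivative w1 l z = 0"
    and H: "H (axis_pt u z) = \<kappa> *\<^sub>R mat 1 + \<mu> *\<^sub>R outer u u"
  shows "\<kappa> + \<mu> \<noteq> 0"
proof
  assume km: "\<kappa> + \<mu> = 0"
  have h: "1 + cosh y > 0" for y :: real using cosh_real_ge_1[of y] by linarith
  have x: "axis_pt u z \<in> \<Omega>" using axis_pt_in_Omega[OF u P l] z(1) by simp
  have uu: "u \<bullet> u = 1" using u by (simp add: dot_square_norm)
  let ?\<psi> = "\<lambda>y. G (axis_pt u y) \<bullet> u"
  \<comment> \<open>Only differentiability of the parametrisation counts; its speed k is multiplied
    by \<kappa> + \<mu> = 0.\<close>
  obtain k where k: "((\<lambda>y. R * tanh (y / 2)) has_real_derivative k) (at z)"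
  proof (rule that)
    have "cosh (z / 2) \<noteq> 0" by (metis cosh_real_pos less_irrefl)
    then show "((\<lambda>y. R * tanh (y / 2)) has_real_derivative R * ((1 - (tanh (z / 2))\<^sup>2) * (1 / 2))) (at z)"
      by (auto intro!: derivative_eq_intros)
  qed
  have dpt: "(axis_pt u has_derivative (\<lambda>t. (t * k) *\<^sub>R u)) (at z)"
    unfolding axis_pt_def[abs_def]
    using has_derivative_scaleR_left[OF k[unfolded has_field_derivative_def], of u] by (simp add: mult.commute)
  have "((\<lambda>y. G (axis_pt u y)) has_derivative (\<lambda>t. H (axis_pt u z) *v ((t * k) *\<^sub>R u))) (at z)"
    by (rule has_derivative_compose[OF dpt c2_withD(3)[OF c2 x]])
  then have "(?\<psi> has_derivative (\<lambda>t. (H (axis_pt u z) *v ((t * k) *\<^sub>R u)) \<bullet> u)) (at z)"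
    by (rule has_derivative_inner_left)
  moreover have "(H (axis_pt u z) *v ((t * k) *\<^sub>R u)) \<bullet> u = 0" for t
  proof -
    have "(H (axis_pt u z) *v ((t * k) *\<^sub>R u)) \<bullet> u = (t * k) * (\<kappa> + \<mu>)"
      unfolding H by (simp add: matrix_vector_mult_add_rdistrib scaleR_matrix_vector_assoc[symmetric]
          outer_mult_vec matrix_vector_mult_scaleR inner_add_left uu algebra_simps)
    then show ?thesis using km by simp
  qed
  ultimately have d0: "(?\<psi> has_real_derivative 0) (at z)" by (simp add: has_field_derivative_def lambda_zero[symmetric])
  obtain D where D: "(axial_derivative w1 l has_real_derivative D) (at z)" "D > 0"
    by (rule axial_derivative_has_derivative[OF w e_gt_1 z(1)])
  have "((\<lambda>y. axial_derivative w1 l y * ((1 + cosh y) / R)) has_real_derivative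
      D * ((1 + cosh z) / R) + sinh z / R * axial_derivative w1 l z) (at z)"
    using R_pos by (intro DERIV_mult D) (auto intro!: derivative_eq_intros)
  then have "((\<lambda>y. axial_derivative w1 l y * ((1 + cosh y) / R)) has_real_derivative D * ((1 + cosh z) / R)) (at z)"
    unfolding z(2) by simp
  then have "(?\<psi> has_real_derivative D * ((1 + cosh z) / R)) (at z)"
  proof (rule has_field_derivative_transform_within_open)
    show "open {y. cosh (y - l) > rmin e}" by (intro open_Collect_less continuous_intros)
    fix y assume "y \<in> {y. cosh (y - l) > rmin e}"
    then have y: "axis_pt u y \<in> \<Omega>" using axis_pt_in_Omega[OF u P l] by simp
    have "axial_derivative w1 l y = (axial_derivative w1 l y *\<^sub>R u) \<bullet> u" by (simp add: uu)
    also have "\<dots> = ((R / (1 + cosh y)) *\<^sub>R G (axis_pt u y)) \<bullet> u" by (simp only: axis_gradient[OF u P l G y])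
    also have "\<dots> = R / (1 + cosh y) * ?\<psi> y" by simp
    finally show "axial_derivative w1 l y * ((1 + cosh y) / R) = ?\<psi> y"
      using R_pos h[of y] by simp
  qed (use z in auto)
  from DERIV_unique[OF this d0] have "D * ((1 + cosh z) / R) = 0" by simp
  then show False using D(2) R_pos h[of z] by simp
qed

lemma exists_arsinh: "\<exists>l :: real. sinh l = y"
  by (rule exI[of _ "arsinh y"]) simp

theorem robin_critical_points:
  defines "Cr \<equiv> {x \<in> \<Omega>. critical_point (robin_function \<Omega>) x}"
  shows "P \<noteq> 0 \<Longrightarrow> card Cr = 2 \<and> (\<forall>x\<in>Cr. nondegenerate_critical_point (robin_function \<Omega>) x)"
    and "P = 0 \<Longrightarrow> infinite Cr"
proof -
  obtain F F1 F2 w w1 w2 where w: "radial_profile e w w1 w2" and F: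
    "\<And>z. (F has_real_derivative F1 z) (at z)" "\<And>z. (F1 has_real_derivative F2 z) (at z)" "\<And>z. F1 z > 0"
    "continuous_on UNIV F2" "\<And>x. x \<in> \<Omega> \<Longrightarrow> robin_function \<Omega> x = F (- ln (al x) + w (axial_cosh x))"
    by (rule robin_profile) (rule that, assumption+)
  obtain G H where c2: "c2_with \<Omega> (\<lambda>x. - ln (al x) + w (axial_cosh x)) G H"
    and G: "\<And>x. x \<in> \<Omega> \<Longrightarrow> al x *\<^sub>R G x = (1 / R + w1 (axial_cosh x) * (g + axial_cosh x / R)) *\<^sub>R x + w1 (axial_cosh x) *\<^sub>R vA"
    and H: "\<And>x u t k. x \<in> \<Omega> \<Longrightarrow> x = t *\<^sub>R u \<Longrightarrow> vA = k *\<^sub>R u \<Longrightarrow>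
       \<exists>\<kappa> \<mu>. H x = \<kappa> *\<^sub>R mat 1 + \<mu> *\<^sub>R outer u u \<and> al x * \<kappa> = 1 / R + w1 (axial_cosh x) * (g + axial_cosh x / R)"
    by (rule c2_with_potential[OF w]) (rule that, assumption+)
  let ?f = "\<lambda>x. - ln (al x) + w (axial_cosh x)"
  have "c2_with \<Omega> (\<lambda>x. F (?f x)) (\<lambda>x. F1 (?f x) *\<^sub>R G x) (\<lambda>x. F1 (?f x) *\<^sub>R H x + F2 (?f x) *\<^sub>R outer (G x) (G x))"
    by (rule c2_with_compose[OF c2 F(1,2) continuous_on_subset[OF F(4)]]) simp
  then have rob: "c2_with \<Omega> (robin_function \<Omega>) (\<lambda>x. F1 (?f x) *\<^sub>R G x) (\<lambda>x. F1 (?f x) *\<^sub>R H x + F2 (?f x) *\<^sub>R outer (G x) (G x))"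
    by (rule c2_with_cong) (simp add: F(5))
  have crit: "critical_point (robin_function \<Omega>) x \<longleftrightarrow> G x = 0" if "x \<in> \<Omega>" for x
    unfolding c2_with_critical_point[OF rob that] using F(3)[of "?f x"] by simp
  have Cr: "Cr = {x \<in> \<Omega>. G x = 0}" using crit by (auto simp: Cr_def)
  have w1: "w1 C < 0" if "C > rmin e" for C using w that by (auto simp: radial_profile_def)
  show "card Cr = 2 \<and> (\<forall>x\<in>Cr. nondegenerate_critical_point (robin_function \<Omega>) x)" if P0: "P \<noteq> 0"
  proof -
    define u where "u = (1 / norm P) *\<^sub>R P"
    define p where "p = norm P"
    have u: "norm u = 1" and P: "P = p *\<^sub>R u" and p: "p \<noteq> 0" using P0 by (simp_all add: u_def p_def)
    obtain l where l: "sinh l = p / (\<epsilon> * s)" using exists_arsinh by blast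
    obtain z1 z2 where z: "z1 \<noteq> z2" "{z. cosh (z - l) > rmin e \<and> axial_derivative w1 l z = 0} = {z1, z2}"
      by (rule axial_derivative_zeros[OF w e_gt_1])
    have Crz: "Cr = axis_pt u ` {z. cosh (z - l) > rmin e \<and> axial_derivative w1 l z = 0}"
      unfolding Cr by (rule critical_points_on_axis[OF u P p l w1 G])
    have "card Cr = card {z1, z2}"
      unfolding Crz z(2) by (rule card_image) (use inj_axis_pt[OF u] inj_on_subset in blast)
    then have "card Cr = 2" using z(1) by simp
    moreover have "nondegenerate_critical_point (robin_function \<Omega>) x" if x: "x \<in> Cr" for x
    proof -
      have xO: "x \<in> \<Omega>" and G0: "G x = 0" using x Cr by auto
      obtain z where z: "x = axis_pt u z" "cosh (z - l) > rmin e" "axial_derivative w1 l z = 0"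
        using x unfolding Crz by blast
      obtain \<kappa> \<mu> where km: "H x = \<kappa> *\<^sub>R mat 1 + \<mu> *\<^sub>R outer u u" "al x * \<kappa> = 1 / R + w1 (axial_cosh x) * (g + axial_cosh x / R)"
        using H[OF xO z(1)[unfolded axis_pt_def] vA_axis[OF P]] by blast
      have Cx: "axial_cosh x > rmin e" using xO Omega_iff_axial_cosh by blast
      \<comment> \<open>If \<kappa> were 0, the x-term of the gradient equation would vanish and
        leave w1 \<open>vA\<close> = 0, impossible for a hole not centred at 0.\<close>
      have "\<kappa> \<noteq> 0"
      proof
        assume "\<kappa> = 0"
        then have "w1 (axial_cosh x) *\<^sub>R vA = 0" using G[OF xO] G0 km(2) by simp
        then have "vA = 0" using w1[OF Cx] by simp
        then show False unfolding vA_axis[OF P] using p eps_pos s_pos u by auto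
      qed
      moreover have "\<kappa> + \<mu> \<noteq> 0"
        by (rule axial_second_derivative_nonzero[OF u P l w G c2 z(2,3) km(1)[unfolded z(1)]])
      ultimately have kk: "F1 (?f x) * \<kappa> \<noteq> 0" "F1 (?f x) * \<kappa> + F1 (?f x) * \<mu> \<noteq> 0"
        using F(3)[of "?f x"] by (simp_all add: distrib_left[symmetric])
      \<comment> \<open>At a critical point the term with \<open>F2\<close> disappears, so the
        Hessian is merely rescaled by \<open>F1\<close> > 0.\<close>
      have "outer 0 (0 :: real ^ 'n) = 0" by (simp add: outer_def vec_eq_iff)
      then have "hessian (robin_function \<Omega>) x = transpose ((F1 (?f x) * \<kappa>) *\<^sub>R mat 1 + (F1 (?f x) * \<mu>) *\<^sub>R outer u u)"
        unfolding c2_with_hessian[OF rob xO] G0 km(1) by (simp add: scaleR_add_right)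
      then have "invertible (hessian (robin_function \<Omega>) x)"
        unfolding transpose_rank_one_update using invertible_rank_one_update[OF u kk] by simp
      then show ?thesis
        unfolding nondegenerate_critical_point_def using crit[OF xO] G0 c2_with_C2_on[OF rob] open_Omega xO by blast
    qed
    ultimately show ?thesis by blast
  qed
  show "infinite Cr" if P0: "P = 0"
  proof -
    obtain z1 z2 where z: "{z. cosh (z - 0) > rmin e \<and> axial_derivative w1 0 z = 0} = {z1, z2}"
      by (rule axial_derivative_zeros[OF w e_gt_1])
    then have z1: "cosh (z1 - 0) > rmin e" "axial_derivative w1 0 z1 = 0" by blast+
    \<comment> \<open>Needed so that the critical sphere does not shrink to a point: cosh 0 = 1 <
      \<open>rmin e\<close>.\<close>
    have z10: "z1 \<noteq> 0" using z1(1) rmin_gt_1[OF e_gt_1] by auto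
    have l: "sinh 0 = (0 :: real) / (\<epsilon> * s)" by simp
    have "axis_pt u z1 \<in> Cr" if u: "norm u = 1" for u
    proof -
      \<comment> \<open>For P = 0 every unit vector spans an axis with l = 0, so one zero of the
        derivative produces a whole sphere of critical points.\<close>
      have P: "P = 0 *\<^sub>R u" using P0 by simp
      have x: "axis_pt u z1 \<in> \<Omega>" using axis_pt_in_Omega[OF u P l] z1(1) by simp
      have "(R / (1 + cosh z1)) *\<^sub>R G (axis_pt u z1) = 0" using axis_gradient[OF u P l G x] z1(2) by simp
      moreover have "R / (1 + cosh z1) \<noteq> 0" using R_pos cosh_real_ge_1[of z1] by simp
      ultimately show ?thesis using x Cr by simp
    qed
    then have "(\<lambda>u. axis_pt u z1) ` {u. norm u = 1} \<subseteq> Cr" by blast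
    moreover have "inj_on (\<lambda>u. axis_pt u z1) {u. norm u = 1}"
      using R_pos z10 by (auto simp: inj_on_def axis_pt_def)
    then have "infinite ((\<lambda>u. axis_pt u z1) ` {u. norm u = 1})"
      using infinite_unit_sphere[OF dim] finite_imageD by blast
    ultimately show ?thesis using finite_subset by blast
  qed
qed

end

theorem corollary1p7:
  fixes R :: real and P :: "real ^ 'n"
  assumes "CARD('n) \<ge> 2" and "R > 0" and "P \<in> ball 0 R"
  shows "\<forall>\<^sub>F \<epsilon> in at_right 0.
           let \<Omega>\<^sub>\<epsilon> = ball 0 R - cball P \<epsilon>;
               C = {x \<in> \<Omega>\<^sub>\<epsilon>. critical_point (robin_function \<Omega>\<^sub>\<epsilon>) x}
           in (P \<noteq> 0 \<longrightarrow> card C = 2 \<and>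
                 (\<forall>x\<in>C. nondegenerate_critical_point (robin_function \<Omega>\<^sub>\<epsilon>) x)) \<and>
              (P = 0 \<longrightarrow> infinite C)"
proof -
  have "R - norm P > 0" using assms(3) by simp
  \<comment> \<open>Smallness of \<open>\<epsilon>\<close> means no more than that the closed hole
    stays inside the ball.\<close>
  then have "\<forall>\<^sub>F \<epsilon> in at_right 0. \<epsilon> \<in> {0<..<R - norm P}" by (rule eventually_at_right_real)
  then show ?thesis
  proof eventually_elim
    case (elim \<epsilon>)
    interpret eccentric_annulus R \<epsilon> P by unfold_locales (use elim assms(1) in auto)
    show ?case unfolding Let_def \<Omega>_def[symmetric] using robin_critical_points by blast
  qed
qed

end
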